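(* For every $\delta>0$ there is $n_0$ such that for all $n\ge n_0$: the total number of intersection points between $n$ pairwise intersecting closed convex curves in general position in the plane is at least $(1-\delta)n^2$. (That is, it is at least $(1-o(1))n^2$.)
   Context: A closed convex curve is the boundary of a bounded convex region with nonempty interior in the plane. A family of curves is in general position if no three curves pass through the same point and no two curves share infinitely many points. Two curves touch if they have precisely one point in common, at which they do not properly cross; this point is a touching point. All other common points of two curves are crossing points. An intersection point is a touching point or a crossing point. Two curves intersect if they share at least one point. *)

theory Defs
  imports "HOL-Analysis.Analysis"
begin

definition closed_convex_curve :: "(real^2) set \<Rightarrow> bool" where
  "closed_convex_curve C \<longleftrightarrow>
     (\<exists>K. convex K \<and> bounded K \<and> interior K \<noteq> {} \<and> C = frontier K)"

text \<open>A family of curves is a set of curves: repeating a curve would violate general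
  position anyway, since a closed convex curve is infinite.\<close>

definition general_position :: "(real^2) set set \<Rightarrow> bool" where
  "general_position F \<longleftrightarrow>
     (\<forall>C\<in>F. \<forall>D\<in>F. \<forall>E\<in>F. C \<noteq> D \<and> C \<noteq> E \<and> D \<noteq> E \<longrightarrow> C \<inter> D \<inter> E = {}) \<and>
     (\<forall>C\<in>F. \<forall>D\<in>F. C \<noteq> D \<longrightarrow> finite (C \<inter> D))"

definition curves_intersect :: "(real^2) set \<Rightarrow> (real^2) set \<Rightarrow> bool" where
  "curves_intersect C D \<longleftrightarrow> C \<inter> D \<noteq> {}"

text \<open>At an isolated common point \<open>p\<close> of two simple closed curves, the curve \<open>C\<close> passes from one
  side of \<open>D\<close> to the other iff arbitrarily close to \<open>p\<close> it meets both components of the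
  complement of \<open>D\<close>.\<close>

definition properly_cross_at :: "(real^2) set \<Rightarrow> (real^2) set \<Rightarrow> real^2 \<Rightarrow> bool" where
  "properly_cross_at C D p \<longleftrightarrow> p \<in> C \<inter> D \<and>
     (\<forall>e>0. C \<inter> inside D \<inter> ball p e \<noteq> {} \<and> C \<inter> outside D \<inter> ball p e \<noteq> {})"

definition touching_point :: "(real^2) set \<Rightarrow> (real^2) set \<Rightarrow> real^2 \<Rightarrow> bool" where
  "touching_point C D p \<longleftrightarrow> C \<inter> D = {p} \<and> \<not> properly_cross_at C D p"

definition crossing_point :: "(real^2) set \<Rightarrow> (real^2) set \<Rightarrow> real^2 \<Rightarrow> bool" where
  "crossing_point C D p \<longleftrightarrow> p \<in> C \<inter> D \<and> \<not> touching_point C D p"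

definition intersection_point :: "(real^2) set \<Rightarrow> (real^2) set \<Rightarrow> real^2 \<Rightarrow> bool" where
  "intersection_point C D p \<longleftrightarrow> touching_point C D p \<or> crossing_point C D p"

definition intersection_points :: "(real^2) set set \<Rightarrow> (real^2) set" where
  "intersection_points F = {p. \<exists>C\<in>F. \<exists>D\<in>F. C \<noteq> D \<and> intersection_point C D p}"

end

theory Submission imports Defs begin

text \<open>
  Every intersection point lies on exactly two curves, so there are at least \<open>n\<^sup>2 - n\<close> of them minus the
  number of pairs that meet in a single point; such pairs touch. It remains to show that \<open>n\<close> pairwise
  intersecting curves with at most \<open>n\<^sup>2\<close> intersection points have only \<open>o(n\<^sup>2)\<close> touching pairs. Since the
  projections to the first axis pairwise intersect, some vertical line meets all curves; on either side of
  it the curves split into upper and lower arcs, which are graphs of functions. Recording the vertical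
  order of the arcs between consecutive intersections gives a sequence of linear orders, in which a
  crossing is an inversion between consecutive orders, and a touching is a pair that is never inverted
  and is adjacent at some time.

  For such sequences on a set of size \<open>n\<close>, for every \<open>\<delta> > 0\<close> the number of touchings is at most \<open>\<delta>\<close> times
  the number of crossings plus \<open>O(n)\<close>. Call a lens two successive crossings of the same pair with boundedly
  many items entering between them. Without lenses, cutting the order into blocks of \<open>k\<^sup>2\<close> consecutive
  positions, and time into intervals in which few items enter the block, leaves touching graphs free of
  four-cycles in each piece, so the number of touchings is at most \<open>O(1/k)\<close> times the number of crossings,
  up to \<open>O(n)\<close>. If lenses abound, pass to a sparse random sample: touchings and crossings scale alike, but a
  sampled lens is mostly empty and its two crossings can be removed. So any slope \<open>\<rho> > \<delta>\<close> in the bound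
  can be improved, and iterating leads to \<open>\<delta>\<close>.
\<close>

subsection \<open>Sequences of heights and surgery on lenses\<close>

text \<open>The slope \<open>O(1/k)\<close> comes from the following balance. A crossing changes two
  ranks by one, so \<open>X\<close> crossings cause, on average over the offset, at most
  \<open>2 X / M\<close> entries into strips of \<open>M = k^2\<close> positions, hence about
  \<open>2 X / M^2\<close> cells beyond one per strip. A cell meets at most \<open>2 M\<close>
  pieces of items, and a graph on them without four-cycles has at most \<open>4 k^3\<close> edges,
  which makes \<open>8 X / k\<close> touchings. The trivial bound \<open>4 M^2\<close> per cell
  would give a slope independent of \<open>k\<close>; the smaller exponent is what counts. A cell
  with a lens has no such saving, and lenses may be about as frequent as crossings, so the first
  available slope is huge. Two opposite estimates are therefore combined: one loses with the number
  of lenses, the other gains with it. Sampling at rate \<open>q\<close> scales touchings, crossings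
  and lenses by about \<open>q^2\<close> but items by \<open>q\<close>, so each round multiplies the
  constant of the linear term by about \<open>1 / q\<close>. This is harmless: the number of rounds
  depends on \<delta> only, and a term linear in the number of curves vanishes against its
  square.\<close>

definition crossings :: "'a set \<Rightarrow> nat \<Rightarrow> (nat \<Rightarrow> 'a \<Rightarrow> real) \<Rightarrow> (nat \<times> 'a \<times> 'a) set" where
  "crossings V m h =
     {(t, i, j). t < m \<and> i \<in> V \<and> j \<in> V \<and> h t i < h t j \<and> h (Suc t) j < h (Suc t) i}"

definition touches_at :: "'a set \<Rightarrow> nat \<Rightarrow> (nat \<Rightarrow> 'a \<Rightarrow> real) \<Rightarrow> 'a \<Rightarrow> 'a \<Rightarrow> nat \<Rightarrow> bool" where
  "touches_at V m h i j t \<longleftrightarrow>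
     t \<le> m \<and> h t i < h t j \<and> (\<forall>k\<in>V. \<not> (h t i < h t k \<and> h t k < h t j))"

definition touches :: "'a set \<Rightarrow> nat \<Rightarrow> (nat \<Rightarrow> 'a \<Rightarrow> real) \<Rightarrow> ('a \<times> 'a) set" where
  "touches V m h =
     {(i, j). i \<in> V \<and> j \<in> V \<and> (\<forall>t\<le>m. h t i < h t j) \<and> (\<exists>t. touches_at V m h i j t)}"

definition between :: "'a set \<Rightarrow> (nat \<Rightarrow> 'a \<Rightarrow> real) \<Rightarrow> 'a \<Rightarrow> 'a \<Rightarrow> nat \<Rightarrow> nat \<Rightarrow> 'a set" where
  "between V h i j s e = {k \<in> V. \<exists>t. s < t \<and> t < e \<and> h t j < h t k \<and> h t k < h t i}"

definition lens_until ::
    "nat \<Rightarrow> 'a set \<Rightarrow> nat \<Rightarrow> (nat \<Rightarrow> 'a \<Rightarrow> real) \<Rightarrow> nat \<Rightarrow> 'a \<Rightarrow> 'a \<Rightarrow> nat \<Rightarrow> bool" where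
  "lens_until A V m h s i j e \<longleftrightarrow>
     Suc s < e \<and> e \<le> m \<and> h e i < h e j \<and> (\<forall>t. s < t \<and> t < e \<longrightarrow> h t j < h t i) \<and>
     card (between V h i j s e) \<le> A"

text \<open>A lens is counted at its opening crossing only, so lenses never outnumber crossings;
  this gives the iteration its starting slope.\<close>

definition lenses :: "nat \<Rightarrow> 'a set \<Rightarrow> nat \<Rightarrow> (nat \<Rightarrow> 'a \<Rightarrow> real) \<Rightarrow> (nat \<times> 'a \<times> 'a) set" where
  "lenses A V m h = {(s, i, j) \<in> crossings V m h. \<exists>e. lens_until A V m h s i j e}"

definition height_system :: "'a set \<Rightarrow> nat \<Rightarrow> (nat \<Rightarrow> 'a \<Rightarrow> real) \<Rightarrow> bool" where
  "height_system V m h \<longleftrightarrow> finite V \<and> (\<forall>t\<le>m. inj_on (h t) V)"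

definition height_rank :: "'a set \<Rightarrow> (nat \<Rightarrow> 'a \<Rightarrow> real) \<Rightarrow> nat \<Rightarrow> 'a \<Rightarrow> nat" where
  "height_rank V h t i = card {k \<in> V. h t k < h t i}"

text \<open>With at most \<open>A\<close> items inside a lens, its two items differ in rank by at
  most \<open>Suc A\<close> while it lasts. So every possible lens partner of \<open>i\<close> at
  time \<open>t\<close> lies in this set, whose size is bounded in terms of \<open>A\<close>
  alone.\<close>

definition near :: "nat \<Rightarrow> 'a set \<Rightarrow> (nat \<Rightarrow> 'a \<Rightarrow> real) \<Rightarrow> nat \<Rightarrow> 'a \<Rightarrow> 'a set" where
  "near A V h t i =
     {k \<in> V. height_rank V h t k \<le> height_rank V h t i + Suc A \<and> height_rank V h t i \<le> height_rank V h t k + Suc A}"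

lemma finite_crossings: "finite V \<Longrightarrow> finite (crossings V m h)"
  by (rule finite_subset[of _ "{..<m} \<times> V \<times> V"]) (auto simp: crossings_def)

lemma finite_touches: "finite V \<Longrightarrow> finite (touches V m h)"
  by (rule finite_subset[of _ "V \<times> V"]) (auto simp: touches_def)

lemma lenses_subset_crossings: "lenses A V m h \<subseteq> crossings V m h"
  by (auto simp: lenses_def)

lemma finite_lenses: "finite V \<Longrightarrow> finite (lenses A V m h)"
  using lenses_subset_crossings finite_crossings by (rule finite_subset)

lemma height_rank_less_iff:
  assumes "finite V" "i \<in> V" "j \<in> V"
  shows "height_rank V h t i < height_rank V h t j \<longleftrightarrow> h t i < h t j"
proof -
  have *: "height_rank V h t i < height_rank V h t j" if "h t i < h t j" "i \<in> V" for i j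
    unfolding height_rank_def using that assms(1)
    by (intro psubset_card_mono) (auto 0 4)
  have **: "height_rank V h t i \<le> height_rank V h t j" if "h t i \<le> h t j" for i j
    unfolding height_rank_def using that assms(1) by (intro card_mono) auto
  show ?thesis
    using *[of i j] **[of j i] assms by (meson not_le)
qed

lemma height_rank_inj_on:
  assumes "finite V" "inj_on (h t) V"
  shows "inj_on (height_rank V h t) V"
  using assms height_rank_less_iff[OF assms(1)] unfolding inj_on_def
  by (metis linorder_neqE_linordered_idom nat_neq_iff)

lemma height_rank_eq_between:
  assumes "finite V" "inj_on (h t) V" "i \<in> V" "j \<in> V" "h t i < h t j"
  shows "height_rank V h t j = height_rank V h t i + Suc (card {k \<in> V. h t i < h t k \<and> h t k < h t j})"
proof -
  have "{k \<in> V. h t k < h t j} =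
      {k \<in> V. h t k < h t i} \<union> insert i {k \<in> V. h t i < h t k \<and> h t k < h t j}"
    using assms by (auto simp: inj_on_def) (metis linorder_neqE_linordered_idom)
  also have "card \<dots> = card {k \<in> V. h t k < h t i} +
      card (insert i {k \<in> V. h t i < h t k \<and> h t k < h t j})"
    using assms(1) by (intro card_Un_disjoint) auto
  finally show ?thesis using assms(1) by (simp add: height_rank_def)
qed

lemma card_near:
  assumes "finite V" "inj_on (h t) V"
  shows "card (near A V h t i) \<le> 2 * A + 3"
proof -
  have "card (near A V h t i) \<le> card {height_rank V h t i - Suc A .. height_rank V h t i + Suc A}"
    by (rule card_inj_on_le[of "height_rank V h t"])
      (use height_rank_inj_on[OF assms(1), of h t] assms(2) in \<open>auto simp: near_def inj_on_def\<close>)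
  then show ?thesis by simp
qed

lemma lens_between_at:
  assumes "finite V" "lens_until A V m h s i j e" "s < t" "t < e"
  shows "card {k \<in> V. h t j < h t k \<and> h t k < h t i} \<le> A"
proof -
  have "card {k \<in> V. h t j < h t k \<and> h t k < h t i} \<le> card (between V h i j s e)"
    using assms by (intro card_mono) (auto simp: between_def)
  then show ?thesis using assms(2) by (simp add: lens_until_def)
qed

lemma lens_near:
  assumes "height_system V m h" "lens_until A V m h s i j e" "s < t" "t < e" "i \<in> V" "j \<in> V"
  shows "i \<in> near A V h t j" "j \<in> near A V h t i"
proof -
  have "h t j < h t i" "t \<le> m" using assms by (auto simp: lens_until_def)
  with assms have "height_rank V h t i = height_rank V h t j + Suc (card {k \<in> V. h t j < h t k \<and> h t k < h t i})"
    by (intro height_rank_eq_between) (auto simp: height_system_def)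
  moreover have "card {k \<in> V. h t j < h t k \<and> h t k < h t i} \<le> A"
    using assms by (intro lens_between_at) (auto simp: height_system_def)
  ultimately show "i \<in> near A V h t j" "j \<in> near A V h t i"
    using assms by (auto simp: near_def)
qed

definition lens_end :: "nat \<Rightarrow> 'a set \<Rightarrow> nat \<Rightarrow> (nat \<Rightarrow> 'a \<Rightarrow> real) \<Rightarrow> nat \<Rightarrow> 'a \<Rightarrow> 'a \<Rightarrow> nat" where
  "lens_end A V m h s i j = (SOME e. lens_until A V m h s i j e)"

definition touch_time :: "'a set \<Rightarrow> nat \<Rightarrow> (nat \<Rightarrow> 'a \<Rightarrow> real) \<Rightarrow> 'a \<Rightarrow> 'a \<Rightarrow> nat" where
  "touch_time V m h i j = (SOME t. touches_at V m h i j t)"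

text \<open>The items whose presence in a sample would spoil the surgery on a lens: those entering it,
  and those so close to it at its start that they could share another active lens with it.\<close>

definition lens_conflict :: "nat \<Rightarrow> 'a set \<Rightarrow> nat \<Rightarrow> (nat \<Rightarrow> 'a \<Rightarrow> real) \<Rightarrow> nat \<Rightarrow> 'a \<Rightarrow> 'a \<Rightarrow> 'a set" where
  "lens_conflict A V m h s i j =
     between V h i j s (lens_end A V m h s i j) \<union> near A V h (Suc s) i \<union> near A V h (Suc s) j - {i, j}"

text \<open>Every item that a lens could exchange with \<open>i\<close> or \<open>j\<close> at the
  chosen touching time. If the sample avoids them, the surgery leaves both in place at that time and
  their adjacency survives.\<close>

definition touch_conflict :: "nat \<Rightarrow> 'a set \<Rightarrow> nat \<Rightarrow> (nat \<Rightarrow> 'a \<Rightarrow> real) \<Rightarrow> 'a \<Rightarrow> 'a \<Rightarrow> 'a set" where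
  "touch_conflict A V m h i j =
     near A V h (touch_time V m h i j) i \<union> near A V h (touch_time V m h i j) j - {i, j}"

lemma lens_end:
  assumes "(s, i, j) \<in> lenses A V m h"
  shows "lens_until A V m h s i j (lens_end A V m h s i j)"
  unfolding lens_end_def by (rule someI_ex) (use assms in \<open>auto simp: lenses_def\<close>)

lemma touch_time:
  assumes "(i, j) \<in> touches V m h"
  shows "touches_at V m h i j (touch_time V m h i j)"
  unfolding touch_time_def by (rule someI_ex) (use assms in \<open>auto simp: touches_def\<close>)

lemma card_lens_conflict:
  assumes sys: "height_system V m h" and l: "(s, i, j) \<in> lenses A V m h"
  shows "card (lens_conflict A V m h s i j) \<le> 5 * A + 6"
proof -
  let ?e = "lens_end A V m h s i j"
  have u: "lens_until A V m h s i j ?e" using lens_end[OF l] .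
  have fin: "finite V" and inj: "inj_on (h (Suc s)) V"
    using sys u by (auto simp: height_system_def lens_until_def)
  have f: "finite (between V h i j s ?e)" "\<And>i. finite (near A V h (Suc s) i)"
    using fin by (auto simp: between_def near_def)
  have "card (lens_conflict A V m h s i j)
      \<le> card (between V h i j s ?e \<union> near A V h (Suc s) i \<union> near A V h (Suc s) j)"
    unfolding lens_conflict_def using f by (intro card_mono) auto
  also have "\<dots> \<le> card (between V h i j s ?e) + card (near A V h (Suc s) i) + card (near A V h (Suc s) j)"
    by (meson card_Un_le add_mono le_refl order_trans)
  also have "\<dots> \<le> A + (2 * A + 3) + (2 * A + 3)"
    using u card_near[OF fin, of h "Suc s", OF inj] by (intro add_mono) (auto simp: lens_until_def)
  finally show ?thesis by simp
qed

text \<open>Two neighbourhoods give \<open>4 * A + 6\<close>; the weaker constant is that of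
  \<open>card_lens_conflict\<close>, so that sampling has a single loss factor.\<close>

lemma card_touch_conflict:
  assumes sys: "height_system V m h" and l: "(i, j) \<in> touches V m h"
  shows "card (touch_conflict A V m h i j) \<le> 5 * A + 6"
proof -
  let ?t = "touch_time V m h i j"
  have fin: "finite V" and inj: "inj_on (h ?t) V"
    using sys touch_time[OF l] by (auto simp: height_system_def touches_at_def)
  have f: "\<And>i. finite (near A V h ?t i)"
    using fin by (auto simp: near_def)
  have "card (touch_conflict A V m h i j) \<le> card (near A V h ?t i \<union> near A V h ?t j)"
    unfolding touch_conflict_def using f by (intro card_mono) auto
  also have "\<dots> \<le> card (near A V h ?t i) + card (near A V h ?t j)"
    by (rule card_Un_le)
  also have "\<dots> \<le> (2 * A + 3) + (2 * A + 3)"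
    using card_near[OF fin, of h ?t, OF inj] by (intro add_mono) auto
  finally show ?thesis by simp
qed

text \<open>Exchanging the two items of each good lens while it lasts removes its two crossings and no
  other relation changes, because no sampled item ever lies between them. The asymmetric relation
  \<open>Q\<close> rules out lenses of the same pair that share a crossing.\<close>

lemma lens_surgery:
  fixes A :: nat
  assumes sys: "height_system V m h" and SV: "S \<subseteq> V"
    and Q: "\<And>i j. Q i j \<Longrightarrow> \<not> Q j i"
  defines "GL \<equiv> {(s, i, j) \<in> lenses A V m h. Q i j \<and> {i, j} \<subseteq> S \<and> lens_conflict A V m h s i j \<inter> S = {}}"
  shows "\<exists>h'. height_system S m h' \<and>
     card (crossings S m h') + 2 * card GL \<le> card {(t, i, j) \<in> crossings V m h. {i, j} \<subseteq> S} \<and>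
     {(i, j) \<in> touches V m h. {i, j} \<subseteq> S \<and> touch_conflict A V m h i j \<inter> S = {}} \<subseteq> touches S m h'"
proof -
  define en where "en = lens_end A V m h"
  define act where "act t i j \<longleftrightarrow> (\<exists>s. (s, i, j) \<in> GL \<and> s < t \<and> t < en s i j)" for t i j
  define par where "par t i j \<longleftrightarrow> act t i j \<or> act t j i" for t i j
  have finV: "finite V" and injV: "\<And>t. t \<le> m \<Longrightarrow> inj_on (h t) V"
    using sys by (auto simp: height_system_def)
  have GL_D: "lens_until A V m h s i j (en s i j) \<and> i \<in> S \<and> j \<in> S \<and> i \<noteq> j \<and> i \<in> V \<and> j \<in> V \<and>
      h s i < h s j \<and> Q i j \<and> s < m \<and> (s, i, j) \<in> crossings V m h \<and>
      (\<forall>k\<in>S. k \<in> lens_conflict A V m h s i j \<longrightarrow> False) \<and>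
      lens_conflict A V m h s i j = between V h i j s (en s i j) \<union> near A V h (Suc s) i \<union> near A V h (Suc s) j - {i, j}"
    if "(s, i, j) \<in> GL" for s i j
    using that lens_end[of s i j A V m h] SV
    by (auto simp: GL_def en_def lenses_def crossings_def lens_conflict_def)
  have act_D: "h t j < h t i \<and> i \<in> S \<and> j \<in> S \<and> t \<le> m \<and> i \<noteq> j \<and> Q i j \<and>
      (\<forall>k\<in>S. \<not> (h t j < h t k \<and> h t k < h t i))" if a: "act t i j" for t i j
  proof -
    obtain s where s: "(s, i, j) \<in> GL" "s < t" "t < en s i j" using a by (auto simp: act_def)
    note G = GL_D[OF s(1)]
    have "k \<in> lens_conflict A V m h s i j" if "k \<in> S" "h t j < h t k" "h t k < h t i" for k
      using G that s SV by (auto simp: between_def)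
    with G s show ?thesis by (auto simp: lens_until_def)
  qed
  have par_sym: "par t i j \<longleftrightarrow> par t j i" for t i j by (auto simp: par_def)
  have par_D: "i \<in> S \<and> j \<in> S \<and> t \<le> m \<and> i \<noteq> j" if "par t i j" for t i j
    using that act_D[of t i j] act_D[of t j i] by (auto simp: par_def)
  \<comment> \<open>What uniqueness of partners rests on, symmetric in the two items: throughout the
    lens \<open>v\<close> stays near \<open>u\<close>, and at its first time \<open>u\<close> has no
    sampled item near it except \<open>v\<close>.\<close>
  have par_lens: "\<exists>s e. s < t \<and> t < e \<and> (\<forall>d. s < d \<and> d < e \<longrightarrow> v \<in> near A V h d u) \<and>
      (\<forall>k\<in>S. k \<in> near A V h (Suc s) u \<longrightarrow> k = u \<or> k = v)" if p: "par t u v" for t u v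
  proof -
    from p consider "act t u v" | "act t v u" by (auto simp: par_def)
    then show ?thesis
    proof cases
      case 1
      then obtain s where s: "(s, u, v) \<in> GL" "s < t" "t < en s u v" by (auto simp: act_def)
      note G = GL_D[OF s(1)]
      have "\<forall>d. s < d \<and> d < en s u v \<longrightarrow> v \<in> near A V h d u"
        using lens_near(2)[OF sys] G by blast
      moreover have "\<forall>k\<in>S. k \<in> near A V h (Suc s) u \<longrightarrow> k = u \<or> k = v" using G by blast
      ultimately show ?thesis using s by blast
    next
      case 2
      then obtain s where s: "(s, v, u) \<in> GL" "s < t" "t < en s v u" by (auto simp: act_def)
      note G = GL_D[OF s(1)]
      have "\<forall>d. s < d \<and> d < en s v u \<longrightarrow> v \<in> near A V h d u"
        using lens_near(1)[OF sys] G by blast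
      moreover have "\<forall>k\<in>S. k \<in> near A V h (Suc s) u \<longrightarrow> k = u \<or> k = v" using G by blast
      ultimately show ?thesis using s by blast
    qed
  qed
  have par_near: "v \<in> near A V h t u" if "par t u v" for t u v
    using par_lens[OF that] by blast
  \<comment> \<open>Of the two lenses take the one that opens last. At its first time the other is
    active as well, so the other partner is a sampled item near \<open>u\<close>, which the conflict
    set of the last lens forbids.\<close>
  have par_unique: "v = v'" if p: "par t u v" "par t u v'" for t u v v'
  proof -
    obtain s e where s: "s < t" "t < e" "\<forall>d. s < d \<and> d < e \<longrightarrow> v \<in> near A V h d u"
      "\<forall>k\<in>S. k \<in> near A V h (Suc s) u \<longrightarrow> k = u \<or> k = v" using par_lens[OF p(1)] by blast
    obtain s' e' where s': "s' < t" "t < e'" "\<forall>d. s' < d \<and> d < e' \<longrightarrow> v' \<in> near A V h d u"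
      "\<forall>k\<in>S. k \<in> near A V h (Suc s') u \<longrightarrow> k = u \<or> k = v'" using par_lens[OF p(2)] by blast
    have S: "v \<in> S" "v' \<in> S" "u \<noteq> v" "u \<noteq> v'" using par_D[OF p(1)] par_D[OF p(2)] by auto
    show ?thesis
    proof (cases "s \<le> s'")
      case True
      then have "v \<in> near A V h (Suc s') u" using s s' by auto
      then show ?thesis using s'(4) S by auto
    next
      case False
      then have "v' \<in> near A V h (Suc s) u" using s s' by auto
      then show ?thesis using s(4) S by auto
    qed
  qed
  define pr where "pr t i = (if \<exists>j. par t i j then THE j. par t i j else i)" for t i
  have pr_eq: "pr t i = j" if "par t i j" for t i j
    unfolding pr_def using that par_unique by (metis the_equality)
  have pr_id: "pr t i = i" if "\<And>j. \<not> par t i j" for t i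
    unfolding pr_def using that by auto
  have pr_S: "pr t i \<in> S" if "i \<in> S" for t i
    using that pr_eq pr_id par_D by metis
  have pr_pr: "pr t (pr t i) = i" for t i
    using pr_eq pr_id par_sym by metis
  define h' where "h' t i = h t (pr t i)" for t i
  have pr_inj: "pr t i = pr t j \<Longrightarrow> i = j" for t i j by (metis pr_pr)
  have sys': "height_system S m h'"
  proof -
    have "inj_on (h' t) S" if "t \<le> m" for t
    proof (rule inj_onI)
      fix i j assume "i \<in> S" "j \<in> S" "h' t i = h' t j"
      then have "pr t i = pr t j" using injV[OF that] pr_S SV
        by (auto simp: h'_def inj_on_def subset_iff)
      then show "i = j" by (rule pr_inj)
    qed
    then show ?thesis using finite_subset[OF SV finV] by (auto simp: height_system_def)
  qed
  \<comment> \<open>No sampled item lies strictly between two exchanged ones, since the conflict set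
    contains everything that enters the lens. Hence the exchange alters the order of the exchanged
    pair only.\<close>
  have sep: "\<not> (h t k < h t i \<and> h t (pr t i) < h t k)" "\<not> (h t i < h t k \<and> h t k < h t (pr t i))"
    if "k \<in> S" for t i k
  proof -
    have "(\<exists>j. par t i j \<and> pr t i = j) \<or> pr t i = i" using pr_eq pr_id by metis
    then show "\<not> (h t k < h t i \<and> h t (pr t i) < h t k)" "\<not> (h t i < h t k \<and> h t k < h t (pr t i))"
      using act_D[of t i "pr t i"] act_D[of t "pr t i" i] that by (auto simp: par_def)
  qed
  have mono: "h' t i < h' t j"
    if ij: "i \<in> S" "j \<in> S" "t \<le> m" "h t i < h t j" "\<not> par t i j" for t i j
  proof -
    have ne: "pr t i \<noteq> j" "pr t j \<noteq> i" "pr t i \<noteq> pr t j"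
      using ij pr_eq pr_id pr_inj par_sym by (metis less_irrefl)+
    have "h t (pr t i) \<noteq> h t j" "h t (pr t i) \<noteq> h t (pr t j)"
      using ne injV[OF ij(3)] pr_S ij SV by (auto simp: inj_on_def subset_iff)
    moreover have "h t (pr t i) \<le> h t j" using sep(2)[of j t i] ij by auto
    ultimately show ?thesis
      using sep(1)[of "pr t i" t j] pr_S[of i t] ij by (auto simp: h'_def)
  qed
  have iff: "h' t i < h' t j \<longleftrightarrow> (if par t i j then h t j < h t i else h t i < h t j)"
    if ij: "i \<in> S" "j \<in> S" "t \<le> m" "i \<noteq> j" for t i j
  proof (cases "par t i j")
    case True
    then have "pr t i = j" "pr t j = i" using pr_eq par_sym by metis+
    then show ?thesis using True by (simp add: h'_def)
  next
    case False
    then have "\<not> par t j i" using par_sym by blast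
    have "h t i \<noteq> h t j" using injV[OF ij(3)] ij SV by (auto simp: inj_on_def)
    then show ?thesis using mono[OF ij(1,2,3)] mono[OF ij(2,1,3)] False \<open>\<not> par t j i\<close>
      by (cases rule: linorder_cases[of "h t i" "h t j"]) auto
  qed
  define XS where "XS = {(t, i, j) \<in> crossings V m h. {i, j} \<subseteq> S}"
  define En where "En = (\<lambda>(s, i, j). (en s i j - 1, j, i)) ` GL"
  have finX: "finite XS" unfolding XS_def using finite_crossings[OF finV] by (rule rev_finite_subset) auto
  have GL_X: "GL \<subseteq> XS"
    unfolding XS_def using GL_D by auto
  have En_X: "En \<subseteq> XS"
  proof
    fix x assume "x \<in> En"
    then obtain s i j where x: "(s, i, j) \<in> GL" "x = (en s i j - 1, j, i)" by (auto simp: En_def)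
    note G = GL_D[OF x(1)]
    have "s < en s i j - 1" "en s i j - 1 < en s i j" "Suc (en s i j - 1) = en s i j"
      using G by (auto simp: lens_until_def)
    then show "x \<in> XS" using G by (auto simp: XS_def x(2) crossings_def lens_until_def)
  qed
  \<comment> \<open>Of two lenses of the same pair with the same end, the later one would open while
    the pair is already inverted by the earlier one.\<close>
  have inj_En: "inj_on (\<lambda>(s, i, j). (en s i j - 1, j, i)) GL"
  proof -
    have False if "(s, i, j) \<in> GL" "(s', i, j) \<in> GL" "en s i j - 1 = en s' i j - 1" "s < s'" for s s' i j
    proof -
      note G = GL_D[OF that(1)] note G' = GL_D[OF that(2)]
      have "s' < en s i j" using G' that by (auto simp: lens_until_def)
      then have "h s' j < h s' i" using G that by (auto simp: lens_until_def)
      then show False using G' by auto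
    qed
    then show ?thesis unfolding inj_on_def by (auto, metis linorder_neqE_nat)
  qed
  \<comment> \<open>The opening of one good lens is the closing of another only if both belong to
    the same pair in opposite orientations, and \<open>Q\<close> admits just one. So each good lens
    removes two crossings of its own.\<close>
  have disj: "GL \<inter> En = {}"
  proof -
    have GL_Q: "Q i j" if "(t, i, j) \<in> GL" for t i j
      using that by (simp add: GL_def)
    have "Q i j \<and> Q j i" if "(t, i, j) \<in> GL" "(t, i, j) \<in> En" for t i j
      using that GL_Q by (auto simp: En_def)
    then show ?thesis using Q by (metis disjoint_iff prod_cases3)
  qed
  have X': "crossings S m h' \<subseteq> XS - (GL \<union> En)"
  proof
    fix x assume "x \<in> crossings S m h'"
    then obtain t i j where x: "x = (t, i, j)" "t < m" "i \<in> S" "j \<in> S" "h' t i < h' t j"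
        "h' (Suc t) j < h' (Suc t) i" by (auto simp: crossings_def)
    have ne: "i \<noteq> j" using x by auto
    have a: "if par t i j then h t j < h t i else h t i < h t j"
      using iff[of i j t] x ne by auto
    have b: "if par (Suc t) i j then h (Suc t) i < h (Suc t) j else h (Suc t) j < h (Suc t) i"
      using iff[of j i "Suc t"] x ne par_sym by auto
    \<comment> \<open>A pair exchanged at exactly one of the times \<open>t\<close> and
      \<open>Suc t\<close> opens or closes its lens in that step, and the exchange cancels the
      crossing; exchanged at both, it would need lenses of both orientations.\<close>
    have np: "\<not> par t i j \<and> \<not> par (Suc t) i j"
    proof (rule ccontr)
      assume "\<not> ?thesis"
      then consider "par t i j" "par (Suc t) i j" | "par t i j" "\<not> par (Suc t) i j"
        | "\<not> par t i j" "par (Suc t) i j" by blast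
      then show False
      proof cases
        case 1
        then have "act t i j" "act (Suc t) j i"
          using a b act_D[of t j i] act_D[of "Suc t" i j] by (auto simp: par_def)
        then show False using act_D Q by blast
      next
        case 2
        then have "act t i j" using a act_D[of t j i] by (auto simp: par_def)
        then obtain s where s: "(s, i, j) \<in> GL" "s < t" "t < en s i j" by (auto simp: act_def)
        have "\<not> act (Suc t) i j" using 2 by (auto simp: par_def)
        then have "en s i j = Suc t" using s by (auto simp: act_def not_less)
        then show False using GL_D[OF s(1)] b 2 by (auto simp: lens_until_def)
      next
        case 3
        then have "act (Suc t) j i" using b act_D[of "Suc t" i j] by (auto simp: par_def)
        then obtain s where s: "(s, j, i) \<in> GL" "s < Suc t" "Suc t < en s j i" by (auto simp: act_def)
        have "\<not> act t j i" using 3 by (auto simp: par_def)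
        then have "\<not> s < t" using s by (auto simp: act_def)
        then have "s = t" using s by auto
        then show False using GL_D[OF s(1)] a 3 by auto
      qed
    qed
    have "(t, i, j) \<in> XS" using np a b x SV by (auto simp: XS_def crossings_def)
    moreover have "(t, i, j) \<notin> GL"
    proof
      assume g: "(t, i, j) \<in> GL"
      then have "act (Suc t) i j" using GL_D[OF g] by (auto simp: act_def lens_until_def)
      then show False using np by (auto simp: par_def)
    qed
    moreover have "(t, i, j) \<notin> En"
    proof
      assume "(t, i, j) \<in> En"
      then obtain s where s: "(s, j, i) \<in> GL" "t = en s j i - 1" by (auto simp: En_def)
      have "s < t" "t < en s j i" using GL_D[OF s(1)] s by (auto simp: lens_until_def)
      then have "act t j i" using s by (auto simp: act_def)
      then show False using np by (auto simp: par_def)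
    qed
    ultimately show "x \<in> XS - (GL \<union> En)" using x by auto
  qed
  have "card (crossings S m h') \<le> card (XS - (GL \<union> En))"
    using X' finX by (intro card_mono) auto
  also have "\<dots> = card XS - card (GL \<union> En)"
    using GL_X En_X finX by (intro card_Diff_subset) (auto intro: finite_subset)
  also have "card (GL \<union> En) = card GL + card En"
    using disj GL_X En_X finX by (intro card_Un_disjoint) (auto intro: finite_subset)
  also have "card En = card GL" unfolding En_def using inj_En by (rule card_image)
  finally have c1: "card (crossings S m h') \<le> card XS - (card GL + card GL)" .
  have "card (GL \<union> En) \<le> card XS" using GL_X En_X finX by (intro card_mono) auto
  moreover have "card (GL \<union> En) = card GL + card GL"
    using disj GL_X En_X finX card_image[OF inj_En] by (subst card_Un_disjoint) (auto intro: finite_subset simp: En_def)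
  ultimately have c2: "card (crossings S m h') + 2 * card GL \<le> card XS" using c1 by simp
  have T: "(i, j) \<in> touches S m h'"
    if ij: "(i, j) \<in> touches V m h" "i \<in> S" "j \<in> S" "touch_conflict A V m h i j \<inter> S = {}" for i j
  proof -
    define \<tau> where "\<tau> = touch_time V m h i j"
    have \<tau>: "touches_at V m h i j \<tau>" using touch_time[OF ij(1)] by (simp add: \<tau>_def)
    have lt: "\<forall>t\<le>m. h t i < h t j" using ij(1) by (auto simp: touches_def)
    then have ne: "i \<noteq> j" by auto
    have nact: "\<not> act t i j" "\<not> act t j i" for t
    proof -
      show "\<not> act t i j" using lt act_D[of t i j] by (meson less_asym)
      show "\<not> act t j i"
      proof
        assume "act t j i"
        then obtain s where "(s, j, i) \<in> GL" by (auto simp: act_def)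
        then show False using GL_D[of s j i] lt by (meson less_asym less_imp_le)
      qed
    qed
    then have npar: "\<not> par t i j" for t by (auto simp: par_def)
    have lt': "\<forall>t\<le>m. h' t i < h' t j" using lt mono ij npar by blast
    \<comment> \<open>A lens partner of \<open>i\<close> at the touching time would be a sampled
      element of the touching conflict; it cannot be \<open>j\<close>, because \<open>i\<close> and
      \<open>j\<close> never cross.\<close>
    have fix1: "pr \<tau> i = i"
    proof (rule pr_id)
      fix k show "\<not> par \<tau> i k"
      proof
        assume p: "par \<tau> i k"
        then have "k \<in> near A V h \<tau> i" "k \<in> S" "k \<noteq> i" "k \<noteq> j" using par_near par_D npar by blast+
        then show False using ij(4) by (auto simp: touch_conflict_def \<tau>_def)
      qed
    qed
    have fix2: "pr \<tau> j = j"
    proof (rule pr_id)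
      fix k show "\<not> par \<tau> j k"
      proof
        assume p: "par \<tau> j k"
        then have "k \<in> near A V h \<tau> j" "k \<in> S" "k \<noteq> j" "k \<noteq> i" using par_near par_D npar par_sym by blast+
        then show False using ij(4) by (auto simp: touch_conflict_def \<tau>_def)
      qed
    qed
    have "touches_at S m h' i j \<tau>"
      using \<tau> fix1 fix2 pr_S SV by (auto simp: touches_at_def h'_def)
    then show ?thesis using lt' ij by (auto simp: touches_def)
  qed
  show ?thesis
    using sys' c2 T by (intro exI[of _ h']) (auto simp: XS_def)
qed

subsection \<open>Random samples\<close>

text \<open>The probability of \<open>S\<close> when every element of \<open>V\<close> is kept
  independently with probability \<open>q\<close>; expectations become finite sums over
  \<open>Pow V\<close>.\<close>

definition sample_weight :: "real \<Rightarrow> 'a set \<Rightarrow> 'a set \<Rightarrow> real" where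
  "sample_weight q V S = q ^ card S * (1 - q) ^ card (V - S)"

lemma sample_weight_nonneg: "0 \<le> q \<Longrightarrow> q \<le> 1 \<Longrightarrow> 0 \<le> sample_weight q V S"
  by (simp add: sample_weight_def)

text \<open>Independence: with the factors of forbidden choices set to zero, the left side is the
  expansion of a product of binomials, one per element of \<open>V\<close>. The binomial equals
  \<open>q\<close> on \<open>P\<close>, \<open>1 - q\<close> on \<open>N\<close> and
  \<open>1\<close> elsewhere.\<close>

lemma sum_sample_weight_event:
  assumes "finite V" "P \<subseteq> V" "N \<subseteq> V" "P \<inter> N = {}"
  shows "(\<Sum>S\<in>Pow V. sample_weight q V S * of_bool (P \<subseteq> S \<and> N \<inter> S = {})) = q ^ card P * (1 - q) ^ card N"
proof -
  let ?a = "\<lambda>x. if x \<in> N then 0 else q" and ?b = "\<lambda>x. if x \<in> P then 0 else 1 - q"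
  have "(\<Sum>S\<in>Pow V. sample_weight q V S * of_bool (P \<subseteq> S \<and> N \<inter> S = {})) =
      (\<Sum>S\<in>Pow V. (\<Prod>x\<in>S. ?a x) * (\<Prod>x\<in>V - S. ?b x))"
  proof (rule sum.cong[OF refl])
    fix S assume "S \<in> Pow V"
    then have S: "S \<subseteq> V" "finite S" using assms(1) finite_subset by auto
    show "sample_weight q V S * of_bool (P \<subseteq> S \<and> N \<inter> S = {}) = (\<Prod>x\<in>S. ?a x) * (\<Prod>x\<in>V - S. ?b x)"
    proof (cases "P \<subseteq> S \<and> N \<inter> S = {}")
      case True
      then have "(\<Prod>x\<in>S. ?a x) = (\<Prod>x\<in>S. q)" "(\<Prod>x\<in>V - S. ?b x) = (\<Prod>x\<in>V - S. 1 - q)"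
        by (intro prod.cong refl; auto)+
      then show ?thesis using True by (simp add: sample_weight_def)
    next
      case False
      then have "(\<exists>x\<in>S. ?a x = 0) \<or> (\<exists>x\<in>V - S. ?b x = 0)" using assms by auto
      then have "(\<Prod>x\<in>S. ?a x) = 0 \<or> (\<Prod>x\<in>V - S. ?b x) = 0"
        using S(2) assms(1) prod_zero[of S ?a] prod_zero[of "V - S" ?b] by blast
      then show ?thesis using False by auto
    qed
  qed
  also have "\<dots> = (\<Prod>x\<in>V. ?a x + ?b x)" using assms(1) by (simp add: prod_add)
  also have "\<dots> = (\<Prod>x\<in>V. (if x \<in> P then q else 1) * (if x \<in> N then 1 - q else 1))"
    using assms by (intro prod.cong) auto
  also have "\<dots> = (\<Prod>x\<in>V. if x \<in> P then q else 1) * (\<Prod>x\<in>V. if x \<in> N then 1 - q else 1)"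
    by (rule prod.distrib)
  also have "(\<Prod>x\<in>V. if x \<in> P then q else 1) = q ^ card P"
    using assms by (subst prod.inter_restrict[symmetric]) (auto simp: Int_absorb1)
  also have "(\<Prod>x\<in>V. if x \<in> N then 1 - q else 1) = (1 - q) ^ card N"
    using assms by (subst prod.inter_restrict[symmetric]) (auto simp: Int_absorb1)
  finally show ?thesis .
qed

text \<open>Linearity of expectation; all expected counts below are instances.\<close>

lemma sum_sample_weight_card:
  assumes "finite V" "finite \<Omega>" "\<And>x. x \<in> \<Omega> \<Longrightarrow> P x \<subseteq> V \<and> N x \<subseteq> V \<and> P x \<inter> N x = {}"
  shows "(\<Sum>S\<in>Pow V. sample_weight q V S * real (card {x \<in> \<Omega>. P x \<subseteq> S \<and> N x \<inter> S = {}})) =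
     (\<Sum>x\<in>\<Omega>. q ^ card (P x) * (1 - q) ^ card (N x))"
proof -
  have "real (card {x \<in> \<Omega>. P x \<subseteq> S \<and> N x \<inter> S = {}}) = (\<Sum>x\<in>\<Omega>. of_bool (P x \<subseteq> S \<and> N x \<inter> S = {}))" for S
    using assms(2) by (subst sum_of_bool_eq) (auto simp: Int_def)
  then have "(\<Sum>S\<in>Pow V. sample_weight q V S * real (card {x \<in> \<Omega>. P x \<subseteq> S \<and> N x \<inter> S = {}})) =
      (\<Sum>S\<in>Pow V. \<Sum>x\<in>\<Omega>. sample_weight q V S * of_bool (P x \<subseteq> S \<and> N x \<inter> S = {}))"
    by (simp add: sum_distrib_left)
  also have "\<dots> = (\<Sum>x\<in>\<Omega>. \<Sum>S\<in>Pow V. sample_weight q V S * of_bool (P x \<subseteq> S \<and> N x \<inter> S = {}))"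
    by (rule sum.swap)
  also have "\<dots> = (\<Sum>x\<in>\<Omega>. q ^ card (P x) * (1 - q) ^ card (N x))"
    using assms by (intro sum.cong refl sum_sample_weight_event) auto
  finally show ?thesis .
qed

lemma power_one_minus_ge:
  fixes q :: real
  assumes "0 \<le> q" "q \<le> 1" "n \<le> D"
  shows "1 - real D * q \<le> (1 - q) ^ n"
proof -
  have "1 - real n * q \<le> (1 - q) ^ n"
    using Bernoulli_inequality[of "-q" n] assms by simp
  moreover have "real n * q \<le> real D * q" using assms by (intro mult_right_mono) auto
  ultimately show ?thesis by linarith
qed

text \<open>The surgery is applied to a random sample, the assumed bound to the resulting system,
  and expectations are taken. Touchings, crossings and lenses survive through two items, with
  probability \<open>q^2\<close>; a conflict set of at most \<open>5 * A + 6\<close> items is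
  avoided with probability at least \<open>1 - (5 * A + 6) * q\<close>, by Bernoulli's inequality.
  Dividing by \<open>q^2\<close> turns the linear term \<open>C * q\<close> into
  \<open>C / q\<close>.\<close>

lemma sampling_oriented:
  fixes h :: "nat \<Rightarrow> 'a \<Rightarrow> real"
  assumes sys: "height_system V m h"
    and bound: "\<And>V m (h :: nat \<Rightarrow> 'a \<Rightarrow> real). height_system V m h \<Longrightarrow>
      real (card (touches V m h)) \<le> \<rho> * real (card (crossings V m h)) + C * real (card V)"
    and Q: "\<And>i j. Q i j \<Longrightarrow> \<not> Q j i" and \<rho>: "0 \<le> \<rho>" and q: "0 < q" "q \<le> 1"
  shows "(1 - real (5 * A + 6) * q) * real (card (touches V m h)) \<le>
     \<rho> * (real (card (crossings V m h))
       - 2 * (1 - real (5 * A + 6) * q) * real (card {(s, i, j) \<in> lenses A V m h. Q i j})) + C / q * real (card V)"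
proof -
  define w where "w = sample_weight q V"
  define D where "D = 5 * A + 6"
  define L where "L = {(s, i, j) \<in> lenses A V m h. Q i j}"
  define TS where "TS S = {x \<in> touches V m h. {fst x, snd x} \<subseteq> S \<and> touch_conflict A V m h (fst x) (snd x) \<inter> S = {}}" for S
  define XS where "XS S = {x \<in> crossings V m h. {fst (snd x), snd (snd x)} \<subseteq> S \<and> {} \<inter> S = {}}" for S
  define LS where "LS S = {x \<in> L. {fst (snd x), snd (snd x)} \<subseteq> S \<and>
     lens_conflict A V m h (fst x) (fst (snd x)) (snd (snd x)) \<inter> S = {}}" for S
  have fin: "finite V" using sys by (simp add: height_system_def)
  have w0: "0 \<le> w S" for S unfolding w_def using q by (intro sample_weight_nonneg) auto
  have each: "real (card (TS S)) \<le> \<rho> * (real (card (XS S)) - 2 * real (card (LS S))) + C * real (card {x \<in> V. {x} \<subseteq> S \<and> {} \<inter> S = {}})"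
    if S: "S \<subseteq> V" for S
  proof -
    have e1: "TS S = {(i, j) \<in> touches V m h. {i, j} \<subseteq> S \<and> touch_conflict A V m h i j \<inter> S = {}}"
      and e2: "XS S = {(t, i, j) \<in> crossings V m h. {i, j} \<subseteq> S}"
      and e3: "LS S = {(s, i, j) \<in> lenses A V m h. Q i j \<and> {i, j} \<subseteq> S \<and> lens_conflict A V m h s i j \<inter> S = {}}"
      and e4: "{x \<in> V. {x} \<subseteq> S \<and> {} \<inter> S = {}} = S"
      using S by (auto simp: TS_def XS_def LS_def L_def)
    obtain h' where h': "height_system S m h'" "card (crossings S m h') + 2 * card (LS S) \<le> card (XS S)"
       "TS S \<subseteq> touches S m h'"
      using lens_surgery[OF sys S, of Q A] Q unfolding e1 e2 e3 by blast
    have "card (TS S) \<le> card (touches S m h')"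
      using h' finite_touches by (intro card_mono) (auto simp: height_system_def)
    then have "real (card (TS S)) \<le> real (card (touches S m h'))" by simp
    also have "\<dots> \<le> \<rho> * real (card (crossings S m h')) + C * real (card S)" by (rule bound[OF h'(1)])
    also have "\<rho> * real (card (crossings S m h')) \<le> \<rho> * (real (card (XS S)) - 2 * real (card (LS S)))"
      using h'(2) \<rho> by (intro mult_left_mono) linarith+
    finally show ?thesis unfolding e4 by simp
  qed
  have sumT: "q^2 * (1 - real D * q) * real (card (touches V m h)) \<le> (\<Sum>S\<in>Pow V. w S * real (card (TS S)))"
  proof -
    have "(\<Sum>S\<in>Pow V. w S * real (card (TS S))) =
        (\<Sum>x\<in>touches V m h. q ^ card {fst x, snd x} * (1 - q) ^ card (touch_conflict A V m h (fst x) (snd x)))"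
      unfolding w_def TS_def using fin
      by (intro sum_sample_weight_card finite_touches) (auto simp: touches_def touch_conflict_def near_def)
    also have "\<dots> \<ge> (\<Sum>x\<in>touches V m h. q^2 * (1 - real D * q))"
    proof (rule sum_mono)
      fix x assume x: "x \<in> touches V m h"
      then have "fst x \<noteq> snd x" by (auto simp: touches_def)
      then have "card {fst x, snd x} = 2" by simp
      moreover have "1 - real D * q \<le> (1 - q) ^ card (touch_conflict A V m h (fst x) (snd x))"
        using card_touch_conflict[OF sys, of "fst x" "snd x" A] x q by (intro power_one_minus_ge) (auto simp: D_def)
      ultimately show "q^2 * (1 - real D * q) \<le> q ^ card {fst x, snd x} * (1 - q) ^ card (touch_conflict A V m h (fst x) (snd x))"
        by (simp add: mult_left_mono)
    qed
    finally show ?thesis by (simp add: mult_ac)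
  qed
  have sumX: "(\<Sum>S\<in>Pow V. w S * real (card (XS S))) = q^2 * real (card (crossings V m h))"
  proof -
    have "(\<Sum>S\<in>Pow V. w S * real (card (XS S))) =
        (\<Sum>x\<in>crossings V m h. q ^ card {fst (snd x), snd (snd x)} * (1 - q) ^ card ({}::'a set))"
      unfolding w_def XS_def using fin
      by (intro sum_sample_weight_card finite_crossings) (auto simp: crossings_def)
    also have "\<dots> = (\<Sum>x\<in>crossings V m h. q^2)"
    proof (rule sum.cong[OF refl])
      fix x assume "x \<in> crossings V m h"
      then have "fst (snd x) \<noteq> snd (snd x)" by (auto simp: crossings_def)
      then have "card {fst (snd x), snd (snd x)} = 2" by simp
      then show "q ^ card {fst (snd x), snd (snd x)} * (1 - q) ^ card ({}::'a set) = q^2" by simp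
    qed
    finally show ?thesis by (simp add: mult_ac)
  qed
  have sumL: "q^2 * (1 - real D * q) * real (card L) \<le> (\<Sum>S\<in>Pow V. w S * real (card (LS S)))"
  proof -
    have Lsub: "L \<subseteq> lenses A V m h" "L \<subseteq> crossings V m h" by (auto simp: L_def lenses_def)
    have "(\<Sum>S\<in>Pow V. w S * real (card (LS S))) =
        (\<Sum>x\<in>L. q ^ card {fst (snd x), snd (snd x)} * (1 - q) ^ card (lens_conflict A V m h (fst x) (fst (snd x)) (snd (snd x))))"
      unfolding w_def LS_def using fin Lsub finite_lenses[OF fin]
      by (intro sum_sample_weight_card)
        (auto simp: crossings_def lens_conflict_def near_def between_def intro: finite_subset)
    also have "\<dots> \<ge> (\<Sum>x\<in>L. q^2 * (1 - real D * q))"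
    proof (rule sum_mono)
      fix x assume x: "x \<in> L"
      then have "fst (snd x) \<noteq> snd (snd x)" using Lsub by (auto simp: crossings_def)
      then have "card {fst (snd x), snd (snd x)} = 2" by simp
      moreover have "1 - real D * q \<le> (1 - q) ^ card (lens_conflict A V m h (fst x) (fst (snd x)) (snd (snd x)))"
        using card_lens_conflict[OF sys, of "fst x" "fst (snd x)" "snd (snd x)" A] x Lsub q
        by (intro power_one_minus_ge) (auto simp: D_def)
      ultimately show "q^2 * (1 - real D * q) \<le> q ^ card {fst (snd x), snd (snd x)} *
          (1 - q) ^ card (lens_conflict A V m h (fst x) (fst (snd x)) (snd (snd x)))"
        by (simp add: mult_left_mono)
    qed
    finally show ?thesis by (simp add: mult_ac)
  qed
  have sumV: "(\<Sum>S\<in>Pow V. w S * real (card {x \<in> V. {x} \<subseteq> S \<and> {} \<inter> S = {}})) = q * real (card V)"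
  proof -
    have "(\<Sum>S\<in>Pow V. w S * real (card {x \<in> V. {x} \<subseteq> S \<and> {} \<inter> S = {}})) =
       (\<Sum>x\<in>V. q ^ card {x} * (1 - q) ^ card ({}::'a set))"
      unfolding w_def using fin by (intro sum_sample_weight_card) auto
    then show ?thesis by (simp add: mult_ac)
  qed
  have "q^2 * (1 - real D * q) * real (card (touches V m h)) \<le> (\<Sum>S\<in>Pow V. w S * real (card (TS S)))"
    by (rule sumT)
  also have "\<dots> \<le> (\<Sum>S\<in>Pow V. w S * (\<rho> * (real (card (XS S)) - 2 * real (card (LS S))) + C * real (card {x \<in> V. {x} \<subseteq> S \<and> {} \<inter> S = {}})))"
    using each w0 by (intro sum_mono mult_left_mono) auto
  also have "\<dots> = \<rho> * ((\<Sum>S\<in>Pow V. w S * real (card (XS S))) - 2 * (\<Sum>S\<in>Pow V. w S * real (card (LS S)))) +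
      C * (\<Sum>S\<in>Pow V. w S * real (card {x \<in> V. {x} \<subseteq> S \<and> {} \<inter> S = {}}))"
    by (simp only: sum_distrib_left sum_subtractf[symmetric] sum.distrib[symmetric])
      (simp add: algebra_simps)
  also have "\<dots> \<le> \<rho> * (q^2 * real (card (crossings V m h)) - 2 * (q^2 * (1 - real D * q) * real (card L))) + C * (q * real (card V))"
    unfolding sumX sumV using sumL \<rho> by (intro add_right_mono mult_left_mono diff_mono) auto
  also have "\<dots> = q^2 * (\<rho> * (real (card (crossings V m h)) - 2 * (1 - real D * q) * real (card L)) + C / q * real (card V))"
    using q by (simp add: field_simps power2_eq_square)
  finally have "q^2 * ((1 - real D * q) * real (card (touches V m h))) \<le>
     q^2 * (\<rho> * (real (card (crossings V m h)) - 2 * (1 - real D * q) * real (card L)) + C / q * real (card V))"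
    by (simp add: mult.assoc)
  then show ?thesis using q by (simp add: D_def L_def)
qed

text \<open>An injection into the naturals splits the lenses into two orientations, each of which is
  asymmetric as required of \<open>Q\<close>. Averaging the two estimates replaces the gain of two
  crossings per oriented lens by one per lens.\<close>

lemma sampling:
  fixes h :: "nat \<Rightarrow> 'a \<Rightarrow> real"
  assumes sys: "height_system V m h"
    and bound: "\<And>V m (h :: nat \<Rightarrow> 'a \<Rightarrow> real). height_system V m h \<Longrightarrow>
      real (card (touches V m h)) \<le> \<rho> * real (card (crossings V m h)) + C * real (card V)"
    and \<rho>: "0 \<le> \<rho>" and q: "0 < q" "q \<le> 1"
  shows "(1 - real (5 * A + 6) * q) * real (card (touches V m h)) \<le>
     \<rho> * (real (card (crossings V m h))
       - (1 - real (5 * A + 6) * q) * real (card (lenses A V m h))) + C / q * real (card V)"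
proof -
  have fin: "finite V" using sys by (simp add: height_system_def)
  then obtain g :: "'a \<Rightarrow> nat" where g: "inj_on g V"
    using finite_imp_inj_to_nat_seg by metis
  define L1 where "L1 = {(s, i, j) \<in> lenses A V m h. g i < g j}"
  define L2 where "L2 = {(s, i, j) \<in> lenses A V m h. g j < g i}"
  have "lenses A V m h = L1 \<union> L2"
    using g unfolding L1_def L2_def lenses_def crossings_def inj_on_def
    by (auto) (metis less_irrefl linorder_neqE_nat)
  moreover have "L1 \<inter> L2 = {}" by (auto simp: L1_def L2_def)
  ultimately have c: "card (lenses A V m h) = card L1 + card L2"
    using finite_lenses[OF fin] by (metis card_Un_disjoint finite_Un)
  define T X n where "T = real (card (touches V m h))" and "X = real (card (crossings V m h))"
    and "n = real (card V)"
  define p where "p = 1 - real (5 * A + 6) * q"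
  have 1: "p * T \<le> \<rho> * (X - 2 * p * real (card L1)) + C / q * n"
    unfolding T_def X_def n_def L1_def p_def
    by (rule sampling_oriented[OF sys bound _ \<rho> q]) auto
  have 2: "p * T \<le> \<rho> * (X - 2 * p * real (card L2)) + C / q * n"
    unfolding T_def X_def n_def L2_def p_def
    by (rule sampling_oriented[OF sys bound _ \<rho> q]) auto
  have "p * T \<le> \<rho> * (X - p * real (card (lenses A V m h))) + C / q * n"
    using 1 2 unfolding c by (simp add: algebra_simps)
  then show ?thesis by (simp add: T_def X_def n_def p_def)
qed

subsection \<open>Lenses from four-cycles of touchings\<close>

text \<open>The Kovari-Sos-Turan argument. Two right ends share at most one left neighbour, so the
  pairs of edges with a common left end number at most \<open>card E\<close> plus one per pair of
  right ends; Cauchy-Schwarz turns this into a quadratic inequality for \<open>card E\<close>. On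
  sides of size \<open>2 * k^2\<close> it saves a factor \<open>k\<close> over the trivial
  \<open>4 * k^4\<close>.\<close>

lemma card_edges_C4_free:
  fixes E :: "('a \<times> 'b) set"
  assumes finU: "finite U" and finW: "finite W" and E: "E \<subseteq> U \<times> W"
    and U: "card U \<le> 2 * k^2" and W: "card W \<le> 2 * k^2"
    and C4: "\<And>f f' g g'. (f, g) \<in> E \<Longrightarrow> (f', g) \<in> E \<Longrightarrow> (f, g') \<in> E \<Longrightarrow> (f', g') \<in> E \<Longrightarrow> f = f' \<or> g = g'"
  shows "card E \<le> 4 * k^3"
proof -
  define d where "d f = card {g. (f, g) \<in> E}" for f
  have finE: "finite E" using E finU finW finite_subset by blast
  have fd: "finite {g. (f, g) \<in> E}" for f
    using E finW by (auto intro: finite_subset)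
  have "E = (SIGMA f:U. {g. (f, g) \<in> E})" using E by auto
  then have cE: "card E = (\<Sum>f\<in>U. d f)"
    unfolding d_def using finU fd by (metis card_SigmaI)
  have "(\<Sum>f\<in>U. (d f)^2) = card (SIGMA f:U. {g. (f, g) \<in> E} \<times> {g. (f, g) \<in> E})"
    using finU fd by (simp add: d_def power2_eq_square card_cartesian_product)
  also have "\<dots> \<le> card ((\<lambda>(f, g). (f, g, g)) ` E \<union>
      {(f, g, g'). (f, g) \<in> E \<and> (f, g') \<in> E \<and> g \<noteq> g'})"
    using finE by (intro card_mono finite_UnI finite_imageI
        finite_subset[of "{(f, g, g'). (f, g) \<in> E \<and> (f, g') \<in> E \<and> g \<noteq> g'}" "U \<times> W \<times> W"]) (use E finU finW in auto)
  also have "\<dots> \<le> card ((\<lambda>(f, g). (f, g, g)) ` E) + card {(f, g, g'). (f, g) \<in> E \<and> (f, g') \<in> E \<and> g \<noteq> g'}"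
    by (rule card_Un_le)
  also have "card {(f, g, g'). (f, g) \<in> E \<and> (f, g') \<in> E \<and> g \<noteq> g'} \<le> card (W \<times> W)"
  proof (rule card_inj_on_le[of snd])
    show "inj_on snd {(f, g, g'). (f, g) \<in> E \<and> (f, g') \<in> E \<and> g \<noteq> g'}"
      using C4 by (auto simp: inj_on_def)
  qed (use E finW in auto)
  also have "card (W \<times> W) \<le> (2 * k^2)^2"
    unfolding card_cartesian_product power2_eq_square[of "2 * k^2"] using W W by (rule mult_le_mono)
  also have "card ((\<lambda>(f, g). (f, g, g)) ` E) \<le> card E" using finE by (rule card_image_le)
  finally have sq: "(\<Sum>f\<in>U. (d f)^2) \<le> card E + (2 * k^2)^2" by simp
  have "real (card E)^2 = (\<Sum>f\<in>U. real (d f) * 1)^2" by (simp add: cE)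
  also have "\<dots> \<le> (\<Sum>f\<in>U. (real (d f))^2) * (\<Sum>f\<in>U. 1^2)" by (rule Cauchy_Schwarz_ineq_sum)
  also have "\<dots> = real (\<Sum>f\<in>U. (d f)^2) * real (card U)" by simp
  also have "\<dots> \<le> real (card E + (2 * k^2)^2) * real (2 * k^2)"
    using sq U by (intro mult_mono) (simp_all only: of_nat_le_iff of_nat_0_le_iff)
  finally have main: "real (card E)^2 \<le> (real (card E) + 4 * real k^4) * (2 * real k^2)"
    by (simp add: power_mult_distrib)
  show ?thesis
  proof (rule ccontr)
    assume "\<not> ?thesis"
    then have e: "real (card E) > 4 * real k^3" by (metis not_le of_nat_less_iff of_nat_mult of_nat_numeral of_nat_power)
    show False
    proof (cases "k = 0")
      case True then show False using main e by simp
    next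
      case False
      then have "real k^2 \<le> real k^3" by (intro power_increasing) auto
      \<comment> \<open>Since \<open>2 * k^2 \<le> 2 * k^3\<close>, the assumption
        \<open>card E > 4 * k^3\<close> leaves at least \<open>2 * k^3\<close> after subtracting
        \<open>2 * k^2\<close>.\<close>
      then have "real (card E) * (2 * real k^3) \<le> real (card E) * (real (card E) - 2 * real k^2)"
        using e by (intro mult_left_mono) auto
      also have "\<dots> \<le> 8 * real k^6" using main by (simp add: algebra_simps power2_eq_square eval_nat_numeral)
      finally have "real (card E) * (2 * real k^3) \<le> 4 * real k^3 * (2 * real k^3)" by (simp add: eval_nat_numeral algebra_simps)
      moreover have "0 < 2 * real k^3" using False by simp
      ultimately have "real (card E) \<le> 4 * real k^3" by (rule mult_right_le_imp_le)
      then show False using e by simp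
    qed
  qed
qed

text \<open>The last time before \<open>t2\<close> and the first time after it at which
  \<open>b\<close> is below \<open>a\<close> bound one lens. \<open>G\<close> stands for a region of
  times and items: whatever lies between the inverted pair belongs to it, and it meets at most
  \<open>A\<close> items, so the lens is thin.\<close>

lemma lens_from_return:
  assumes "t1 < t2" "t2 < t3" "t3 \<le> m" "a \<in> V" "b \<in> V"
    and "h t1 b < h t1 a" "h t2 a < h t2 b" "h t3 b < h t3 a"
    and inj: "\<And>t. t \<le> m \<Longrightarrow> inj_on (h t) V"
    and G: "\<And>t k. t1 \<le> t \<Longrightarrow> t \<le> t3 \<Longrightarrow> k \<in> V \<Longrightarrow> h t a < h t b \<Longrightarrow> h t a \<le> h t k \<Longrightarrow> h t k \<le> h t b \<Longrightarrow> G t k"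
    and card: "card {k \<in> V. \<exists>t. G t k} \<le> A" and fin: "finite V"
  shows "\<exists>s. (s, b, a) \<in> lenses A V m h \<and> G (Suc s) b"
proof -
  have ne: "a \<noteq> b" using assms(6) by auto
  have tot: "h t a < h t b \<or> h t b < h t a" if "t \<le> m" for t
    using inj[OF that] assms(4,5) ne by (auto simp: inj_on_def) (metis linorder_neqE_linordered_idom)
  define s where "s = (GREATEST s. s < t2 \<and> h s b < h s a)"
  have s: "s < t2 \<and> h s b < h s a" unfolding s_def
    by (rule GreatestI_nat[of _ t1 t2]) (use assms in auto)
  have smax: "s' \<le> s" if "s' < t2" "h s' b < h s' a" for s'
    unfolding s_def by (rule Greatest_le_nat[of _ _ t2]) (use that in auto)
  define e where "e = (LEAST e. t2 < e \<and> h e b < h e a)"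
  have e: "t2 < e \<and> h e b < h e a" unfolding e_def by (rule LeastI[of _ t3]) (use assms in auto)
  have emin: "e \<le> e'" if "t2 < e'" "h e' b < h e' a" for e'
    unfolding e_def by (rule Least_le) (use that in auto)
  have e3: "e \<le> t3" using emin assms by auto
  have s1: "t1 \<le> s" using smax assms by auto
  have mid: "h t a < h t b" if "s < t" "t < e" for t
  proof -
    have "\<not> h t b < h t a" using smax[of t] emin[of t] that assms(7) by (cases t t2 rule: linorder_cases) auto
    then show ?thesis using tot[of t] that e3 assms by auto
  qed
  have "card (between V h b a s e) \<le> card {k \<in> V. \<exists>t. G t k}"
  proof (rule card_mono)
    show "between V h b a s e \<subseteq> {k \<in> V. \<exists>t. G t k}"
    proof
      fix k assume "k \<in> between V h b a s e"
      then obtain t where "k \<in> V" "s < t" "t < e" "h t a < h t k" "h t k < h t b" by (auto simp: between_def)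
      then have "G t k" using s1 e3 by (intro G) auto
      then show "k \<in> {k \<in> V. \<exists>t. G t k}" using \<open>k \<in> V\<close> by auto
    qed
  qed (use fin in auto)
  then have "lens_until A V m h s b a e"
    using s e e3 mid assms card by (auto simp: lens_until_def)
  moreover have "(s, b, a) \<in> crossings V m h"
    using s e mid[of "Suc s"] assms e3 by (auto simp: crossings_def)
  ultimately have "(s, b, a) \<in> lenses A V m h" by (auto simp: lenses_def)
  moreover have "G (Suc s) b"
    using mid[of "Suc s"] s e e3 s1 assms(5) by (intro G) auto
  ultimately show ?thesis by blast
qed

text \<open>The four pairs \<open>x y\<close>, \<open>y y'\<close>, \<open>y' x'\<close>,
  \<open>x' x\<close> form a cycle, but only three pairs of four distinct times are consecutive; so
  one of the pairs has another time strictly inside.\<close>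

lemma four_times_alternate:
  fixes x x' y y' :: nat
  assumes "x \<noteq> x'" "x \<noteq> y" "x \<noteq> y'" "x' \<noteq> y" "x' \<noteq> y'" "y \<noteq> y'"
  obtains r where "r = x' \<or> r = y'" "min x y < r" "r < max x y"
  | r where "r = x \<or> r = y" "min x' y' < r" "r < max x' y'"
  | r where "r = y \<or> r = y'" "min x x' < r" "r < max x x'"
  | r where "r = x \<or> r = x'" "min y y' < r" "r < max y y'"
proof -
  have "(min x y < x' \<and> x' < max x y) \<or> (min x y < y' \<and> y' < max x y) \<or>
     (min x' y' < x \<and> x < max x' y') \<or> (min x' y' < y \<and> y < max x' y') \<or>
     (min x x' < y \<and> y < max x x') \<or> (min x x' < y' \<and> y' < max x x') \<or>
     (min y y' < x \<and> x < max y y') \<or> (min y y' < x' \<and> x' < max y y')"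
    using assms by (simp add: min_def max_def) arith
  then show thesis using that by blast
qed

text \<open>The hulls along the path \<open>a\<close>, \<open>b\<close>, \<open>c\<close>,
  \<open>d\<close> cover the hull of its ends. It serves to go around the other three sides of a
  four-cycle of touchings.\<close>

lemma hull_cover:
  fixes a b c d t :: nat
  assumes "min a d \<le> t" "t \<le> max a d"
  shows "(min a b \<le> t \<and> t \<le> max a b) \<or> (min b c \<le> t \<and> t \<le> max b c) \<or> (min d c \<le> t \<and> t \<le> max d c)"
  using assms unfolding min_le_iff_disj le_max_iff_disj by linarith

text \<open>At the four touching times the upper one of \<open>f, f'\<close> and the lower one of \<open>g, g'\<close> run through
  all four combinations, so one of these two pairs must swap twice.\<close>

lemma lens_from_C4:
  fixes h :: "nat \<Rightarrow> 'a \<Rightarrow> real"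
  assumes V: "f \<in> V" "f' \<in> V" "g \<in> V" "g' \<in> V" and ne: "f \<noteq> f'" "g \<noteq> g'"
    and touch: "touches_at V m h f g x" "touches_at V m h f' g x'" "touches_at V m h f g' y" "touches_at V m h f' g' y'"
    and below: "\<And>t. t \<le> m \<Longrightarrow> h t f < h t g \<and> h t f' < h t g \<and> h t f < h t g' \<and> h t f' < h t g'"
    and inj: "\<And>t. t \<le> m \<Longrightarrow> inj_on (h t) V" and fin: "finite V"
    and Gconv: "\<And>t i j k. G t i \<Longrightarrow> G t j \<Longrightarrow> k \<in> V \<Longrightarrow> h t i \<le> h t k \<Longrightarrow> h t k \<le> h t j \<Longrightarrow> G t k"
    and Gf: "\<And>t. min x y \<le> t \<Longrightarrow> t \<le> max x y \<Longrightarrow> G t f"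
    and Gf': "\<And>t. min x' y' \<le> t \<Longrightarrow> t \<le> max x' y' \<Longrightarrow> G t f'"
    and Gg: "\<And>t. min x x' \<le> t \<Longrightarrow> t \<le> max x x' \<Longrightarrow> G t g"
    and Gg': "\<And>t. min y y' \<le> t \<Longrightarrow> t \<le> max y y' \<Longrightarrow> G t g'"
    and card: "card {k \<in> V. \<exists>t. G t k} \<le> A"
  shows "\<exists>s u v. (s, u, v) \<in> lenses A V m h \<and> G (Suc s) u"
proof -
  have le: "x \<le> m" "x' \<le> m" "y \<le> m" "y' \<le> m" using touch by (auto simp: touches_at_def)
  have neq: "h t f \<noteq> h t f'" "h t g \<noteq> h t g'" if "t \<le> m" for t
    using inj[OF that] V ne by (auto simp: inj_on_def)
  \<comment> \<open>At the time \<open>x\<close> when \<open>f\<close> touches \<open>g\<close>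
    nothing lies between them, and \<open>f'\<close> is below \<open>g\<close>; hence
    \<open>f'\<close> is below \<open>f\<close>. The other relations arise in the same way.\<close>
  have Fx: "h x f' < h x f" and Fy: "h y f' < h y f" and Fx': "h x' f < h x' f'" and Fy': "h y' f < h y' f'"
    using touch neq le below V unfolding touches_at_def by (metis linorder_neqE_linordered_idom)+
  have Gx: "h x g < h x g'" and Gx': "h x' g < h x' g'" and Gy: "h y g' < h y g" and Gy': "h y' g' < h y' g"
    using touch neq le below V unfolding touches_at_def by (metis linorder_neqE_linordered_idom)+
  have d: "x \<noteq> x'" "x \<noteq> y" "x \<noteq> y'" "x' \<noteq> y" "x' \<noteq> y'" "y \<noteq> y'"
    using Fx Fy Fx' Fy' Gx Gx' Gy Gy' by (metis less_asym)+
  note lens = lens_from_return[where A = A and G = G and m = m and V = V and h = h, OF _ _ _ _ _ _ _ _ inj _ card fin]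
  show ?thesis
    using d
  proof (cases rule: four_times_alternate)
    case (1 r)
    have "\<exists>s. (s, f', f) \<in> lenses A V m h \<and> G (Suc s) f'"
    proof (rule lens[of "min x y" r "max x y"])
      show "G t k" if t: "min x y \<le> t" "t \<le> max x y" "k \<in> V" "h t f < h t f'" "h t f \<le> h t k" "h t k \<le> h t f'" for t k
      proof -
        have "t \<le> m" using t le by auto
        \<comment> \<open>In the hull of \<open>x\<close> and \<open>y\<close> the item
          \<open>f\<close> stays in the region, and at each time one of \<open>g\<close>,
          \<open>f'\<close>, \<open>g'\<close> is there too and is not below \<open>f'\<close>. By
          convexity of \<open>G\<close> everything between \<open>f\<close> and \<open>f'\<close> is
          in the region.\<close>
        have "(min x x' \<le> t \<and> t \<le> max x x') \<or> (min x' y' \<le> t \<and> t \<le> max x' y') \<or> (min y y' \<le> t \<and> t \<le> max y y')"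
          using hull_cover[of x y t x' y'] t by (auto simp: min.commute max.commute)
        then obtain w where "G t w" "h t f' \<le> h t w"
          using Gg Gf' Gg' below[OF \<open>t \<le> m\<close>] by (meson less_imp_le order_refl)
        then show ?thesis using Gconv[OF Gf] t by auto
      qed
    qed (use 1 V le Fx Fy Fx' Fy' in \<open>auto simp: min_def max_def split: if_splits\<close>)
    then show ?thesis by blast
  next
    case (2 r)
    have "\<exists>s. (s, f, f') \<in> lenses A V m h \<and> G (Suc s) f"
    proof (rule lens[of "min x' y'" r "max x' y'"])
      show "G t k" if t: "min x' y' \<le> t" "t \<le> max x' y'" "k \<in> V" "h t f' < h t f" "h t f' \<le> h t k" "h t k \<le> h t f" for t k
      proof -
        have "t \<le> m" using t le by auto
        have "(min x x' \<le> t \<and> t \<le> max x x') \<or> (min x y \<le> t \<and> t \<le> max x y) \<or> (min y y' \<le> t \<and> t \<le> max y y')"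
          using hull_cover[of x' y' t x y] t by (auto simp: min.commute max.commute)
        then obtain w where "G t w" "h t f \<le> h t w"
          using Gg Gf Gg' below[OF \<open>t \<le> m\<close>] by (meson less_imp_le order_refl)
        then show ?thesis using Gconv[OF Gf'] t by auto
      qed
    qed (use 2 V le Fx Fy Fx' Fy' in \<open>auto simp: min_def max_def split: if_splits\<close>)
    then show ?thesis by blast
  next
    case (3 r)
    have "\<exists>s. (s, g, g') \<in> lenses A V m h \<and> G (Suc s) g"
    proof (rule lens[of "min x x'" r "max x x'"])
      show "G t k" if t: "min x x' \<le> t" "t \<le> max x x'" "k \<in> V" "h t g' < h t g" "h t g' \<le> h t k" "h t k \<le> h t g" for t k
      proof -
        have "t \<le> m" using t le by auto
        have "(min x y \<le> t \<and> t \<le> max x y) \<or> (min x' y' \<le> t \<and> t \<le> max x' y') \<or> (min y y' \<le> t \<and> t \<le> max y y')"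
          using hull_cover[of x x' t y y'] t by (auto simp: min.commute max.commute)
        then obtain w where "G t w" "h t w \<le> h t g'"
          using Gf Gf' Gg' below[OF \<open>t \<le> m\<close>] by (meson less_imp_le order_refl)
        then show ?thesis using Gconv[OF _ Gg] t by auto
      qed
    qed (use 3 V le Gx Gy Gx' Gy' in \<open>auto simp: min_def max_def split: if_splits\<close>)
    then show ?thesis by blast
  next
    case (4 r)
    have "\<exists>s. (s, g', g) \<in> lenses A V m h \<and> G (Suc s) g'"
    proof (rule lens[of "min y y'" r "max y y'"])
      show "G t k" if t: "min y y' \<le> t" "t \<le> max y y'" "k \<in> V" "h t g < h t g'" "h t g \<le> h t k" "h t k \<le> h t g'" for t k
      proof -
        have "t \<le> m" using t le by auto
        have "(min x y \<le> t \<and> t \<le> max x y) \<or> (min x' y' \<le> t \<and> t \<le> max x' y') \<or> (min x x' \<le> t \<and> t \<le> max x x')"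
          using hull_cover[of y y' t x x'] t by (auto simp: min.commute max.commute)
        then obtain w where "G t w" "h t w \<le> h t g"
          using Gf Gf' Gg below[OF \<open>t \<le> m\<close>] by (meson less_imp_le order_refl)
        then show ?thesis using Gconv[OF _ Gg'] t by auto
      qed
    qed (use 4 V le Gx Gy Gx' Gy' in \<open>auto simp: min_def max_def split: if_splits\<close>)
    then show ?thesis by blast
  qed
qed

subsection \<open>Strips and cells\<close>

text \<open>The offset shifts the strip boundaries. A particular one may separate many touching
  pairs or be passed by many items, so it is kept as a parameter over which the estimates are later
  summed.\<close>

locale strip_decomposition =
  fixes V :: "'a set" and m :: nat and h :: "nat \<Rightarrow> 'a \<Rightarrow> real" and M off :: nat
  assumes sys: "height_system V m h" and off: "off < M"
begin

definition strip :: "nat \<Rightarrow> 'a \<Rightarrow> nat" where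
  "strip t i = (height_rank V h t i + off) div M"

definition entries :: "(nat \<times> 'a) set" where
  "entries = {(t, i). t < m \<and> i \<in> V \<and> strip t i \<noteq> strip (Suc t) i}"

text \<open>A strip is cut into cells at every \<open>M\<close>-th entry, so that only \<open>2 * M\<close> pieces meet a cell.\<close>

definition entry_count :: "nat \<Rightarrow> nat \<Rightarrow> nat" where
  "entry_count l t = card {x \<in> entries. fst x < t \<and> strip (Suc (fst x)) (snd x) = l}"

definition in_cell :: "nat \<Rightarrow> nat \<Rightarrow> nat \<Rightarrow> 'a \<Rightarrow> bool" where
  "in_cell l c t i \<longleftrightarrow> t \<le> m \<and> i \<in> V \<and> strip t i = l \<and> entry_count l t div M = c"

text \<open>An uninterrupted stay of an item in a cell is named by its first time, so a stay can
  serve as a vertex of a graph.\<close>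

definition piece_start :: "nat \<Rightarrow> nat \<Rightarrow> nat \<Rightarrow> 'a \<Rightarrow> nat" where
  "piece_start l c t i = (LEAST s. s \<le> t \<and> (\<forall>u. s \<le> u \<and> u \<le> t \<longrightarrow> in_cell l c u i))"

definition pieces :: "nat \<Rightarrow> nat \<Rightarrow> ('a \<times> nat) set" where
  "pieces l c = {(i, piece_start l c t i) | i t. in_cell l c t i}"

definition cell_touches :: "nat \<Rightarrow> nat \<Rightarrow> ('a \<times> 'a) set" where
  "cell_touches l c = {(i, j) \<in> touches V m h.
     in_cell l c (touch_time V m h i j) i \<and> in_cell l c (touch_time V m h i j) j}"

lemma fin: "finite V" and inj: "t \<le> m \<Longrightarrow> inj_on (h t) V" and M: "0 < M"
proof -
  show "finite V" using sys by (simp add: height_system_def)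
  show "inj_on (h t) V" if "t \<le> m" using sys that by (simp add: height_system_def)
  show "0 < M" using off by simp
qed

lemma finite_entries: "finite entries"
  by (rule finite_subset[of _ "{..<m} \<times> V"]) (use fin in \<open>auto simp: entries_def\<close>)

lemma entry_count_mono: "s \<le> t \<Longrightarrow> entry_count l s \<le> entry_count l t"
  unfolding entry_count_def using finite_entries by (intro card_mono) auto

lemma card_strip:
  assumes "t \<le> m"
  shows "card {i \<in> V. strip t i = l} \<le> M"
proof -
  have "card {i \<in> V. strip t i = l} \<le> card {l * M ..< l * M + M}"
  proof (rule card_inj_on_le[of "\<lambda>i. height_rank V h t i + off"])
    show "inj_on (\<lambda>i. height_rank V h t i + off) {i \<in> V. strip t i = l}"
      using height_rank_inj_on[OF fin, of h t] inj[OF assms] by (auto simp: inj_on_def)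
    show "(\<lambda>i. height_rank V h t i + off) ` {i \<in> V. strip t i = l} \<subseteq> {l * M ..< l * M + M}"
    proof
      fix r assume "r \<in> (\<lambda>i. height_rank V h t i + off) ` {i \<in> V. strip t i = l}"
      then have "r div M = l" by (auto simp: strip_def)
      then show "r \<in> {l * M ..< l * M + M}"
        using M dividend_less_div_times[of M r] div_times_less_eq_dividend[of r M] by (auto simp: add.commute)
    qed
  qed auto
  then show ?thesis by simp
qed

lemma piece_start:
  assumes "in_cell l c t i"
  shows "piece_start l c t i \<le> t" "\<And>u. piece_start l c t i \<le> u \<Longrightarrow> u \<le> t \<Longrightarrow> in_cell l c u i"
    and "0 < piece_start l c t i \<Longrightarrow> \<not> in_cell l c (piece_start l c t i - 1) i"
proof -
  let ?P = "\<lambda>s. s \<le> t \<and> (\<forall>u. s \<le> u \<and> u \<le> t \<longrightarrow> in_cell l c u i)"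
  have P: "?P (piece_start l c t i)" unfolding piece_start_def
    by (rule LeastI[of ?P t]) (use assms in auto)
  show "piece_start l c t i \<le> t" "\<And>u. piece_start l c t i \<le> u \<Longrightarrow> u \<le> t \<Longrightarrow> in_cell l c u i"
    using P by auto
  show "\<not> in_cell l c (piece_start l c t i - 1) i" if "0 < piece_start l c t i"
  proof
    assume a: "in_cell l c (piece_start l c t i - 1) i"
    define s where "s = piece_start l c t i"
    have "in_cell l c u i" if u: "s - 1 \<le> u" "u \<le> t" for u
    proof (cases "s \<le> u")
      case True
      then show ?thesis using P u(2) unfolding s_def by blast
    next
      case False
      then have "u = s - 1" using u by simp
      then show ?thesis using a by (simp add: s_def)
    qed
    moreover have "s - 1 \<le> t" using conjunct1[OF P] unfolding s_def by linarith
    ultimately have "?P (s - 1)" by blast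
    then have "piece_start l c t i \<le> s - 1" unfolding piece_start_def by (rule Least_le)
    then show False using that by (simp add: s_def)
  qed
qed

lemma in_cell_hull:
  assumes "in_cell l c x i" "in_cell l c y i" "piece_start l c x i = piece_start l c y i"
    and "min x y \<le> t" "t \<le> max x y"
  shows "in_cell l c t i"
proof -
  have "piece_start l c x i \<le> t"
    using piece_start(1)[OF assms(1)] piece_start(1)[OF assms(2)] assms(3,4) by (simp add: min_def split: if_splits)
  note s = this
  have "t \<le> x \<or> t \<le> y" using assms(5) by (simp add: le_max_iff_disj)
  then show ?thesis
  proof
    assume "t \<le> x"
    then show ?thesis using piece_start(2)[OF assms(1) s] by blast
  next
    assume "t \<le> y"
    then show ?thesis using piece_start(2)[OF assms(2) s[unfolded assms(3)]] by blast
  qed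
qed

text \<open>A piece either is present when the cell begins, and a strip holds at most
  \<open>M\<close> items, or starts with an entry into the strip during the cell, of which there are
  fewer than \<open>M\<close>.\<close>

lemma card_pieces: "finite (pieces l c) \<and> card (pieces l c) \<le> 2 * M"
proof (cases "\<exists>t i. in_cell l c t i")
  case False
  then have "pieces l c = {}" by (auto simp: pieces_def)
  then show ?thesis by simp
next
  case True
  define P where "P t \<longleftrightarrow> t \<le> m \<and> entry_count l t div M = c" for t
  define a where "a = (LEAST t. P t)"
  define b where "b = (GREATEST t. P t)"
  obtain t0 where t0: "P t0" using True by (auto simp: P_def in_cell_def)
  have a: "P a" "\<And>t. P t \<Longrightarrow> a \<le> t" unfolding a_def using t0 by (auto intro: LeastI Least_le)
  have b: "P b" unfolding b_def by (rule GreatestI_nat[of P t0 m]) (use t0 in \<open>auto simp: P_def\<close>)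
  have b': "t \<le> b" if "P t" for t
    unfolding b_def by (rule Greatest_le_nat[of P t m]) (use that in \<open>auto simp: P_def\<close>)
  define E where "E = {x \<in> entries. a \<le> fst x \<and> fst x < b \<and> strip (Suc (fst x)) (snd x) = l}"
  have "entry_count l b = entry_count l a + card E"
  proof -
    have "{x \<in> entries. fst x < b \<and> strip (Suc (fst x)) (snd x) = l} =
       {x \<in> entries. fst x < a \<and> strip (Suc (fst x)) (snd x) = l} \<union> E"
      using a(2)[OF b] by (auto simp: E_def)
    then show ?thesis unfolding entry_count_def using finite_entries
      by (simp only:) (rule card_Un_disjoint, auto simp: E_def)
  qed
  moreover have "entry_count l b div M * M = entry_count l a div M * M" using a b by (simp add: P_def)
  moreover have "entry_count l b < entry_count l b div M * M + M" "entry_count l a div M * M \<le> entry_count l a"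
    using M dividend_less_div_times[of M "entry_count l b"] by (simp_all add: add.commute)
  ultimately have E: "card E < M" by linarith
  have sub: "pieces l c \<subseteq> (\<lambda>i. (i, a)) ` {i \<in> V. strip a i = l} \<union> (\<lambda>(t, i). (i, Suc t)) ` E"
  proof
    fix p assume "p \<in> pieces l c"
    then obtain i t where p: "p = (i, piece_start l c t i)" and it: "in_cell l c t i"
      by (auto simp: pieces_def)
    define s where "s = piece_start l c t i"
    note ps = piece_start[OF it, folded s_def]
    have ins: "in_cell l c s i" using ps by auto
    then have Ps: "P s" by (auto simp: P_def in_cell_def)
    show "p \<in> (\<lambda>i. (i, a)) ` {i \<in> V. strip a i = l} \<union> (\<lambda>(t, i). (i, Suc t)) ` E"
    proof (cases "s = a")
      case True
      then show ?thesis using ins by (auto simp: p s_def[symmetric] in_cell_def)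
    next
      case False
      then have as: "a < s" using a(2)[OF Ps] by auto
      \<comment> \<open>The entry count at \<open>s - 1\<close> lies between two values of the same
        block, so that time belongs to the cell too; the piece starts at \<open>s\<close> only
        because its item was in another strip just before.\<close>
      have "entry_count l a \<le> entry_count l (s - 1)" "entry_count l (s - 1) \<le> entry_count l s"
        using as by (auto intro: entry_count_mono)
      then have "entry_count l (s - 1) div M = c"
        using a(1) Ps unfolding P_def by (metis div_le_mono le_antisym)
      then have "strip (s - 1) i \<noteq> l" using ps(3) as ins by (auto simp: in_cell_def)
      then have "(s - 1, i) \<in> E"
        using ins as b'[OF Ps] by (auto simp: E_def entries_def in_cell_def)
      moreover have "p = (\<lambda>(t, i). (i, Suc t)) (s - 1, i)" using as by (simp add: p s_def[symmetric])
      ultimately show ?thesis by blast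
    qed
  qed
  have finE: "finite E" using finite_entries by (simp add: E_def)
  have fin2: "finite ((\<lambda>i. (i, a)) ` {i \<in> V. strip a i = l} \<union> (\<lambda>(t, i). (i, Suc t)) ` E)"
    using fin finE by auto
  have "card (pieces l c) \<le> card ((\<lambda>i. (i, a)) ` {i \<in> V. strip a i = l} \<union> (\<lambda>(t, i). (i, Suc t)) ` E)"
    using fin2 sub by (rule card_mono)
  also have "\<dots> \<le> card ((\<lambda>i. (i, a)) ` {i \<in> V. strip a i = l}) + card ((\<lambda>(t, i). (i, Suc t)) ` E)"
    by (rule card_Un_le)
  also have "\<dots> \<le> card {i \<in> V. strip a i = l} + card E"
    using fin finE by (intro add_mono card_image_le) auto
  also have "\<dots> \<le> M + M" using card_strip[of a l] a(1) E by (auto simp: P_def)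
  finally show ?thesis using finite_subset[OF sub fin2] by simp
qed

lemma in_cell_convex:
  assumes "in_cell l c t i" "in_cell l c t j" "k \<in> V" "h t i \<le> h t k" "h t k \<le> h t j"
  shows "in_cell l c t k"
proof -
  have "height_rank V h t i \<le> height_rank V h t k" "height_rank V h t k \<le> height_rank V h t j"
    using assms height_rank_less_iff[OF fin] by (auto simp: in_cell_def not_less[symmetric])
  then have "strip t i \<le> strip t k" "strip t k \<le> strip t j"
    by (auto simp: strip_def intro: div_le_mono)
  then show ?thesis using assms by (auto simp: in_cell_def)
qed

lemma card_cell_items: "card {k \<in> V. \<exists>t. in_cell l c t k} \<le> 2 * M"
proof -
  have "{k \<in> V. \<exists>t. in_cell l c t k} \<subseteq> fst ` pieces l c" by (force simp: pieces_def)
  then have "card {k \<in> V. \<exists>t. in_cell l c t k} \<le> card (fst ` pieces l c)"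
    using card_pieces by (intro card_mono) auto
  also have "\<dots> \<le> card (pieces l c)" using card_pieces by (intro card_image_le) auto
  finally show ?thesis using card_pieces[of l c] by simp
qed

text \<open>A touching joins the pieces of its items at the chosen touching time. Pieces, not items,
  are the vertices, since an item may leave the cell between two of its touching times unless both
  lie in one piece.\<close>

definition edge :: "nat \<Rightarrow> nat \<Rightarrow> 'a \<times> 'a \<Rightarrow> ('a \<times> nat) \<times> ('a \<times> nat)" where
  "edge l c x = (let t = touch_time V m h (fst x) (snd x) in
     ((fst x, piece_start l c t (fst x)), (snd x, piece_start l c t (snd x))))"

lemma edges_subset: "edge l c ` cell_touches l c \<subseteq> pieces l c \<times> pieces l c"
proof
  fix e assume "e \<in> edge l c ` cell_touches l c"
  then obtain i j where "(i, j) \<in> cell_touches l c" "e = edge l c (i, j)" by auto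
  then show "e \<in> pieces l c \<times> pieces l c"
    unfolding edge_def cell_touches_def pieces_def Let_def by simp blast
qed

lemma card_edges: "card (edge l c ` cell_touches l c) = card (cell_touches l c)"
proof (rule card_image, rule inj_onI)
  fix x y assume "edge l c x = edge l c y"
  then show "x = y" by (simp add: edge_def Let_def prod_eq_iff)
qed

lemma card_cell_touches: "card (cell_touches l c) \<le> 4 * M^2"
proof -
  have "card (cell_touches l c) \<le> card (pieces l c \<times> pieces l c)"
    unfolding card_edges[symmetric] using edges_subset card_pieces by (intro card_mono) auto
  also have "\<dots> \<le> (2 * M) * (2 * M)"
    unfolding card_cartesian_product using card_pieces by (intro mult_le_mono) auto
  finally show ?thesis by (simp add: power2_eq_square)
qed

text \<open>A four-cycle of pieces supplies the four stays that \<open>lens_from_C4\<close>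
  requires, with the cell as region. The cell meets at most \<open>2 * M\<close> items, whence the
  size of the lenses considered.\<close>

lemma card_cell_touches_no_lens:
  assumes Mk: "M = k^2"
    and no: "\<not> (\<exists>s u v. (s, u, v) \<in> lenses (2 * M) V m h \<and> in_cell l c (Suc s) u)"
  shows "card (cell_touches l c) \<le> 4 * k^3"
proof -
  have "card (edge l c ` cell_touches l c) \<le> 4 * k^3"
  proof (rule card_edges_C4_free[OF _ _ edges_subset])
    fix F F' G G'
    assume E: "(F, G) \<in> edge l c ` cell_touches l c" "(F', G) \<in> edge l c ` cell_touches l c"
      "(F, G') \<in> edge l c ` cell_touches l c" "(F', G') \<in> edge l c ` cell_touches l c"
    define f f' g g' where "f = fst F" and "f' = fst F'" and "g = fst G" and "g' = fst G'"
    define \<tau> where "\<tau> = touch_time V m h"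
    have *: "(fst A, fst B) \<in> touches V m h \<and> in_cell l c (\<tau> (fst A) (fst B)) (fst A) \<and>
        in_cell l c (\<tau> (fst A) (fst B)) (fst B) \<and>
        snd A = piece_start l c (\<tau> (fst A) (fst B)) (fst A) \<and> snd B = piece_start l c (\<tau> (fst A) (fst B)) (fst B) \<and>
        touches_at V m h (fst A) (fst B) (\<tau> (fst A) (fst B))"
      if AB: "(A, B) \<in> edge l c ` cell_touches l c" for A B
    proof -
      obtain i j where ij: "(i, j) \<in> cell_touches l c" "(A, B) = edge l c (i, j)" using AB by auto
      then show ?thesis using touch_time[of i j V m h] by (auto simp: edge_def Let_def cell_touches_def \<tau>_def)
    qed
    note e1 = *[OF E(1)] note e2 = *[OF E(2)] note e3 = *[OF E(3)] note e4 = *[OF E(4)]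
    show "F = F' \<or> G = G'"
    proof (rule ccontr)
      assume n: "\<not> (F = F' \<or> G = G')"
      \<comment> \<open>If \<open>f = f'\<close>, both pieces touch \<open>g\<close> at the same
        chosen time, so they have the same start and coincide.\<close>
      have ff: "f \<noteq> f'" using n e1 e2 unfolding f_def f'_def by (metis prod_eqI)
      have gg: "g \<noteq> g'" using n e1 e3 unfolding g_def g'_def by (metis prod_eqI)
      have "\<exists>s u v. (s, u, v) \<in> lenses (2 * M) V m h \<and> in_cell l c (Suc s) u"
      proof (rule lens_from_C4[where f = f and f' = f' and g = g and g' = g' and x = "\<tau> f g" and x' = "\<tau> f' g"
            and y = "\<tau> f g'" and y' = "\<tau> f' g'"])
        show "f \<in> V" "f' \<in> V" "g \<in> V" "g' \<in> V"
          using e1 e4 by (auto simp: f_def f'_def g_def g'_def in_cell_def)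
        show "f \<noteq> f'" "g \<noteq> g'" by fact+
        show "touches_at V m h f g (\<tau> f g)" "touches_at V m h f' g (\<tau> f' g)"
          "touches_at V m h f g' (\<tau> f g')" "touches_at V m h f' g' (\<tau> f' g')"
          using e1 e2 e3 e4 by (auto simp: f_def f'_def g_def g'_def)
        show "h t f < h t g \<and> h t f' < h t g \<and> h t f < h t g' \<and> h t f' < h t g'" if "t \<le> m" for t
          using that e1 e2 e3 e4 by (auto simp: f_def f'_def g_def g'_def touches_def)
        show "inj_on (h t) V" if "t \<le> m" for t using inj[OF that] .
        show "finite V" by (rule fin)
        show "in_cell l c t k" if "in_cell l c t i" "in_cell l c t j" "k \<in> V" "h t i \<le> h t k" "h t k \<le> h t j" for t i j k
          using that by (rule in_cell_convex)
        show "in_cell l c t f" if "min (\<tau> f g) (\<tau> f g') \<le> t" "t \<le> max (\<tau> f g) (\<tau> f g')" for t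
          by (rule in_cell_hull[OF _ _ _ that]) (use e1 e3 in \<open>auto simp: f_def g_def g'_def\<close>)
        show "in_cell l c t f'" if "min (\<tau> f' g) (\<tau> f' g') \<le> t" "t \<le> max (\<tau> f' g) (\<tau> f' g')" for t
          by (rule in_cell_hull[OF _ _ _ that]) (use e2 e4 in \<open>auto simp: f'_def g_def g'_def\<close>)
        show "in_cell l c t g" if "min (\<tau> f g) (\<tau> f' g) \<le> t" "t \<le> max (\<tau> f g) (\<tau> f' g)" for t
          by (rule in_cell_hull[OF _ _ _ that]) (use e1 e2 in \<open>auto simp: f_def f'_def g_def\<close>)
        show "in_cell l c t g'" if "min (\<tau> f g') (\<tau> f' g') \<le> t" "t \<le> max (\<tau> f g') (\<tau> f' g')" for t
          by (rule in_cell_hull[OF _ _ _ that]) (use e3 e4 in \<open>auto simp: f_def f'_def g'_def\<close>)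
        show "card {k \<in> V. \<exists>t. in_cell l c t k} \<le> 2 * M" by (rule card_cell_items)
      qed
      then show False using no by blast
    qed
  qed (use card_pieces[of l c] Mk in auto)
  then show ?thesis by (simp add: card_edges)
qed

definition cells :: "(nat \<times> nat) set" where
  "cells = (SIGMA l:{..card V}. {..entry_count l m div M})"

lemma card_cells: "real (card cells) \<le> real (card entries) / real M + real (card V) + 1"
proof -
  have "(\<Sum>l\<le>card V. entry_count l m) = card (\<Union>l\<le>card V. {x \<in> entries. fst x < m \<and> strip (Suc (fst x)) (snd x) = l})"
    unfolding entry_count_def using finite_entries by (subst card_UN_disjoint) auto
  also have "\<dots> \<le> card entries" using finite_entries by (intro card_mono) auto
  finally have s: "(\<Sum>l\<le>card V. entry_count l m) \<le> card entries" .
  have "real (card cells) = (\<Sum>l\<le>card V. real (entry_count l m div M) + 1)"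
    by (simp add: cells_def add.commute)
  also have "\<dots> \<le> (\<Sum>l\<le>card V. real (entry_count l m) / real M + 1)"
    by (intro sum_mono add_mono of_nat_div_le_of_nat) auto
  also have "\<dots> = real (\<Sum>l\<le>card V. entry_count l m) / real M + real (card V) + 1"
    by (simp add: sum.distrib sum_divide_distrib)
  also have "\<dots> \<le> real (card entries) / real M + real (card V) + 1"
    using s by (intro add_right_mono divide_right_mono) (simp_all only: of_nat_le_iff of_nat_0_le_iff)
  finally show ?thesis .
qed

text \<open>A cell in which no lens opens carries at most \<open>4 * k^3\<close> touchings, any
  other at most \<open>4 * M^2\<close>. Charging a lens to the cell of its upper item just after
  opening bounds the number of the latter by the number of lenses.\<close>

lemma card_strip_touches:
  assumes Mk: "M = k^2"
  shows "real (card {(i, j) \<in> touches V m h. strip (touch_time V m h i j) i = strip (touch_time V m h i j) j})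
     \<le> (real (card entries) / real M + real (card V) + 1) * (4 * real k^3)
        + 4 * (real M)^2 * real (card (lenses (2 * M) V m h))"
    (is "real (card ?T) \<le> _")
proof -
  define LC where "LC = {(l, c). \<exists>s u v. (s, u, v) \<in> lenses (2 * M) V m h \<and> in_cell l c (Suc s) u}"
  have fc: "finite cells" by (simp add: cells_def)
  have finL: "finite (lenses (2 * M) V m h)" by (rule finite_lenses[OF fin])
  have "LC \<subseteq> (\<lambda>(s, u, v). (strip (Suc s) u, entry_count (strip (Suc s) u) (Suc s) div M)) ` lenses (2 * M) V m h"
    unfolding LC_def in_cell_def by force
  then have LC: "finite LC" "card LC \<le> card (lenses (2 * M) V m h)"
    using finL by (auto intro: finite_subset surj_card_le)
  have "?T \<subseteq> (\<Union>x\<in>cells. cell_touches (fst x) (snd x))"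
  proof clarify
    fix i j assume ij: "(i, j) \<in> touches V m h"
      and st: "strip (touch_time V m h i j) i = strip (touch_time V m h i j) j"
    let ?t = "touch_time V m h i j"
    let ?l = "strip ?t i"
    have t: "?t \<le> m" using touch_time[OF ij] by (simp add: touches_at_def)
    have V: "i \<in> V" "j \<in> V" using ij by (auto simp: touches_def)
    have "height_rank V h ?t i < card V"
      unfolding height_rank_def using fin V by (intro psubset_card_mono) auto
    moreover have "card V \<le> card V * M" using M by simp
    ultimately have "height_rank V h ?t i + off < card V * M + M" using off by linarith
    then have "height_rank V h ?t i + off < (card V + 1) * M" by simp
    then have "?l \<le> card V"
      unfolding strip_def by (metis Suc_eq_plus1 less_Suc_eq_le less_mult_imp_div_less)
    moreover have "entry_count ?l ?t div M \<le> entry_count ?l m div M"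
      using t by (intro div_le_mono entry_count_mono)
    ultimately have "(?l, entry_count ?l ?t div M) \<in> cells" by (simp add: cells_def)
    moreover have "(i, j) \<in> cell_touches ?l (entry_count ?l ?t div M)"
      using ij st t V by (simp add: cell_touches_def in_cell_def)
    ultimately show "(i, j) \<in> (\<Union>x\<in>cells. cell_touches (fst x) (snd x))" by force
  qed
  moreover have "finite (cell_touches l c)" for l c
    using finite_touches[OF fin] by (rule rev_finite_subset) (auto simp: cell_touches_def)
  ultimately have "card ?T \<le> card (\<Union>x\<in>cells. cell_touches (fst x) (snd x))"
    using fc by (intro card_mono) auto
  also have "\<dots> \<le> (\<Sum>x\<in>cells. card (cell_touches (fst x) (snd x)))"
    using fc by (rule card_UN_le)
  also have "\<dots> \<le> (\<Sum>x\<in>cells. 4 * k^3 + (if x \<in> LC then 4 * M^2 else 0))"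
  proof (rule sum_mono)
    fix x assume "x \<in> cells"
    show "card (cell_touches (fst x) (snd x)) \<le> 4 * k^3 + (if x \<in> LC then 4 * M^2 else 0)"
      using card_cell_touches[of "fst x" "snd x"] card_cell_touches_no_lens[OF Mk, of "fst x" "snd x"]
      by (cases x) (auto simp: LC_def)
  qed
  also have "\<dots> = card cells * (4 * k^3) + card (cells \<inter> LC) * (4 * M^2)"
    using fc by (simp add: sum.distrib sum.inter_restrict[symmetric])
  also have "\<dots> \<le> card cells * (4 * k^3) + card (lenses (2 * M) V m h) * (4 * M^2)"
    using LC card_mono[of LC "cells \<inter> LC"] by (intro add_left_mono mult_right_mono) auto
  finally have "real (card ?T) \<le> real (card cells * (4 * k^3) + card (lenses (2 * M) V m h) * (4 * M^2))"
    by (simp only: of_nat_le_iff)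
  also have "\<dots> = real (card cells) * (4 * real k^3) + 4 * (real M)^2 * real (card (lenses (2 * M) V m h))"
    by simp
  also have "real (card cells) * (4 * real k^3) \<le> (real (card entries) / real M + real (card V) + 1) * (4 * real k^3)"
    using card_cells by (intro mult_right_mono) auto
  finally show ?thesis by simp
qed

end


section \<open>Averaging over the offset of the strips\<close>

lemma card_offsets_between:
  fixes a b M :: nat
  assumes "a \<le> b"
  shows "card {off \<in> {..<M}. (a + off) div M \<noteq> (b + off) div M} \<le> b - a"
  using assms
proof (induction b rule: dec_induct)
  case base
  then show ?case by simp
next
  case (step b)
  \<comment> \<open>A boundary falls between \<open>b\<close> and \<open>Suc b\<close> only if
    \<open>M\<close> divides \<open>Suc (b + off)\<close>, which determines \<open>off\<close> below
    \<open>M\<close>; so each unit of distance is cut by at most one offset.\<close>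
  have "off = off'" if o: "off < M" "off' < M" "(b + off) div M \<noteq> (Suc b + off) div M"
      "(b + off') div M \<noteq> (Suc b + off') div M" for off off'
  proof -
    have "M dvd Suc (b + off)" "M dvd Suc (b + off')"
      using o(3,4) by (auto simp: div_Suc dvd_eq_mod_eq_0 split: if_splits)
    then have "M dvd off' - off" "M dvd off - off'"
      using dvd_diff_nat[of M "Suc (b + off')" "Suc (b + off)"] dvd_diff_nat[of M "Suc (b + off)" "Suc (b + off')"] by auto
    then show ?thesis using o(1,2) by (auto dest!: dvd_imp_le split: nat_diff_split)
  qed
  then have "card {off \<in> {..<M}. (b + off) div M \<noteq> (Suc b + off) div M} \<le> Suc 0"
    by (subst card_le_Suc0_iff_eq) auto
  moreover have "card {off \<in> {..<M}. (a + off) div M \<noteq> (Suc b + off) div M} \<le>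
     card ({off \<in> {..<M}. (a + off) div M \<noteq> (b + off) div M} \<union> {off \<in> {..<M}. (b + off) div M \<noteq> (Suc b + off) div M})"
    by (intro card_mono) auto
  ultimately show ?case
    using step card_Un_le[of "{off \<in> {..<M}. (a + off) div M \<noteq> (b + off) div M}" "{off \<in> {..<M}. (b + off) div M \<noteq> (Suc b + off) div M}"]
    by linarith
qed

lemma card_offsets_diff:
  fixes a b c M :: nat
  assumes "b \<le> a + c" "a \<le> b + c"
  shows "card {off \<in> {..<M}. (a + off) div M \<noteq> (b + off) div M} \<le> c"
proof (cases "a \<le> b")
  case True
  then show ?thesis using card_offsets_between[of a b M] assms by linarith
next
  case False
  moreover have "{off \<in> {..<M}. (a + off) div M \<noteq> (b + off) div M} = {off \<in> {..<M}. (b + off) div M \<noteq> (a + off) div M}"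
    by auto
  ultimately show ?thesis using card_offsets_between[of b a M] assms by simp
qed

lemma height_rank_step:
  assumes "height_system V m h" "t < m" "i \<in> V"
  shows "height_rank V h (Suc t) i \<le> height_rank V h t i + card {k. (t, i, k) \<in> crossings V m h}"
    and "height_rank V h t i \<le> height_rank V h (Suc t) i + card {k. (t, k, i) \<in> crossings V m h}"
proof -
  have fin: "finite V" and inj: "inj_on (h t) V" "inj_on (h (Suc t)) V"
    using assms by (auto simp: height_system_def)
  have f: "finite {k. (t, i, k) \<in> crossings V m h}" "finite {k. (t, k, i) \<in> crossings V m h}"
    using fin by (auto intro: finite_subset[of _ V] simp: crossings_def)
  have ne: "h t k \<noteq> h t i \<and> h (Suc t) k \<noteq> h (Suc t) i" if "k \<in> V" "k \<noteq> i" for k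
    using inj that assms(3) by (auto simp: inj_on_def)
  have "{k \<in> V. h (Suc t) k < h (Suc t) i} \<subseteq> {k \<in> V. h t k < h t i} \<union> {k. (t, i, k) \<in> crossings V m h}"
    using ne assms by (auto simp: crossings_def) (metis less_irrefl linorder_neqE_linordered_idom)
  then show "height_rank V h (Suc t) i \<le> height_rank V h t i + card {k. (t, i, k) \<in> crossings V m h}"
    unfolding height_rank_def using fin f by (intro order_trans[OF card_mono card_Un_le]) auto
  have "{k \<in> V. h t k < h t i} \<subseteq> {k \<in> V. h (Suc t) k < h (Suc t) i} \<union> {k. (t, k, i) \<in> crossings V m h}"
    using ne assms by (auto simp: crossings_def) (metis less_irrefl linorder_neqE_linordered_idom)
  then show "height_rank V h t i \<le> height_rank V h (Suc t) i + card {k. (t, k, i) \<in> crossings V m h}"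
    unfolding height_rank_def using fin f by (intro order_trans[OF card_mono card_Un_le]) auto
qed

lemma sum_card_swap:
  assumes "finite A" "finite B"
  shows "(\<Sum>a\<in>A. card {b \<in> B. P a b}) = (\<Sum>b\<in>B. card {a \<in> A. P a b})"
  using assms by (rule sum_multicount_gen) simp

text \<open>A change of rank by \<open>c\<close> is an entry for at most \<open>c\<close> offsets,
  and in one step a rank changes by at most the number of crossings of the item. Each crossing is
  counted once for either of its two items.\<close>

lemma sum_entries:
  assumes sys: "height_system V m h"
  shows "(\<Sum>off<M. card {(t, i). t < m \<and> i \<in> V \<and>
      (height_rank V h t i + off) div M \<noteq> (height_rank V h (Suc t) i + off) div M}) \<le> 2 * card (crossings V m h)"
proof -
  have fin: "finite V" using sys by (simp add: height_system_def)
  let ?X = "crossings V m h"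
  define P where "P off x \<longleftrightarrow> (height_rank V h (fst x) (snd x) + off) div M \<noteq> (height_rank V h (Suc (fst x)) (snd x) + off) div M" for off x
  have e: "{(t, i). t < m \<and> i \<in> V \<and> (height_rank V h t i + off) div M \<noteq> (height_rank V h (Suc t) i + off) div M} =
      {x \<in> {..<m} \<times> V. P off x}" for off by (auto simp: P_def)
  have "(\<Sum>off<M. card {x \<in> {..<m} \<times> V. P off x}) = (\<Sum>x\<in>{..<m} \<times> V. card {off \<in> {..<M}. P off x})"
    using fin by (intro sum_card_swap) auto
  also have "\<dots> \<le> (\<Sum>x\<in>{..<m} \<times> V. card {k \<in> V. (fst x, snd x, k) \<in> ?X} + card {k \<in> V. (fst x, k, snd x) \<in> ?X})"
  proof (rule sum_mono)
    fix x assume x: "x \<in> {..<m} \<times> V"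
    have "{k. (fst x, snd x, k) \<in> ?X} = {k \<in> V. (fst x, snd x, k) \<in> ?X}" "{k. (fst x, k, snd x) \<in> ?X} = {k \<in> V. (fst x, k, snd x) \<in> ?X}"
      by (auto simp: crossings_def)
    then show "card {off \<in> {..<M}. P off x} \<le> card {k \<in> V. (fst x, snd x, k) \<in> ?X} + card {k \<in> V. (fst x, k, snd x) \<in> ?X}"
      unfolding P_def using height_rank_step[OF sys, of "fst x" "snd x"] x
      by (intro card_offsets_diff) auto
  qed
  also have "\<dots> = (\<Sum>x\<in>{..<m} \<times> V. card {k \<in> V. (fst x, snd x, k) \<in> ?X}) + (\<Sum>x\<in>{..<m} \<times> V. card {k \<in> V. (fst x, k, snd x) \<in> ?X})"
    by (rule sum.distrib)
  also have "(\<Sum>x\<in>{..<m} \<times> V. card {k \<in> V. (fst x, snd x, k) \<in> ?X}) = card (SIGMA x:{..<m} \<times> V. {k \<in> V. (fst x, snd x, k) \<in> ?X})"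
    using fin by simp
  also have "\<dots> = card ?X"
    by (rule bij_betw_same_card[of "\<lambda>((t, i), k). (t, i, k)"], rule bij_betwI[where g = "\<lambda>(t, i, k). ((t, i), k)"])
      (auto simp: crossings_def)
  also have "(\<Sum>x\<in>{..<m} \<times> V. card {k \<in> V. (fst x, k, snd x) \<in> ?X}) = card (SIGMA x:{..<m} \<times> V. {k \<in> V. (fst x, k, snd x) \<in> ?X})"
    using fin by simp
  also have "\<dots> = card ?X"
    by (rule bij_betw_same_card[of "\<lambda>((t, i), k). (t, k, i)"], rule bij_betwI[where g = "\<lambda>(t, k, i). ((t, i), k)"])
      (auto simp: crossings_def)
  finally show ?thesis unfolding e by simp
qed

text \<open>At the touching time the pair has consecutive ranks, so at most one of the
  \<open>M\<close> offsets puts a strip boundary between the two.\<close>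

lemma sum_strip_touches:
  assumes sys: "height_system V m h"
  shows "(M - 1) * card (touches V m h) \<le> (\<Sum>off<M. card {(i, j) \<in> touches V m h.
      (height_rank V h (touch_time V m h i j) i + off) div M = (height_rank V h (touch_time V m h i j) j + off) div M})"
proof -
  have fin: "finite V" using sys by (simp add: height_system_def)
  define P where "P off x \<longleftrightarrow> (height_rank V h (touch_time V m h (fst x) (snd x)) (fst x) + off) div M =
     (height_rank V h (touch_time V m h (fst x) (snd x)) (snd x) + off) div M" for off x
  have e: "{(i, j) \<in> touches V m h. (height_rank V h (touch_time V m h i j) i + off) div M = (height_rank V h (touch_time V m h i j) j + off) div M}
     = {x \<in> touches V m h. P off x}" for off by (auto simp: P_def)
  have "(M - 1) * card (touches V m h) = (\<Sum>x\<in>touches V m h. M - 1)" by simp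
  also have "\<dots> \<le> (\<Sum>x\<in>touches V m h. card {off \<in> {..<M}. P off x})"
  proof (rule sum_mono)
    fix x assume x: "x \<in> touches V m h"
    let ?t = "touch_time V m h (fst x) (snd x)"
    have t: "touches_at V m h (fst x) (snd x) ?t" using x touch_time[of "fst x" "snd x" V m h] by simp
    have V: "fst x \<in> V" "snd x \<in> V" using x by (auto simp: touches_def)
    have "height_rank V h ?t (snd x) = height_rank V h ?t (fst x) + Suc (card {k \<in> V. h ?t (fst x) < h ?t k \<and> h ?t k < h ?t (snd x)})"
      using t V sys by (intro height_rank_eq_between) (auto simp: height_system_def touches_at_def)
    also have "{k \<in> V. h ?t (fst x) < h ?t k \<and> h ?t k < h ?t (snd x)} = {}" using t by (auto simp: touches_at_def)
    finally have r: "height_rank V h ?t (snd x) = height_rank V h ?t (fst x) + 1" by simp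
    have "card {off \<in> {..<M}. \<not> P off x} \<le> 1"
      unfolding P_def using r by (intro card_offsets_diff) auto
    moreover have "M = card ({off \<in> {..<M}. P off x} \<union> {off \<in> {..<M}. \<not> P off x})"
      by (subst card_lessThan[of M, symmetric]) (rule arg_cong[of _ _ card], auto)
    moreover have "\<dots> \<le> card {off \<in> {..<M}. P off x} + card {off \<in> {..<M}. \<not> P off x}" by (rule card_Un_le)
    ultimately show "M - 1 \<le> card {off \<in> {..<M}. P off x}" by linarith
  qed
  also have "\<dots> = (\<Sum>off<M. card {x \<in> touches V m h. P off x})"
    using finite_touches[OF fin] by (intro sum_card_swap) auto
  finally show ?thesis unfolding e .
qed

text \<open>The bounds for single offsets are summed over all \<open>M = k^2\<close> of them. The
  entries contribute \<open>(2 X / k^2) * 4 k^3 = 8 k X\<close> for \<open>X\<close> crossings, and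
  division by \<open>M - 1 \<ge> k^2 / 2\<close> leaves \<open>16 X / k\<close>.\<close>

lemma touches_lens_bound:
  assumes sys: "height_system V m h" and k: "2 \<le> k"
  shows "real (card (touches V m h)) \<le> 16 / real k * real (card (crossings V m h))
     + 16 * real k^3 * real (card V) + 8 * real k^4 * real (card (lenses (2 * k^2) V m h))"
proof (cases "V = {}")
  case True
  then show ?thesis by (simp add: touches_def)
next
  case False
  define T X n L where "T = real (card (touches V m h))" and "X = real (card (crossings V m h))"
    and "n = real (card V)" and "L = real (card (lenses (2 * k^2) V m h))"
  have fin: "finite V" using sys by (simp add: height_system_def)
  have n: "1 \<le> n" using False fin by (simp add: n_def Suc_le_eq card_gt_0_iff)
  have nn: "0 \<le> T" "0 \<le> X" "0 \<le> L" by (auto simp: T_def X_def L_def)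
  define M where "M = k^2"
  define K where "K = real k"
  have K: "2 \<le> K" using k by (simp add: K_def)
  have MK: "real M = K^2" by (simp add: M_def K_def)
  have M: "4 \<le> M" using power_mono[OF k, of 2] by (simp add: M_def)
  define En where "En off = card {(t, i). t < m \<and> i \<in> V \<and>
      (height_rank V h t i + off) div M \<noteq> (height_rank V h (Suc t) i + off) div M}" for off
  define To where "To off = card {(i, j) \<in> touches V m h.
      (height_rank V h (touch_time V m h i j) i + off) div M = (height_rank V h (touch_time V m h i j) j + off) div M}" for off
  have each: "real (To off) \<le> (real (En off) / real M + n + 1) * (4 * K^3) + 4 * (real M)^2 * L" if "off < M" for off
  proof -
    interpret strip_decomposition V m h M off by unfold_locales (use sys that in auto)
    note c = card_strip_touches[OF M_def, unfolded entries_def strip_def]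
    show ?thesis
      using c unfolding To_def[symmetric] En_def[symmetric] n_def[symmetric] K_def[symmetric] L_def M_def[symmetric] .
  qed
  have "real ((M - 1) * card (touches V m h)) \<le> real (\<Sum>off<M. To off)"
    using sum_strip_touches[OF sys, of M] unfolding To_def by (simp only: of_nat_le_iff)
  also have "\<dots> = (\<Sum>off<M. real (To off))" by simp
  also have "\<dots> \<le> (\<Sum>off<M. (real (En off) / real M + n + 1) * (4 * K^3) + 4 * (real M)^2 * L)"
    using each by (intro sum_mono) auto
  also have "\<dots> = (real (\<Sum>off<M. En off) / real M + real M * (n + 1)) * (4 * K^3) + real M * (4 * (real M)^2 * L)"
    by (simp add: sum.distrib sum_distrib_right[symmetric] sum_divide_distrib[symmetric] algebra_simps)
  also have "\<dots> \<le> (2 * X / real M + real M * (n + 1)) * (4 * K^3) + real M * (4 * (real M)^2 * L)"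
  proof -
    have "(\<Sum>off<M. En off) \<le> 2 * card (crossings V m h)"
      using sum_entries[OF sys, of M] unfolding En_def .
    then have "real (\<Sum>off<M. En off) \<le> 2 * X" unfolding X_def by linarith
    then show ?thesis using K by (intro add_right_mono mult_right_mono divide_right_mono) auto
  qed
  also have "\<dots> = K^2 / 2 * (16 / K * X + 8 * K^3 * (n + 1) + 8 * K^4 * L)"
    unfolding MK using K by (simp add: field_simps eval_nat_numeral)
  finally have 1: "real ((M - 1) * card (touches V m h)) \<le> K^2 / 2 * (16 / K * X + 8 * K^3 * (n + 1) + 8 * K^4 * L)" .
  have "K^2 / 2 * T \<le> (real M - 1) * T"
    using M nn unfolding MK[symmetric] by (intro mult_right_mono) auto
  also have "\<dots> = real ((M - 1) * card (touches V m h))" using M by (simp add: T_def of_nat_diff)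
  also note 1
  finally have "K^2 / 2 * T \<le> K^2 / 2 * (16 / K * X + 8 * K^3 * (n + 1) + 8 * K^4 * L)" .
  moreover have "0 < K^2 / 2" using K by simp
  ultimately have "T \<le> 16 / K * X + 8 * K^3 * (n + 1) + 8 * K^4 * L"
    by (rule mult_left_le_imp_le)
  also have "8 * K^3 * (n + 1) \<le> 8 * K^3 * (2 * n)" using n K by (intro mult_left_mono) auto
  finally show ?thesis by (simp add: T_def X_def n_def L_def K_def)
qed


text \<open>If the bound holds with slope \<open>\<rho> \<ge> \<delta>\<close>, then a convex combination of \<open>sampling\<close> (which gains when
  there are many lenses) and \<open>touches_lens_bound\<close> (which gains when there are few) gives slope
  \<open>\<rho> - \<kappa>\<close> with \<open>\<kappa>\<close> depending on \<open>\<delta>\<close> only.\<close>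

theorem touches_linear_bound:
  fixes \<delta> :: real
  assumes \<delta>: "0 < \<delta>"
  shows "\<exists>C\<ge>0. \<forall>V m (h :: nat \<Rightarrow> 'a \<Rightarrow> real). height_system V m h \<longrightarrow>
     real (card (touches V m h)) \<le> \<delta> * real (card (crossings V m h)) + C * real (card V)"
proof -
  define B where "B \<rho> \<longleftrightarrow> (\<exists>C\<ge>0. \<forall>V m (h :: nat \<Rightarrow> 'a \<Rightarrow> real). height_system V m h \<longrightarrow>
     real (card (touches V m h)) \<le> \<rho> * real (card (crossings V m h)) + C * real (card V))" for \<rho>
  have B_mono: "B \<rho>'" if "B \<rho>" "\<rho> \<le> \<rho>'" for \<rho> \<rho>'
  proof -
    have "\<rho> * real x \<le> \<rho>' * real x" for x using that(2) by (intro mult_right_mono) auto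
    then show ?thesis using that(1) unfolding B_def by (meson add_right_mono order_trans)
  qed
  \<comment> \<open>This makes \<open>16 / k \<le> \<delta> / 2\<close>: half of the target slope is
    used up, the other half pays for the improvement \<kappa>.\<close>
  obtain k0 :: nat where k0: "32 / \<delta> < real k0" using reals_Archimedean2 by blast
  define k where "k = max 2 k0"
  have k: "2 \<le> k" "32 / \<delta> < real k" using k0 by (auto simp: k_def)
  have k\<delta>: "16 / real k \<le> \<delta> / 2" using k \<delta> by (simp add: field_simps)
  define A where "A = 2 * k^2"
  define C1 C2 where "C1 = 16 * real k^3" and "C2 = 8 * real k^4"
  have C: "0 \<le> C1" "0 \<le> C2" by (auto simp: C1_def C2_def)
  have I: "real (card (touches V m h)) \<le> \<delta> / 2 * real (card (crossings V m h)) + C1 * real (card V)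
      + C2 * real (card (lenses A V m h))" if "height_system V m h" for V m and h :: "nat \<Rightarrow> 'a \<Rightarrow> real"
  proof -
    have "16 / real k * real (card (crossings V m h)) \<le> \<delta> / 2 * real (card (crossings V m h))"
      using k\<delta> by (intro mult_right_mono) auto
    then show ?thesis using touches_lens_bound[OF that k(1)] by (simp add: C1_def C2_def A_def)
  qed
  define \<rho>0 where "\<rho>0 = \<delta> + C2"
  \<comment> \<open>The weight of \<open>touches_lens_bound\<close> in the combination, so small
    that \<open>\<mu> * C2 \<le> \<delta> / 2 \<le> (1 - \<mu>) * \<rho>\<close>: the gain from
    lenses in sampling outweighs the loss from them.\<close>
  define \<mu> where "\<mu> = \<delta> / (2 * (C2 + \<delta>))"
  have \<mu>: "0 < \<mu>" "\<mu> \<le> 1 / 2" "\<mu> * C2 \<le> \<delta> / 2" using \<delta> C by (auto simp: \<mu>_def field_simps)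
  \<comment> \<open>The combination gains
    \<open>\<mu> * (\<rho> - \<delta> / 2) \<ge> 2 * \<kappa>\<close> on the slope; one \<kappa> of
    it covers the loss of sampling.\<close>
  define \<kappa> where "\<kappa> = \<mu> * \<delta> / 4"
  have \<kappa>: "0 < \<kappa>" using \<mu> \<delta> by (simp add: \<kappa>_def)
  have base: "B \<rho>0"
    unfolding B_def
  proof (intro exI[of _ C1] conjI allI impI C)
    fix V m and h :: "nat \<Rightarrow> 'a \<Rightarrow> real" assume sys: "height_system V m h"
    have "card (lenses A V m h) \<le> card (crossings V m h)"
      using sys by (intro card_mono lenses_subset_crossings finite_crossings) (simp add: height_system_def)
    then have "C2 * real (card (lenses A V m h)) \<le> C2 * real (card (crossings V m h))"
      using C by (intro mult_left_mono) auto
    moreover have "\<delta> / 2 * real (card (crossings V m h)) \<le> \<delta> * real (card (crossings V m h))"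
      using \<delta> by (intro mult_right_mono) auto
    ultimately show "real (card (touches V m h)) \<le> \<rho>0 * real (card (crossings V m h)) + C1 * real (card V)"
      using I[OF sys] by (simp add: \<rho>0_def algebra_simps)
  qed
  have step: "B (\<rho> - \<kappa>)" if \<rho>: "\<delta> \<le> \<rho>" "\<rho> \<le> \<rho>0" and B\<rho>: "B \<rho>" for \<rho>
  proof -
    obtain C where C0: "0 \<le> C" and bd: "\<And>V m (h :: nat \<Rightarrow> 'a \<Rightarrow> real). height_system V m h \<Longrightarrow>
     real (card (touches V m h)) \<le> \<rho> * real (card (crossings V m h)) + C * real (card V)"
      using B\<rho> unfolding B_def by blast
    define D where "D = real (5 * A + 6)"
    have D: "1 \<le> D" by (simp add: D_def)
    have \<rho>0: "0 < \<rho>0" using \<rho> \<delta> by linarith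
    \<comment> \<open>The first bound keeps \<open>p \<ge> 1 / 2\<close>, the second keeps the slope
      after division by \<open>p\<close> within \<open>\<rho> + \<kappa>\<close>.\<close>
    define q where "q = min (1 / (2 * D)) (\<kappa> / (2 * D * \<rho>0))"
    have q0: "0 < q" using D \<kappa> \<rho>0 by (auto simp: q_def)
    have q1: "D * q \<le> 1 / 2"
    proof -
      have "D * q \<le> D * (1 / (2 * D))" using D by (intro mult_left_mono) (auto simp: q_def)
      then show ?thesis using D by simp
    qed
    have q2: "2 * D * q * \<rho>0 \<le> \<kappa>"
    proof -
      have "2 * D * \<rho>0 * q \<le> 2 * D * \<rho>0 * (\<kappa> / (2 * D * \<rho>0))"
        using D \<rho>0 by (intro mult_left_mono) (auto simp: q_def)
      then show ?thesis using D \<rho>0 by (simp add: mult_ac)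
    qed
    have q3: "q \<le> 1"
    proof -
      have "1 * q \<le> D * q" using D q0 by (intro mult_right_mono) auto
      then show ?thesis using q1 by simp
    qed
    define p where "p = 1 - D * q"
    have p: "1 / 2 \<le> p" "p \<le> 1" using q1 D q0 by (auto simp: p_def)
    have rp: "\<rho> / p \<le> \<rho> + \<kappa>"
    proof -
      have "\<rho> * (D * q) \<le> \<rho>0 * (D * q)" using \<rho> D q0 by (intro mult_right_mono) auto
      then have "2 * (\<rho> * (D * q)) \<le> \<kappa>" using q2 by (simp add: mult_ac)
      moreover have "\<kappa> / 2 \<le> \<kappa> * p" using p \<kappa> mult_left_mono[of "1/2" p \<kappa>] by simp
      ultimately have "\<rho> \<le> (\<rho> + \<kappa>) * p" by (simp add: p_def algebra_simps)
      then show ?thesis using p by (simp add: divide_le_eq)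
    qed
    define C' where "C' = (1 - \<mu>) * (C / q / p) + \<mu> * C1"
    have C'0: "0 \<le> C'" unfolding C'_def using C0 q0 p \<mu> C by (intro add_nonneg_nonneg mult_nonneg_nonneg) auto
    have "real (card (touches V m h)) \<le> (\<rho> - \<kappa>) * real (card (crossings V m h)) + C' * real (card V)"
      if sys: "height_system V m h" for V m and h :: "nat \<Rightarrow> 'a \<Rightarrow> real"
    proof -
      define T X n L where "T = real (card (touches V m h))" and "X = real (card (crossings V m h))"
        and "n = real (card V)" and "L = real (card (lenses A V m h))"
      have nn: "0 \<le> T" "0 \<le> X" "0 \<le> n" "0 \<le> L" by (auto simp: T_def X_def n_def L_def)
      have 1: "T \<le> \<delta> / 2 * X + C1 * n + C2 * L"
        using I[OF sys] by (simp add: T_def X_def n_def L_def)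
      have "p * T \<le> \<rho> * (X - p * L) + C / q * n"
        using sampling[OF sys bd, of q A] \<rho> \<delta> q0 q3
        unfolding p_def D_def T_def X_def n_def L_def by simp
      then have "p * T / p \<le> (\<rho> * (X - p * L) + C / q * n) / p" using p by (intro divide_right_mono) auto
      then have "T \<le> \<rho> / p * X - \<rho> * L + C / q / p * n" using p by (simp add: field_simps)
      moreover have "\<rho> / p * X \<le> (\<rho> + \<kappa>) * X" using rp nn by (intro mult_right_mono) auto
      ultimately have 2: "T \<le> (\<rho> + \<kappa>) * X - \<rho> * L + C / q / p * n" by linarith
      have "(1 - \<mu>) * T \<le> (1 - \<mu>) * ((\<rho> + \<kappa>) * X - \<rho> * L + C / q / p * n)"
        using 2 \<mu> by (intro mult_left_mono) auto
      moreover have "\<mu> * T \<le> \<mu> * (\<delta> / 2 * X + C1 * n + C2 * L)"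
        using 1 \<mu> by (intro mult_left_mono) auto
      ultimately have "T \<le> ((1 - \<mu>) * (\<rho> + \<kappa>) + \<mu> * (\<delta> / 2)) * X + (\<mu> * C2 - (1 - \<mu>) * \<rho>) * L + C' * n"
        by (simp add: C'_def algebra_simps)
      moreover have "(\<mu> * C2 - (1 - \<mu>) * \<rho>) * L \<le> 0"
      proof -
        have "1 / 2 * \<delta> \<le> (1 - \<mu>) * \<rho>" using \<mu> \<rho> \<delta> by (intro mult_mono) auto
        then show ?thesis using \<mu> nn by (intro mult_nonpos_nonneg) auto
      qed
      moreover have "((1 - \<mu>) * (\<rho> + \<kappa>) + \<mu> * (\<delta> / 2)) * X \<le> (\<rho> - \<kappa>) * X"
      proof (rule mult_right_mono)
        have "\<mu> * \<delta> \<le> \<mu> * \<rho>" using \<mu> \<rho> by (intro mult_left_mono) auto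
        moreover have "0 \<le> \<mu> * \<kappa>" using \<mu> \<kappa> by simp
        moreover have "\<mu> * \<delta> = 4 * \<kappa>" by (simp add: \<kappa>_def)
        ultimately show "(1 - \<mu>) * (\<rho> + \<kappa>) + \<mu> * (\<delta> / 2) \<le> \<rho> - \<kappa>" by (simp add: algebra_simps)
      qed (use nn in auto)
      ultimately show ?thesis by (simp add: T_def X_def n_def)
    qed
    then show ?thesis unfolding B_def using C'0 by blast
  qed
  have iter: "B (max \<delta> (\<rho>0 - real j * \<kappa>))" for j
  proof (induction j)
    case 0
    then show ?case using B_mono[OF base] by simp
  next
    case (Suc j)
    have "max \<delta> (\<rho>0 - real j * \<kappa>) \<le> \<rho>0" using C \<kappa> by (auto simp: \<rho>0_def)
    then have "B (max \<delta> (\<rho>0 - real j * \<kappa>) - \<kappa>)" using step Suc by simp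
    moreover have "max \<delta> (\<rho>0 - real j * \<kappa>) - \<kappa> \<le> max \<delta> (\<rho>0 - real (Suc j) * \<kappa>)"
      using \<kappa> by (auto simp: max_def algebra_simps)
    ultimately show ?case by (rule B_mono)
  qed
  obtain j :: nat where "\<rho>0 / \<kappa> < real j" using reals_Archimedean2 by blast
  then have "\<rho>0 - real j * \<kappa> \<le> \<delta>" using \<kappa> \<delta> by (simp add: field_simps)
  then have "B \<delta>" using iter[of j] by (simp add: max_def)
  then show ?thesis unfolding B_def .
qed

subsection \<open>Convex bodies in the plane\<close>

definition convex_body :: "'a::euclidean_space set \<Rightarrow> bool" where
  "convex_body K \<longleftrightarrow> convex K \<and> compact K \<and> interior K \<noteq> {}"

definition upper :: "(real \<times> real) set \<Rightarrow> real \<Rightarrow> real" where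
  "upper K x = Sup {y. (x, y) \<in> K}"

definition lower :: "(real \<times> real) set \<Rightarrow> real \<Rightarrow> real" where
  "lower K x = Inf {y. (x, y) \<in> K}"

definition left_end :: "(real \<times> real) set \<Rightarrow> real" where
  "left_end K = Inf (fst ` K)"

definition right_end :: "(real \<times> real) set \<Rightarrow> real" where
  "right_end K = Sup (fst ` K)"

lemma convex_body_ne: "convex_body K \<Longrightarrow> K \<noteq> {}"
  unfolding convex_body_def by (metis interior_empty)

lemma fst_image_body:
  assumes "convex_body K"
  shows "fst ` K = {left_end K..right_end K}"
proof -
  have K: "convex K" "compact K" "K \<noteq> {}" using assms convex_body_ne by (auto simp: convex_body_def)
  have c: "compact (fst ` K)" by (intro compact_continuous_image continuous_on_fst continuous_on_id K)
  have "is_interval (fst ` K)"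
    using K by (simp add: is_interval_convex_1 convex_linear_image linear_fst)
  have inf: "left_end K \<in> fst ` K" and sup: "right_end K \<in> fst ` K"
    unfolding left_end_def right_end_def using c K
    by (auto intro!: closed_contains_Inf closed_contains_Sup compact_imp_closed bounded_imp_bdd_below bounded_imp_bdd_above compact_imp_bounded)
  have "x \<in> {left_end K..right_end K}" if "x \<in> fst ` K" for x
    using that c unfolding left_end_def right_end_def
    by (auto intro!: cInf_lower cSup_upper bounded_imp_bdd_below bounded_imp_bdd_above compact_imp_bounded)
  moreover have "x \<in> fst ` K" if "x \<in> {left_end K..right_end K}" for x
    using mem_is_interval_1_I[OF \<open>is_interval (fst ` K)\<close> inf sup] that by simp
  ultimately show ?thesis by blast
qed

lemma section_body:
  assumes "convex_body K" "left_end K \<le> x" "x \<le> right_end K"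
  shows "(x, y) \<in> K \<longleftrightarrow> lower K x \<le> y \<and> y \<le> upper K x" and "lower K x \<le> upper K x"
    and "(x, upper K x) \<in> K" "(x, lower K x) \<in> K"
proof -
  define S where "S = {y. (x, y) \<in> K}"
  have K: "convex K" "compact K" using assms by (auto simp: convex_body_def)
  have ne: "S \<noteq> {}" using fst_image_body[OF assms(1)] assms(2,3) unfolding S_def by force
  have S: "S = snd ` (K \<inter> {x} \<times> UNIV)" unfolding S_def by force
  have "compact (K \<inter> {x} \<times> UNIV)" using K by (intro compact_Int_closed closed_Times) auto
  then have c: "compact S" unfolding S by (intro compact_continuous_image continuous_on_snd continuous_on_id)
  have t: "upper K x \<in> S" and b: "lower K x \<in> S"
    unfolding upper_def lower_def S_def[symmetric] using c ne
    by (auto intro!: closed_contains_Inf closed_contains_Sup compact_imp_closed bounded_imp_bdd_below bounded_imp_bdd_above compact_imp_bounded)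
  then show "(x, upper K x) \<in> K" "(x, lower K x) \<in> K" by (auto simp: S_def)
  have le: "lower K x \<le> y \<and> y \<le> upper K x" if "y \<in> S" for y
    using that c unfolding upper_def lower_def S_def[symmetric]
    by (auto intro!: cInf_lower cSup_upper bounded_imp_bdd_below bounded_imp_bdd_above compact_imp_bounded)
  then show "lower K x \<le> upper K x" using t by auto
  have "convex S" unfolding S using K by (intro convex_linear_image linear_snd convex_Int convex_Times) auto
  then have "is_interval S" by (simp add: is_interval_convex_1)
  then have "y \<in> S" if "lower K x \<le> y \<and> y \<le> upper K x" for y
    using mem_is_interval_1_I[OF _ b t] that by blast
  then show "(x, y) \<in> K \<longleftrightarrow> lower K x \<le> y \<and> y \<le> upper K x" using le unfolding S_def by blast
qed

lemma frontier_body: "convex_body K \<Longrightarrow> frontier K = K - interior K"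
  unfolding convex_body_def frontier_def by (metis closure_closed compact_imp_closed)

lemma lines_through_interior:
  fixes K :: "(real \<times> real) set"
  assumes "(x, y) \<in> interior K"
  obtains e where "0 < e" "\<And>d. \<bar>d\<bar> < e \<Longrightarrow> (x, y + d) \<in> K" "\<And>d. \<bar>d\<bar> < e \<Longrightarrow> (x + d, y) \<in> K"
proof -
  obtain e where e: "0 < e" "ball (x, y) e \<subseteq> K" using assms by (auto simp: mem_interior)
  have "(x, y + d) \<in> K" "(x + d, y) \<in> K" if "\<bar>d\<bar> < e" for d
    using e(2) that by (auto simp: subset_iff dist_Pair_Pair dist_real_def)
  then show thesis using that e(1) by blast
qed

lemma upper_lower_frontier:
  assumes "convex_body K" "left_end K \<le> x" "x \<le> right_end K"
  shows "(x, upper K x) \<in> frontier K" "(x, lower K x) \<in> frontier K"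
proof -
  note s = section_body[OF assms]
  have "(x, upper K x) \<notin> interior K"
  proof
    assume "(x, upper K x) \<in> interior K"
    then obtain e where e: "0 < e" "\<And>d. \<bar>d\<bar> < e \<Longrightarrow> (x, upper K x + d) \<in> K" by (rule lines_through_interior) blast
    then have "(x, upper K x + e / 2) \<in> K" by simp
    then show False using s(1)[of "upper K x + e / 2"] e by simp
  qed
  then show "(x, upper K x) \<in> frontier K" using s frontier_body[OF assms(1)] by simp
  have "(x, lower K x) \<notin> interior K"
  proof
    assume "(x, lower K x) \<in> interior K"
    then obtain e where e: "0 < e" "\<And>d. \<bar>d\<bar> < e \<Longrightarrow> (x, lower K x + d) \<in> K" by (rule lines_through_interior) blast
    then have "(x, lower K x + - (e / 2)) \<in> K" using e(2)[of "- (e / 2)"] by simp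
    then show False using s(1)[of "lower K x + - (e / 2)"] e by simp
  qed
  then show "(x, lower K x) \<in> frontier K" using s frontier_body[OF assms(1)] by simp
qed

text \<open>An interior point would have neighbours in \<open>K\<close> further left and further
  right, so a vertical edge consists of frontier points.\<close>

lemma extreme_section_frontier:
  assumes "convex_body K" "(x, y) \<in> K" "x = left_end K \<or> x = right_end K"
  shows "(x, y) \<in> frontier K"
proof -
  have "(x, y) \<notin> interior K"
  proof
    assume "(x, y) \<in> interior K"
    then obtain e where e: "0 < e" "\<And>d. \<bar>d\<bar> < e \<Longrightarrow> (x + d, y) \<in> K" by (rule lines_through_interior) blast
    then have "(x + e / 2, y) \<in> K" "(x + - (e / 2), y) \<in> K" using e(2)[of "e/2"] e(2)[of "-(e/2)"] by auto
    then have "x + e / 2 \<in> fst ` K" "x - e / 2 \<in> fst ` K" by force+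
    then show False using assms(3) e(1) fst_image_body[OF assms(1)] by auto
  qed
  then show ?thesis using assms frontier_body by blast
qed

text \<open>A supporting line at a frontier point strictly inside its vertical section must be
  vertical, but no vertical line supports \<open>K\<close> at an abscissa strictly between the
  ends.\<close>

lemma frontier_inside_cases:
  assumes b: "convex_body K" and x: "left_end K < x" "x < right_end K" and p: "(x, y) \<in> frontier K"
  shows "y = upper K x \<or> y = lower K x"
proof (rule ccontr)
  assume n: "\<not> (y = upper K x \<or> y = lower K x)"
  have K: "(x, y) \<in> K" "(x, y) \<notin> interior K" using p frontier_body[OF b] by auto
  note s = section_body[OF b less_imp_le[OF x(1)] less_imp_le[OF x(2)]]
  have y: "lower K x < y" "y < upper K x" using s(1)[of y] K n by auto
  have ri: "(x, y) \<notin> rel_interior K" using K b by (simp add: convex_body_def rel_interior_nonempty_interior)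
  obtain a where a: "a \<noteq> 0" "\<And>z. z \<in> K \<Longrightarrow> a \<bullet> (x, y) \<le> a \<bullet> z"
    using supporting_hyperplane_rel_boundary[of K "(x, y)"] b K ri unfolding convex_body_def by metis
  obtain \<alpha> \<beta> where ab: "a = (\<alpha>, \<beta>)" by (cases a)
  have le: "\<alpha> * x + \<beta> * y \<le> \<alpha> * u + \<beta> * v" if "(u, v) \<in> K" for u v
    using a(2)[OF that] by (simp add: ab)
  have "\<beta> * y \<le> \<beta> * upper K x" "\<beta> * y \<le> \<beta> * lower K x"
    using le[OF s(3)] le[OF s(4)] by auto
  then have \<beta>: "\<beta> = 0" using y by (auto simp: mult_le_cancel_left) 
  obtain v w where "(left_end K, v) \<in> K" "(right_end K, w) \<in> K"
    using fst_image_body[OF b] x by force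
  then have "\<alpha> * x \<le> \<alpha> * left_end K" "\<alpha> * x \<le> \<alpha> * right_end K" using le \<beta> by force+
  then have "\<alpha> = 0" using x by (auto simp: mult_le_cancel_left)
  then show False using a ab \<beta> by (simp add: zero_prod_def)
qed

text \<open>A vertical segment at an interior point, shrunk towards a point over the end on the side
  of \<open>x\<close>, gives a vertical segment of positive length over \<open>x\<close>.\<close>

lemma lower_less_upper:
  assumes b: "convex_body K" and x: "left_end K < x" "x < right_end K"
  shows "lower K x < upper K x"
proof -
  note s = section_body[OF b less_imp_le[OF x(1)] less_imp_le[OF x(2)]]
  obtain c d where cd: "(c, d) \<in> interior K" using b by (auto simp: convex_body_def)
  obtain e where e: "0 < e" "\<And>f. \<bar>f\<bar> < e \<Longrightarrow> (c, d + f) \<in> K" using cd by (rule lines_through_interior) blast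
  have p: "(c, d) \<in> K" "(c, d + e / 2) \<in> K" using e(2)[of 0] e(2)[of "e/2"] e(1) by auto
  obtain v w where vw: "(left_end K, v) \<in> K" "(right_end K, w) \<in> K" using fst_image_body[OF b] x by force
  obtain z w u where z: "(z, w) \<in> K" and u: "0 \<le> u" "u < 1" "x = (1 - u) * c + u * z"
  proof (cases "c \<le> x")
    case True
    define u where "u = (x - c) / (right_end K - c)"
    have "0 \<le> u" "u < 1" "x = (1 - u) * c + u * right_end K"
    proof -
      have "u * (right_end K - c) = x - c" using True x by (simp add: u_def)
      then show "x = (1 - u) * c + u * right_end K" by (simp add: algebra_simps)
    qed (use True x in \<open>auto simp: u_def field_simps\<close>)
    then show thesis using that vw by blast
  next
    case False
    define u where "u = (c - x) / (c - left_end K)"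
    have "0 \<le> u" "u < 1" "x = (1 - u) * c + u * left_end K"
    proof -
      have "u * (c - left_end K) = c - x" using False x by (simp add: u_def)
      then show "x = (1 - u) * c + u * left_end K" by (simp add: algebra_simps)
    qed (use False x in \<open>auto simp: u_def field_simps\<close>)
    then show thesis using that vw by blast
  qed
  have cv: "(x, (1 - u) * f + u * w) \<in> K" if "(c, f) \<in> K" for f
  proof -
    have "(1 - u) *\<^sub>R (c, f) + u *\<^sub>R (z, w) \<in> K"
      using b that z u unfolding convex_body_def by (intro convexD_alt) auto
    then show ?thesis using u by simp
  qed
  have "(x, (1 - u) * d + u * w) \<in> K" "(x, (1 - u) * (d + e / 2) + u * w) \<in> K" using cv p by auto
  then have "lower K x \<le> (1 - u) * d + u * w" "(1 - u) * (d + e / 2) + u * w \<le> upper K x"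
    using s(1) by blast+
  moreover have "(1 - u) * d < (1 - u) * (d + e / 2)" using u e by (intro mult_strict_left_mono) auto
  ultimately show ?thesis by linarith
qed

text \<open>On the open interval \<open>lower K\<close> is convex and \<open>upper K\<close> is
  concave.\<close>

lemma continuous_upper_lower:
  assumes b: "convex_body K"
  shows "continuous_on {left_end K<..<right_end K} (upper K)" "continuous_on {left_end K<..<right_end K} (lower K)"
proof -
  let ?I = "{left_end K<..<right_end K}"
  have comb: "lower K ((1 - t) * x + t * y) \<le> (1 - t) * lower K x + t * lower K y \<and>
     (1 - t) * upper K x + t * upper K y \<le> upper K ((1 - t) * x + t * y)"
    if t: "0 < t" "t < 1" and xy: "x \<in> ?I" "y \<in> ?I" for t x y
  proof -
    have x: "left_end K \<le> x" "x \<le> right_end K" and y: "left_end K \<le> y" "y \<le> right_end K" using xy by auto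
    have "(1 - t) *\<^sub>R x + t *\<^sub>R y \<in> ?I" using xy t by (intro convexD_alt[of ?I]) auto
    then have z: "left_end K \<le> (1 - t) * x + t * y" "(1 - t) * x + t * y \<le> right_end K" by auto
    have c: "((1 - t) * x + t * y, (1 - t) * u + t * v) \<in> K" if "(x, u) \<in> K" "(y, v) \<in> K" for u v
    proof -
      have "(1 - t) *\<^sub>R (x, u) + t *\<^sub>R (y, v) \<in> K"
        using b that t unfolding convex_body_def by (intro convexD_alt) auto
      then show ?thesis by simp
    qed
    have "((1 - t) * x + t * y, (1 - t) * upper K x + t * upper K y) \<in> K"
      "((1 - t) * x + t * y, (1 - t) * lower K x + t * lower K y) \<in> K"
      by (intro c section_body[OF b x] section_body[OF b y])+
    then show ?thesis using section_body(1)[OF b z] by blast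
  qed
  have "convex_on ?I (lower K)" "convex_on ?I (\<lambda>x. - upper K x)"
    by (rule convex_onI; use comb in force)+
  then have "continuous_on ?I (lower K)" "continuous_on ?I (\<lambda>x. - upper K x)"
    by (auto intro: convex_on_continuous)
  then show "continuous_on ?I (upper K)" "continuous_on ?I (lower K)"
    using continuous_on_minus[of ?I "\<lambda>x. - upper K x"] by auto
qed

lemma connected_frontier_punctured:
  fixes K :: "(real \<times> real) set"
  assumes "convex_body K" "p \<in> frontier K"
  shows "connected (frontier K - {p})"
proof -
  let ?T = "{z::real \<times> real. (1, 0) \<bullet> z = 0}"
  have K: "convex K" "bounded K" "interior K \<noteq> {}" using assms compact_imp_bounded by (auto simp: convex_body_def)
  have rf: "rel_frontier K = frontier K" using K by (simp add: rel_frontier_nonempty_interior)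
  have "aff_dim ?T = 1"
    by (subst aff_dim_hyperplane) (simp_all add: zero_prod_def)
  then have d: "aff_dim K = aff_dim ?T + 1" using aff_dim_nonempty_interior[OF K(3)] by simp
  have "rel_frontier K - {p} homeomorphic ?T"
    by (rule homeomorphic_punctured_sphere_affine_gen) (use K rf assms d affine_hyperplane in auto)
  moreover have "connected ?T" by (intro convex_connected convex_hyperplane)
  ultimately show ?thesis unfolding rf using homeomorphic_connectedness by blast
qed

text \<open>The frontier of one body without \<open>p\<close> is connected and misses the frontier
  of the other, so it lies inside or outside the other body. Inside gives inclusion, by taking
  convex hulls. If both lie outside, the frontier of the intersection is contained in
  \<open>{p}\<close>, and the intersection is its convex hull.\<close>

lemma touching_bodies_cases:
  fixes K L :: "(real \<times> real) set"
  assumes K: "convex_body K" and L: "convex_body L" and p: "frontier K \<inter> frontier L = {p}"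
  shows "K \<inter> L = {p} \<or> K \<subseteq> L \<or> L \<subseteq> K"
proof -
  have half: "A \<subseteq> B \<or> (frontier A - {p}) \<inter> B = {}"
    if A: "convex_body A" and B: "convex_body B" and p: "frontier A \<inter> frontier B = {p}" for A B :: "(real \<times> real) set"
  proof (cases "(frontier A - {p}) \<inter> B = {}")
    case True
    then show ?thesis ..
  next
    case ne: False
    have pA: "p \<in> frontier A" and pB: "p \<in> B" using p frontier_body[OF B] by auto
    have "(frontier A - {p}) \<inter> frontier B = {}" using p by auto
    then have "frontier A - {p} - B = {}"
      using connected_Int_frontier[OF connected_frontier_punctured[OF A pA] ne] by blast
    then have "frontier A \<subseteq> B" using pB by blast
    then have "convex hull (frontier A) \<subseteq> B" using B by (intro hull_minimal) (auto simp: convex_body_def)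
    then show ?thesis using Krein_Milman_frontier[of A] A by (auto simp: convex_body_def)
  qed
  have "K \<inter> L = {p}" if a: "(frontier K - {p}) \<inter> L = {}" and b: "(frontier L - {p}) \<inter> K = {}"
  proof -
    have pKL: "p \<in> K \<inter> L" using p frontier_body[OF K] frontier_body[OF L] by auto
    have cv: "convex (K \<inter> L)" "compact (K \<inter> L)"
      using K L by (auto simp: convex_body_def intro: convex_Int compact_Int)
    have "frontier (K \<inter> L) = K \<inter> L - interior (K \<inter> L)"
      using cv by (simp add: frontier_def compact_imp_closed)
    then have "frontier (K \<inter> L) \<subseteq> {p}"
      using a b frontier_body[OF K] frontier_body[OF L] by auto
    then have "convex hull (frontier (K \<inter> L)) \<subseteq> {p}" by (intro hull_minimal) auto
    then show ?thesis using Krein_Milman_frontier[OF cv] pKL by auto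
  qed
  then show ?thesis using half[OF K L p] half[OF L K] p by (auto simp: Int_commute)
qed

subsection \<open>The heights of the arcs of a family of convex curves\<close>

text \<open>Ties have to be broken because several bodies may end at the same abscissa while heights
  must stay distinct.\<close>

lemma finite_ranking_exists:
  fixes b :: "'i \<Rightarrow> real"
  assumes "finite I"
  shows "\<exists>r :: 'i \<Rightarrow> nat. inj_on r I \<and> (\<forall>i\<in>I. r i < card I) \<and> (\<forall>i\<in>I. \<forall>j\<in>I. b i < b j \<longrightarrow> r i < r j)"
  using assms
proof (induction I rule: finite_ranking_induct[where f = b])
  case empty
  then show ?case by simp
next
  case (insert x S)
  show ?case
  proof (cases "x \<in> S")
    case True
    then show ?thesis using insert by (simp add: insert_absorb)
  next
    case False
    obtain r :: "'i \<Rightarrow> nat" where r: "inj_on r S" "\<forall>i\<in>S. r i < card S" "\<forall>i\<in>S. \<forall>j\<in>S. b i < b j \<longrightarrow> r i < r j"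
      using insert by blast
    have "inj_on (r(x := card S)) (insert x S)"
    proof (rule inj_onI)
      fix i j assume ij: "i \<in> insert x S" "j \<in> insert x S" "(r(x := card S)) i = (r(x := card S)) j"
      have "i = x \<longleftrightarrow> j = x" using ij r(2) False by (metis fun_upd_apply insertE less_irrefl)
      then show "i = j" using ij r(1) by (cases "i = x") (auto dest: inj_onD)
    qed
    moreover have "\<forall>i\<in>insert x S. (r(x := card S)) i < card (insert x S)"
      using r(2) False insert(1) by (simp add: less_SucI)
    moreover have "\<forall>i\<in>insert x S. \<forall>j\<in>insert x S. b i < b j \<longrightarrow> (r(x := card S)) i < (r(x := card S)) j"
    proof (intro ballI impI)
      fix i j assume ij: "i \<in> insert x S" "j \<in> insert x S" "b i < b j"
      have "i \<noteq> x" using ij insert(2)[of j] by auto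
      then have "i \<in> S" using ij by simp
      then show "(r(x := card S)) i < (r(x := card S)) j" using \<open>i \<noteq> x\<close> ij r(2,3) by auto
    qed
    ultimately show ?thesis by blast
  qed
qed

lemma card_pairs_at_point:
  assumes "\<And>i j k. i \<in> I \<Longrightarrow> j \<in> I \<Longrightarrow> k \<in> I \<Longrightarrow> i \<noteq> j \<Longrightarrow> i \<noteq> k \<Longrightarrow> j \<noteq> k \<Longrightarrow> A i \<inter> A j \<inter> A k = {}"
  shows "card {(i, j) \<in> I \<times> I. i \<noteq> j \<and> p \<in> A i \<inter> A j} \<le> 2"
proof (cases "{(i, j) \<in> I \<times> I. i \<noteq> j \<and> p \<in> A i \<inter> A j} = {}")
  case True
  then show ?thesis by (simp only: card.empty)
next
  case False
  then obtain i j where ij: "i \<in> I" "j \<in> I" "i \<noteq> j" "p \<in> A i" "p \<in> A j" by auto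
  have only: "k = i \<or> k = j" if "k \<in> I" "p \<in> A k" for k
    using assms[OF ij(1,2) that(1) ij(3)] ij that by auto
  have "{(i, j) \<in> I \<times> I. i \<noteq> j \<and> p \<in> A i \<inter> A j} \<subseteq> set [(i, j), (j, i)]"
    using only by auto
  then have "card {(i, j) \<in> I \<times> I. i \<noteq> j \<and> p \<in> A i \<inter> A j} \<le> card (set [(i, j), (j, i)])"
    by (intro card_mono) auto
  also have "\<dots> \<le> 2" by (rule order_trans[OF card_length]) simp
  finally show ?thesis .
qed

text \<open>Only the part right of the vertical line at \<open>x0\<close> is treated; reflection
  supplies the left part. The bodies are indexed, so that a family and its mirror image share the
  index set.\<close>

locale curve_family =
  fixes I :: "'i set" and K :: "'i \<Rightarrow> (real \<times> real) set" and x0 :: real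
  assumes finI: "finite I"
    and body: "i \<in> I \<Longrightarrow> convex_body (K i)"
    and x0: "i \<in> I \<Longrightarrow> left_end (K i) \<le> x0 \<and> x0 \<le> right_end (K i)"
    and fin_int: "i \<in> I \<Longrightarrow> j \<in> I \<Longrightarrow> i \<noteq> j \<Longrightarrow> finite (frontier (K i) \<inter> frontier (K j))"
    and no_triple: "i \<in> I \<Longrightarrow> j \<in> I \<Longrightarrow> k \<in> I \<Longrightarrow> i \<noteq> j \<Longrightarrow> i \<noteq> k \<Longrightarrow> j \<noteq> k \<Longrightarrow>
      frontier (K i) \<inter> frontier (K j) \<inter> frontier (K k) = {}"
begin

definition V :: "('i \<times> bool) set" where "V = I \<times> UNIV"

definition val :: "'i \<times> bool \<Rightarrow> real \<Rightarrow> real" where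
  "val a x = (if snd a then upper (K (fst a)) x else lower (K (fst a)) x)"

text \<open>The point \<open>x0 + 1\<close> only makes the set nonempty.\<close>

definition event_set :: "real set" where
  "event_set = insert (x0 + 1) {x. x0 < x \<and> (x \<in> (\<lambda>i. right_end (K i)) ` I \<or>
     x \<in> (\<Union>i\<in>I. \<Union>j\<in>I - {i}. fst ` (frontier (K i) \<inter> frontier (K j))))}"

definition last_time :: nat where "last_time = card event_set - 1"

definition event :: "nat \<Rightarrow> real" where "event t = sorted_list_of_set event_set ! t"

text \<open>Only \<open>event t\<close> separates \<open>sample t\<close> from
  \<open>sample (Suc t)\<close>, so a change of order between them can be attributed to it. A
  touching at \<open>event t\<close> shows up at the earlier of the two, hence the samples stop
  before the last event.\<close>

definition sample :: "nat \<Rightarrow> real" where "sample t = ((if t = 0 then x0 else event (t - 1)) + event t) / 2"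

lemma finite_event_set: "finite event_set"
proof -
  have "finite ((\<lambda>i. right_end (K i)) ` I \<union> (\<Union>i\<in>I. \<Union>j\<in>I - {i}. fst ` (frontier (K i) \<inter> frontier (K j))))"
    using finI fin_int by auto
  then show ?thesis unfolding event_set_def by (simp only: finite_insert) (erule rev_finite_subset, blast)
qed

lemma event_gt: "t \<le> last_time \<Longrightarrow> x0 < event t"
proof -
  assume t: "t \<le> last_time"
  have "card event_set \<noteq> 0" using finite_event_set by (auto simp: event_set_def)
  then have "t < length (sorted_list_of_set event_set)" using t by (simp add: last_time_def)
  then have "event t \<in> set (sorted_list_of_set event_set)" unfolding event_def by (rule nth_mem)
  then have "event t \<in> event_set" using finite_event_set by simp
  then show "x0 < event t" by (auto simp: event_set_def)
qed

lemma event_mono: "t < u \<Longrightarrow> u \<le> last_time \<Longrightarrow> event t < event u"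
proof -
  assume t: "t < u" "u \<le> last_time"
  have "card event_set \<noteq> 0" using finite_event_set by (auto simp: event_set_def)
  then show "event t < event u" unfolding event_def using t
    by (intro sorted_wrt_nth_less[of "(<)"] strict_sorted_list_of_set) (auto simp: last_time_def)
qed

lemma event_mono_le: "t \<le> u \<Longrightarrow> u \<le> last_time \<Longrightarrow> event t \<le> event u"
  using event_mono[of t u] by (cases "t = u") auto

lemma event_surj:
  assumes "x \<in> event_set"
  obtains t where "t \<le> last_time" "x = event t"
proof -
  have "x \<in> set (sorted_list_of_set event_set)" using assms finite_event_set by simp
  then obtain t where "t < length (sorted_list_of_set event_set)" "x = sorted_list_of_set event_set ! t"
    by (metis in_set_conv_nth)
  then show thesis using that[of t] by (auto simp: last_time_def event_def)
qed

lemma sample_less_event: "t \<le> last_time \<Longrightarrow> sample t < event t" and sample_gt: "t \<le> last_time \<Longrightarrow> x0 < sample t"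
  and event_less_sample: "Suc t \<le> last_time \<Longrightarrow> event t < sample (Suc t)"
proof -
  have p: "(if t = 0 then x0 else event (t - 1)) < event t" if "t \<le> last_time" for t
    using event_gt[OF that] event_mono[of "t - 1" t] that by auto
  show "t \<le> last_time \<Longrightarrow> sample t < event t" using p[of t] by (simp add: sample_def)
  show "t \<le> last_time \<Longrightarrow> x0 < sample t" 
  proof -
    assume t: "t \<le> last_time"
    then have "x0 < event t" "x0 < event (t - 1)" using event_gt[of t] event_gt[of "t - 1"] by auto
    then show "x0 < sample t" by (cases "t = 0") (simp_all add: sample_def)
  qed
  show "Suc t \<le> last_time \<Longrightarrow> event t < sample (Suc t)" using p[of "Suc t"] by (simp add: sample_def)
qed

lemma event_ge:
  assumes "t \<le> last_time" "x \<in> event_set" "sample t \<le> x"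
  shows "event t \<le> x"
proof -
  obtain u where u: "u \<le> last_time" "x = event u" using event_surj[OF assms(2)] .
  have "\<not> u < t"
  proof
    assume ut: "u < t"
    then have "event u \<le> event (t - 1)" "event (t - 1) < sample t" using assms event_mono_le[of u "t - 1"] event_less_sample[of "t - 1"] by auto
    then show False using assms u by simp
  qed
  then show ?thesis using u event_mono_le[of t u] by simp
qed

lemma event_le:
  assumes "Suc t \<le> last_time" "x \<in> event_set" "x \<le> sample (Suc t)"
  shows "x \<le> event t"
proof -
  obtain u where u: "u \<le> last_time" "x = event u" using event_surj[OF assms(2)] .
  have "\<not> Suc t \<le> u" using assms u sample_less_event[OF assms(1)] event_mono_le[of "Suc t" u] by auto
  then show ?thesis using u assms event_mono_le[of u t] by auto
qed

lemma sample_notin: "t \<le> last_time \<Longrightarrow> sample t \<notin> event_set"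
  using event_ge[of t "sample t"] sample_less_event[of t] by auto

lemma sample_mono: "t < u \<Longrightarrow> u \<le> last_time \<Longrightarrow> sample t < sample u"
proof -
  assume a: "t < u" "u \<le> last_time"
  then have "t \<le> u - 1" "u - 1 \<le> last_time" "Suc (u - 1) = u" by auto
  then have "sample t < event t" "event t \<le> event (u - 1)" "event (u - 1) < sample u"
    using sample_less_event[of t] event_mono_le[of t "u - 1"] event_less_sample[of "u - 1"] a by auto
  then show "sample t < sample u" by linarith
qed

lemma right_end_event: "i \<in> I \<Longrightarrow> x0 < right_end (K i) \<Longrightarrow> right_end (K i) \<in> event_set"
  by (auto simp: event_set_def)

lemma val_frontier:
  assumes "fst a \<in> I" "x0 \<le> x" "x \<le> right_end (K (fst a))"
  shows "(x, val a x) \<in> frontier (K (fst a))"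
  using upper_lower_frontier[OF body[OF assms(1)], of x] x0[OF assms(1)] assms by (auto simp: val_def)

lemma val_eq:
  assumes "fst a \<in> I" "fst b \<in> I" "a \<noteq> b" "x0 < x" "x < right_end (K (fst a))" "x < right_end (K (fst b))"
    and eq: "val a x = val b x"
  shows "fst a \<noteq> fst b" "(x, val a x) \<in> frontier (K (fst a)) \<inter> frontier (K (fst b))" "x \<in> event_set"
proof -
  show ne: "fst a \<noteq> fst b"
  proof
    assume "fst a = fst b"
    then have "snd a \<noteq> snd b" using assms(3) by (auto simp: prod_eq_iff)
    moreover have "lower (K (fst a)) x < upper (K (fst a)) x"
      using x0[OF assms(1)] assms by (intro lower_less_upper body) auto
    ultimately show False using eq \<open>fst a = fst b\<close> by (auto simp: val_def split: if_splits)
  qed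
  show m: "(x, val a x) \<in> frontier (K (fst a)) \<inter> frontier (K (fst b))"
    using val_frontier[of a x] val_frontier[of b x] eq assms by auto
  have "x \<in> fst ` (frontier (K (fst a)) \<inter> frontier (K (fst b)))" using m by force
  then show "x \<in> event_set" using ne assms by (auto simp: event_set_def)
qed

lemma continuous_val:
  assumes "fst a \<in> I"
  shows "continuous_on {x0<..<right_end (K (fst a))} (val a)"
proof -
  have "{x0<..<right_end (K (fst a))} \<subseteq> {left_end (K (fst a))<..<right_end (K (fst a))}"
    using x0[OF assms] by auto
  then show ?thesis
    using continuous_upper_lower[OF body[OF assms]] continuous_on_subset
    by (cases "snd a") (auto simp: val_def[abs_def])
qed

text \<open>Intermediate value theorem: arcs that exchange order meet in between, and by
  \<open>val_eq\<close> they do so at an event.\<close>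

lemma val_no_cross:
  assumes a: "fst a \<in> I" "fst b \<in> I" "a \<noteq> b" and xy: "x0 < x" "x0 < y"
    "x < right_end (K (fst a))" "x < right_end (K (fst b))" "y < right_end (K (fst a))" "y < right_end (K (fst b))"
    and lt: "val a x < val b x" "val b y \<le> val a y"
  obtains w where "min x y \<le> w" "w \<le> max x y" "val a w = val b w"
proof -
  have c: "continuous_on {min x y..max x y} (\<lambda>x. val a x - val b x)"
    using xy by (intro continuous_on_diff continuous_on_subset[OF continuous_val[OF a(1)]]
      continuous_on_subset[OF continuous_val[OF a(2)]]) auto
  have "\<exists>w. min x y \<le> w \<and> w \<le> max x y \<and> val a w - val b w = 0"
  proof (cases "x \<le> y")
    case True
    then show ?thesis using IVT'[of "\<lambda>x. val a x - val b x" x 0 y] c lt by (auto simp: min_def max_def)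
  next
    case False
    then show ?thesis using IVT2'[of "\<lambda>x. val a x - val b x" x 0 y] c lt by (auto simp: min_def max_def)
  qed
  then show thesis using that by auto
qed

section \<open>Heights of the arcs, also past the right ends of their bodies\<close>

definition height_bound :: real where
  "height_bound = (SOME height_bound. 0 < height_bound \<and> (\<forall>i\<in>I. \<forall>p\<in>K i. \<bar>snd p\<bar> < height_bound))"

definition end_rank :: "'i \<Rightarrow> nat" where
  "end_rank = (SOME end_rank. inj_on end_rank I \<and> (\<forall>i\<in>I. end_rank i < card I) \<and>
     (\<forall>i\<in>I. \<forall>j\<in>I. right_end (K i) < right_end (K j) \<longrightarrow> end_rank i < end_rank j))"

text \<open>Past the right end of its body an upper arc drops below everything and a lower arc rises above
  everything; the ranking by right ends keeps nested touching arcs uncrossed.\<close>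

definition h :: "nat \<Rightarrow> 'i \<times> bool \<Rightarrow> real" where
  "h t a = (if sample t < right_end (K (fst a)) then val a (sample t)
     else if snd a then - (height_bound + real (card I)) + real (end_rank (fst a)) else height_bound + real (card I) - real (end_rank (fst a)))"

lemma height_bound: "0 < height_bound" "i \<in> I \<Longrightarrow> p \<in> K i \<Longrightarrow> \<bar>snd p\<bar> < height_bound"
proof -
  have "bounded (\<Union>i\<in>I. snd ` K i)"
    using finI body compact_imp_bounded
    by (intro bounded_UN ballI bounded_snd) (auto simp: convex_body_def)
  then obtain b where b: "\<forall>y\<in>(\<Union>i\<in>I. snd ` K i). norm y \<le> b" by (auto simp: bounded_iff)
  then have "0 < \<bar>b\<bar> + 1 \<and> (\<forall>i\<in>I. \<forall>p\<in>K i. \<bar>snd p\<bar> < \<bar>b\<bar> + 1)" by fastforce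
  then have "0 < height_bound \<and> (\<forall>i\<in>I. \<forall>p\<in>K i. \<bar>snd p\<bar> < height_bound)" unfolding height_bound_def by (rule someI)
  then show "0 < height_bound" "i \<in> I \<Longrightarrow> p \<in> K i \<Longrightarrow> \<bar>snd p\<bar> < height_bound" by auto
qed

lemma end_rank: "inj_on end_rank I" "i \<in> I \<Longrightarrow> end_rank i < card I"
    "i \<in> I \<Longrightarrow> j \<in> I \<Longrightarrow> right_end (K i) < right_end (K j) \<Longrightarrow> end_rank i < end_rank j"
proof -
  have "inj_on end_rank I \<and> (\<forall>i\<in>I. end_rank i < card I) \<and>
     (\<forall>i\<in>I. \<forall>j\<in>I. right_end (K i) < right_end (K j) \<longrightarrow> end_rank i < end_rank j)"
    unfolding end_rank_def by (rule someI_ex[OF finite_ranking_exists[OF finI, of "\<lambda>i. right_end (K i)"]])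
  then show "inj_on end_rank I" "i \<in> I \<Longrightarrow> end_rank i < card I"
    "i \<in> I \<Longrightarrow> j \<in> I \<Longrightarrow> right_end (K i) < right_end (K j) \<Longrightarrow> end_rank i < end_rank j" by auto
qed

lemma h_normal:
  assumes "fst a \<in> I" "t \<le> last_time" "sample t < right_end (K (fst a))"
  shows "h t a = val a (sample t)" "\<bar>h t a\<bar> < height_bound"
proof -
  show e: "h t a = val a (sample t)" using assms by (simp add: h_def)
  have "(sample t, val a (sample t)) \<in> frontier (K (fst a))"
    using sample_gt[OF assms(2)] assms by (intro val_frontier) auto
  then show "\<bar>h t a\<bar> < height_bound" using height_bound(2)[OF assms(1)] frontier_body[OF body[OF assms(1)]] e by force
qed

lemma h_ended:
  assumes "fst a \<in> I" "\<not> sample t < right_end (K (fst a))"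
  shows "snd a \<Longrightarrow> h t a < - height_bound" "\<not> snd a \<Longrightarrow> height_bound < h t a"
    "h t a = (if snd a then - (height_bound + real (card I)) + real (end_rank (fst a)) else height_bound + real (card I) - real (end_rank (fst a)))"
  using end_rank(2)[OF assms(1)] assms(2) by (auto simp: h_def)

text \<open>At a sample the arcs still present differ, because equal values occur at events only.
  The other arcs lie beyond the range of all bodies, upper ones below and lower ones above it, and
  \<open>end_rank\<close> tells them apart.\<close>

lemma system: "height_system V last_time h"
  unfolding height_system_def
proof (intro conjI allI impI)
  show "finite V" using finI by (simp add: V_def)
  fix t assume t: "t \<le> last_time"
  show "inj_on (h t) V"
  proof (rule inj_onI, rule ccontr)
    fix a b assume a: "a \<in> V" "b \<in> V" and eq: "h t a = h t b" and ne: "a \<noteq> b"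
    have I: "fst a \<in> I" "fst b \<in> I" using a by (auto simp: V_def)
    note na = h_normal[OF I(1) t] and nb = h_normal[OF I(2) t] and ea = h_ended[OF I(1), of t] and eb = h_ended[OF I(2), of t]
    consider "sample t < right_end (K (fst a))" "sample t < right_end (K (fst b))"
      | "sample t < right_end (K (fst a))" "\<not> sample t < right_end (K (fst b))"
      | "\<not> sample t < right_end (K (fst a))" "sample t < right_end (K (fst b))"
      | "\<not> sample t < right_end (K (fst a))" "\<not> sample t < right_end (K (fst b))" by blast
    then show False
    proof cases
      case 1
      then show False using val_eq(3)[OF I ne sample_gt[OF t]] na nb eq sample_notin[OF t] by simp
    next
      case 2
      then show False using na eb(1,2) eq by (cases "snd b") auto
    next
      case 3
      then show False using nb ea(1,2) eq by (cases "snd a") auto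
    next
      case 4
      show False
      proof (cases "snd a = snd b")
        case True
        then have "end_rank (fst a) = end_rank (fst b)" using ea(3) eb(3) 4 eq by (auto split: if_splits)
        then have "fst a = fst b" using end_rank(1) I by (auto simp: inj_on_def)
        then show False using True ne by (simp add: prod_eq_iff)
      next
        case False
        then show False using ea(1,2) eb(1,2) 4 eq height_bound(1) by (cases "snd a"; cases "snd b") auto
      qed
    qed
  qed
qed

text \<open>The step in which an arc moves to its artificial height. It happens at most once per
  arc, so artificial crossings cost a bounded number per pair of arcs.\<close>

definition jumps :: "'i \<times> bool \<Rightarrow> nat \<Rightarrow> bool" where
  "jumps a t \<longleftrightarrow> Suc t \<le> last_time \<and> sample t < right_end (K (fst a)) \<and> \<not> sample (Suc t) < right_end (K (fst a))"

lemma jumps_unique: "jumps a t \<Longrightarrow> jumps a u \<Longrightarrow> t = u"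
proof (rule ccontr)
  assume j: "jumps a t" "jumps a u" and "t \<noteq> u"
  moreover have False if "t < u" "jumps a t" "jumps a u" for t u
  proof -
    have "sample (Suc t) \<le> sample u" using that sample_mono[of "Suc t" u] by (cases "Suc t = u") (auto simp: jumps_def)
    then show False using that by (auto simp: jumps_def)
  qed
  ultimately show False by (metis linorder_neqE_nat)
qed

text \<open>Without a jump an arc is present at both samples or at neither. Absent arcs are constant
  and beyond all present ones, so a crossing needs two present arcs; these meet by the intermediate
  value theorem, at the only event of the step.\<close>

lemma crossing_cases:
  assumes c: "(t, a, b) \<in> crossings V last_time h" and nj: "\<not> jumps a t" "\<not> jumps b t"
  shows "fst a \<noteq> fst b \<and> (event t, val a (event t)) \<in> frontier (K (fst a)) \<inter> frontier (K (fst b))"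
proof -
  have t: "Suc t \<le> last_time" "t \<le> last_time" and I: "fst a \<in> I" "fst b \<in> I" and lt: "h t a < h t b" "h (Suc t) b < h (Suc t) a"
    using c by (auto simp: crossings_def V_def)
  have ne: "a \<noteq> b" using lt by auto
  have st: "sample t < sample (Suc t)" using sample_mono[of t "Suc t"] t by simp
  have ext: "h t x = h (Suc t) x" if "\<not> sample t < right_end (K (fst x))" for x
    using that st by (simp add: h_def)
  have "sample (Suc t) < right_end (K (fst a)) \<and> sample (Suc t) < right_end (K (fst b))"
  proof (rule ccontr)
    assume n: "\<not> ?thesis"
    have na: "sample t < right_end (K (fst a)) \<longleftrightarrow> sample (Suc t) < right_end (K (fst a))"
      and nb: "sample t < right_end (K (fst b)) \<longleftrightarrow> sample (Suc t) < right_end (K (fst b))"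
      using nj t st by (auto simp: jumps_def)
    note A = h_normal(2)[OF I(1) t(1)] h_normal(2)[OF I(1) t(2)] h_ended(1,2)[OF I(1), of t]
    note bs = h_normal(2)[OF I(2) t(1)] h_normal(2)[OF I(2) t(2)] h_ended(1,2)[OF I(2), of t]
    show False
      using n na nb A bs ext[of a] ext[of b] lt
      by (cases "sample t < right_end (K (fst a))"; cases "sample t < right_end (K (fst b))"; cases "snd a"; cases "snd b") auto
  qed
  then have e: "sample (Suc t) < right_end (K (fst a))" "sample (Suc t) < right_end (K (fst b))"
    "sample t < right_end (K (fst a))" "sample t < right_end (K (fst b))" using st by auto
  have "val a (sample t) < val b (sample t)" "val b (sample (Suc t)) \<le> val a (sample (Suc t))"
    using lt e by (simp_all add: h_def)
  then obtain w where w: "min (sample t) (sample (Suc t)) \<le> w" "w \<le> max (sample t) (sample (Suc t))" "val a w = val b w"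
    using val_no_cross[OF I ne sample_gt[OF t(2)] sample_gt[OF t(1)] e(3,4) e(1,2)] by blast
  have w': "sample t \<le> w" "w \<le> sample (Suc t)" using w st by auto
  have wi: "x0 < w" "w < right_end (K (fst a))" "w < right_end (K (fst b))" using w' e sample_gt[OF t(2)] by auto
  note v = val_eq[OF I ne wi w(3)]
  have "w = event t" using event_ge[OF t(2) v(3) w'(1)] event_le[OF t(1) v(3) w'(2)] by simp
  then show ?thesis using v by simp
qed

section \<open>Crossings bounded by common points\<close>

definition common :: "'i \<Rightarrow> 'i \<Rightarrow> nat" where
  "common i j = (if i = j then 0 else card (frontier (K i) \<inter> frontier (K j)))"

text \<open>An ordered pair of arcs crosses at most once per common point of its curves, plus once
  per jump of either arc. A pair of curves has four pairs of arcs, and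
  \<open>2 * (2 n)^2 = 8 n^2\<close> for \<open>n\<close> curves.\<close>

lemma card_crossings: "card (crossings V last_time h) \<le> 4 * (\<Sum>i\<in>I. \<Sum>j\<in>I. common i j) + 8 * (card I)^2"
proof -
  let ?X = "crossings V last_time h"
  have finV: "finite V" using finI by (simp add: V_def)
  have one: "card {t. (t, a, b) \<in> ?X} \<le> common (fst a) (fst b) + 2" if "a \<in> V" "b \<in> V" for a b
  proof -
    define S where "S = {t. t \<le> last_time \<and> fst a \<noteq> fst b \<and> (event t, val a (event t)) \<in> frontier (K (fst a)) \<inter> frontier (K (fst b))}"
    have I: "fst a \<in> I" "fst b \<in> I" using that by (auto simp: V_def)
    have "{t. (t, a, b) \<in> ?X} \<subseteq> S \<union> ({t. jumps a t} \<union> {t. jumps b t})"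
    proof
      fix t assume "t \<in> {t. (t, a, b) \<in> ?X}"
      then have x: "(t, a, b) \<in> ?X" by simp
      then have "t \<le> last_time" by (simp add: crossings_def)
      then show "t \<in> S \<union> ({t. jumps a t} \<union> {t. jumps b t})"
        using crossing_cases[OF x] by (auto simp: S_def)
    qed
    moreover have fj: "finite {t. jumps a t}" for a
      by (rule finite_subset[of _ "{..last_time}"]) (auto simp: jumps_def)
    moreover have "finite S" by (rule finite_subset[of _ "{..last_time}"]) (auto simp: S_def)
    ultimately have "card {t. (t, a, b) \<in> ?X} \<le> card (S \<union> ({t. jumps a t} \<union> {t. jumps b t}))"
      by (intro card_mono) auto
    also have "\<dots> \<le> card S + (card {t. jumps a t} + card {t. jumps b t})"
      by (meson card_Un_le add_left_mono order_trans)
    finally have le: "card {t. (t, a, b) \<in> ?X} \<le> card S + (card {t. jumps a t} + card {t. jumps b t})" .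
    have "card {t. jumps a t} \<le> Suc 0" for a
      using jumps_unique[of a] fj[of a] by (simp add: card_le_Suc0_iff_eq)
    note this[of a] this[of b]
    moreover have "card S \<le> common (fst a) (fst b)"
    proof (cases "fst a = fst b")
      case True
      then show ?thesis by (simp add: S_def)
    next
      case False
      have "card S \<le> card (frontier (K (fst a)) \<inter> frontier (K (fst b)))"
      proof (rule card_inj_on_le[of "\<lambda>t. (event t, val a (event t))"])
        show "inj_on (\<lambda>t. (event t, val a (event t))) S"
          using event_mono by (auto simp: inj_on_def S_def) (metis less_irrefl linorder_neqE_nat)
      qed (use fin_int[OF I False] in \<open>auto simp: S_def\<close>)
      then show ?thesis using False by (simp add: common_def)
    qed
    ultimately show ?thesis using le by linarith
  qed
  have fT: "finite {t. (t, a, b) \<in> ?X}" for a b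
    by (rule finite_subset[of _ "{..<last_time}"]) (auto simp: crossings_def)
  have "?X = (\<lambda>((a, b), t). (t, a, b)) ` (SIGMA x:V \<times> V. {t. (t, fst x, snd x) \<in> ?X})"
    by (auto simp: crossings_def image_iff)
  then have "card ?X = card ((\<lambda>((a, b), t). (t, a, b)) ` (SIGMA x:V \<times> V. {t. (t, fst x, snd x) \<in> ?X}))"
    by (rule arg_cong)
  also have "\<dots> \<le> card (SIGMA x:V \<times> V. {t. (t, fst x, snd x) \<in> ?X})"
    using finV fT by (intro card_image_le finite_SigmaI) auto
  also have "\<dots> = (\<Sum>x\<in>V \<times> V. card {t. (t, fst x, snd x) \<in> ?X})"
    using finV fT by (intro card_SigmaI) auto
  also have "\<dots> \<le> (\<Sum>x\<in>V \<times> V. common (fst (fst x)) (fst (snd x)) + 2)"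
    using one by (intro sum_mono) auto
  also have "\<dots> = (\<Sum>a\<in>V. \<Sum>b\<in>V. common (fst a) (fst b) + 2)"
    by (simp add: sum.cartesian_product')
  also have "\<dots> = 2 * (\<Sum>i\<in>I. 2 * (\<Sum>j\<in>I. common i j + 2))"
  proof -
    have sV: "(\<Sum>a\<in>V. f (fst a)) = 2 * (\<Sum>i\<in>I. f i)" for f :: "'i \<Rightarrow> nat"
      unfolding V_def by (simp add: sum.cartesian_product' UNIV_bool sum_distrib_left mult_2)
    have "(\<Sum>a\<in>V. \<Sum>b\<in>V. common (fst a) (fst b) + 2) = (\<Sum>a\<in>V. 2 * (\<Sum>j\<in>I. common (fst a) j + 2))"
      by (intro sum.cong refl sV)
    also have "\<dots> = 2 * (\<Sum>i\<in>I. 2 * (\<Sum>j\<in>I. common i j + 2))" by (rule sV)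
    finally show ?thesis .
  qed
  also have "\<dots> = 4 * (\<Sum>i\<in>I. \<Sum>j\<in>I. common i j) + 8 * (card I)^2"
    by (simp only: sum.distrib sum_distrib_left[symmetric] sum_constant) (simp add: power2_eq_square)
  finally show ?thesis .
qed

text \<open>An arc strictly between \<open>a\<close> and \<open>b\<close> at the last sample before
  \<open>px\<close> cannot meet either of them before \<open>px\<close>, as no event intervenes. So
  it is squeezed into the common point, which would then lie on a third curve or on both arcs of one
  curve.\<close>

lemma touches_at_common_point:
  assumes ab: "a \<in> V" "b \<in> V" "fst a \<noteq> fst b"
    and p: "x0 < px" "px < right_end (K (fst a))" "px < right_end (K (fst b))"
    and v: "val a px = py" "val b px = py"
    and lt: "\<And>t. t \<le> last_time \<Longrightarrow> h t a < h t b"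
  shows "(a, b) \<in> touches V last_time h"
proof -
  have I: "fst a \<in> I" "fst b \<in> I" and ne: "a \<noteq> b" using ab by (auto simp: V_def)
  have pf: "(px, py) \<in> frontier (K (fst a)) \<inter> frontier (K (fst b))" and pZ: "px \<in> event_set"
    using val_eq(2,3)[OF I ne p] v by auto
  obtain t where t: "t \<le> last_time" "px = event t" using event_surj[OF pZ] .
  have st: "sample t < px" "x0 < sample t" using sample_less_event[OF t(1)] sample_gt[OF t(1)] t by auto
  have na: "h t a = val a (sample t)" "\<bar>h t a\<bar> < height_bound" and nb: "h t b = val b (sample t)" "\<bar>h t b\<bar> < height_bound"
    using h_normal[OF I(1) t(1)] h_normal[OF I(2) t(1)] st p by auto
  have "False" if c: "c \<in> V" "h t a < h t c" "h t c < h t b" for c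
  proof -
    have Ic: "fst c \<in> I" using c by (auto simp: V_def)
    have nea: "a \<noteq> c" and neb: "c \<noteq> b" using c by auto
    have sc: "sample t < right_end (K (fst c))"
      using h_ended(1,2)[OF Ic, of t] na nb c by (cases "snd c") force+
    then have rc: "px \<le> right_end (K (fst c))"
      unfolding t(2) using st by (intro event_ge[OF t(1)] right_end_event Ic) auto
    have nc: "h t c = val c (sample t)" using h_normal[OF Ic t(1) sc] by simp
    have noZ: "x \<notin> event_set" if "sample t \<le> x" "x < px" for x using event_ge[OF t(1), of x] that t by auto
    have below: "val d x < val e x"
      if de: "fst d \<in> I" "fst e \<in> I" "d \<noteq> e" "px \<le> right_end (K (fst d))" "px \<le> right_end (K (fst e))"
        and l: "val d (sample t) < val e (sample t)" and x: "sample t \<le> x" "x < px" for d e x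
    proof (rule ccontr)
      assume "\<not> val d x < val e x"
      then have le: "val e x \<le> val d x" by simp
      obtain w where w: "min (sample t) x \<le> w" "w \<le> max (sample t) x" "val d w = val e w"
      proof (rule val_no_cross[OF de(1,2,3) st(2) _ _ _ _ _ l le])
        show "x0 < x" "sample t < right_end (K (fst d))" "sample t < right_end (K (fst e))"
          "x < right_end (K (fst d))" "x < right_end (K (fst e))"
          using x st de by linarith+
      qed
      then have w': "sample t \<le> w" "w < px" using x by auto
      then have "w \<in> event_set" using de st w(3) by (intro val_eq(3)[OF de(1,2,3)]) auto
      then show False using noZ w' by blast
    qed
    have l1: "val a x < val c x" if "sample t \<le> x" "x < px" for x
      using below[OF I(1) Ic nea _ rc _ that] p na nc c by auto
    have l2: "val c x < val b x" if "sample t \<le> x" "x < px" for x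
      using below[OF Ic I(2) neb rc _ _ that] p nb nc c by auto
    have cont: "(val d \<longlongrightarrow> val d px) (at_left px)" if "fst d \<in> I" "px < right_end (K (fst d))" for d
    proof -
      have "isCont (val d) px"
        using continuous_val[OF that(1)] that p by (simp add: continuous_on_eq_continuous_at)
      then show ?thesis by (simp add: isCont_def filterlim_at_split)
    qed
    have ev: "\<forall>\<^sub>F x in at_left px. sample t \<le> x \<and> x < px"
      using st by (intro eventually_at_leftI[of "sample t"]) auto
    \<comment> \<open>The body of \<open>c\<close> may end exactly at \<open>px\<close>, where
      \<open>continuous_val\<close> says nothing; squeezing gives the limit, and closedness of the
      frontier puts it on the curve.\<close>
    have lim: "(val c \<longlongrightarrow> py) (at_left px)"
    proof (rule tendsto_sandwich)
      show "\<forall>\<^sub>F x in at_left px. val a x \<le> val c x" using ev by eventually_elim (use l1 in force)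
      show "\<forall>\<^sub>F x in at_left px. val c x \<le> val b x" using ev by eventually_elim (use l2 in force)
      show "(val a \<longlongrightarrow> py) (at_left px)" "(val b \<longlongrightarrow> py) (at_left px)" using cont I p v by metis+
    qed
    have pc: "(px, py) \<in> frontier (K (fst c))"
    proof (rule Lim_in_closed_set[of "frontier (K (fst c))" "\<lambda>x. (x, val c x)" "at_left px"])
      show "closed (frontier (K (fst c)))" by simp
      show "\<forall>\<^sub>F x in at_left px. (x, val c x) \<in> frontier (K (fst c))"
        using ev by eventually_elim (use st rc Ic in \<open>auto intro!: val_frontier\<close>)
      show "((\<lambda>x. (x, val c x)) \<longlongrightarrow> (px, py)) (at_left px)" by (intro tendsto_Pair tendsto_ident_at lim)
    qed auto
    have same: False if d: "fst d \<in> I" "fst c = fst d" "d \<noteq> c" "px < right_end (K (fst d))" "val d px = py" for d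
    proof -
      have "px < right_end (K (fst c))" using d by simp
      then have "(val c \<longlongrightarrow> val c px) (at_left px)" by (intro cont Ic)
      then have "val c px = py" using lim tendsto_unique trivial_limit_at_left_real by blast
      then show False using val_eq(1)[OF d(1) Ic d(3) p(1) d(4) \<open>px < right_end (K (fst c))\<close>] d by simp
    qed
    show False
    proof (cases "fst c = fst a \<or> fst c = fst b")
      case True
      then show False using same[of a] same[of b] I p v nea neb by metis
    next
      case False
      then show False using no_triple[OF I Ic] ab(3) pf pc by auto
    qed
  qed
  then have "touches_at V last_time h a b t" using lt t by (auto simp: touches_at_def)
  then show ?thesis using ab lt by (auto simp: touches_def)
qed

lemma disjoint_touch:
  assumes ij: "i \<in> I" "j \<in> I" "i \<noteq> j" and p: "K i \<inter> K j = {(px, py)}"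
    and px: "x0 < px" "px < right_end (K i)" "px < right_end (K j)"
    and eq: "upper (K i) px = py" "lower (K j) px = py"
  shows "((i, True), (j, False)) \<in> touches V last_time h"
proof (rule touches_at_common_point[where px = px and py = py])
  have inside: "left_end (K k) \<le> x \<and> left_end (K k) < x \<and> x \<le> right_end (K k)"
    if "k \<in> I" "x0 < x" "x < right_end (K k)" for k x
    using x0[OF that(1)] that by auto
  have lu: "lower (K k) x < upper (K k) x" if "k \<in> I" "x0 < x" "x < right_end (K k)" for k x
    using inside[OF that] that by (intro lower_less_upper body) auto
  have sec: "(x, y) \<in> K k \<longleftrightarrow> lower (K k) x \<le> y \<and> y \<le> upper (K k) x" if "k \<in> I" "x0 < x" "x < right_end (K k)" for k x y
    using inside[OF that] that by (intro section_body(1) body) auto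
  have strict: "upper (K i) x < lower (K j) x" if x: "x0 < x" "x < right_end (K i)" "x < right_end (K j)" "x \<noteq> px" for x
  proof (rule ccontr)
    assume n: "\<not> ?thesis"
    have "(x, y) \<notin> K i \<inter> K j" for y using p x(4) by auto
    then have nb: "\<not> (lower (K i) x \<le> y \<and> y \<le> upper (K i) x \<and> lower (K j) x \<le> y \<and> y \<le> upper (K j) x)" for y
      using sec[OF ij(1) x(1,2)] sec[OF ij(2) x(1,3)] by auto
    have "upper (K j) x < lower (K i) x"
      using n nb[of "upper (K i) x"] nb[of "lower (K j) x"] nb[of "upper (K j) x"] lu[OF ij(1) x(1,2)] lu[OF ij(2) x(1,3)] by linarith
    then have 1: "val (j, True) x < val (i, False) x" by (simp add: val_def)
    \<comment> \<open>At \<open>px\<close> the body \<open>K i\<close> is below \<open>K j\<close>.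
      Being above at \<open>x\<close>, it would have its lower arc meet the upper arc of
      \<open>K j\<close> at an abscissa other than \<open>px\<close>, in a second common
      point.\<close>
    have 2: "val (i, False) px < val (j, True) px"
      using lu[OF ij(1) px(1,2)] lu[OF ij(2) px(1,3)] eq by (simp add: val_def)
    obtain w where w: "min x px \<le> w" "w \<le> max x px" "val (j, True) w = val (i, False) w"
      using val_no_cross[of "(j, True)" "(i, False)" x px] ij x px 1 2 by auto
    have w': "x0 < w" "w < right_end (K j)" "w < right_end (K i)" using w x px by auto
    have "(w, val (j, True) w) \<in> K j \<inter> K i"
      using val_frontier[of "(j, True)" w] val_frontier[of "(i, False)" w] w' ij w(3) frontier_body[OF body] by auto
    then have "w = px" using p by auto
    then show False using w(3) 2 by simp
  qed
  show "h t (i, True) < h t (j, False)" if t: "t \<le> last_time" for t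
  proof -
    have pZ: "px \<in> event_set"
      using val_eq(3)[of "(i, True)" "(j, False)" px] ij px eq by (simp add: val_def)
    then have sp: "sample t \<noteq> px" using sample_notin[OF t] by auto
    note ni = h_normal[of "(i, True)" t] and nj = h_normal[of "(j, False)" t]
      and ei = h_ended(1)[of "(i, True)" t] and ej = h_ended(2)[of "(j, False)" t]
    consider "sample t < right_end (K i)" "sample t < right_end (K j)"
      | "sample t < right_end (K i)" "\<not> sample t < right_end (K j)"
      | "\<not> sample t < right_end (K i)" "sample t < right_end (K j)"
      | "\<not> sample t < right_end (K i)" "\<not> sample t < right_end (K j)" by blast
    then show ?thesis
    proof cases
      case 1
      then show ?thesis using strict[OF sample_gt[OF t] 1 sp] ni(1) nj(1) ij t by (simp add: val_def)
    next
      case 2 then show ?thesis using ni(2) ej ij t by auto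
    next
      case 3 then show ?thesis using nj(2) ei ij t by auto
    next
      case 4 then show ?thesis using ei ej ij t height_bound(1) by auto
    qed
  qed
qed (use ij px eq in \<open>auto simp: V_def val_def\<close>)

text \<open>By inclusion the arcs of \<open>K i\<close> stay between those of \<open>K j\<close>,
  and the touching point is on the upper or the lower arc of both. Once the bodies have ended,
  \<open>end_rank\<close> keeps this order, since \<open>K i\<close> ends first.\<close>

lemma nested_touch:
  assumes ij: "i \<in> I" "j \<in> I" "i \<noteq> j" and sub: "K i \<subseteq> K j"
    and p: "frontier (K i) \<inter> frontier (K j) = {(px, py)}"
    and px: "x0 < px" "px < right_end (K i)" "px < right_end (K j)"
  shows "((i, True), (j, True)) \<in> touches V last_time h \<or> ((j, False), (i, False)) \<in> touches V last_time h"
proof -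
  have inside: "left_end (K k) \<le> x" "left_end (K k) < x" "x \<le> right_end (K k)"
    if "k \<in> I" "x0 < x" "x < right_end (K k)" for k x
    using x0[OF that(1)] that by auto
  have sec: "(x, y) \<in> K k \<longleftrightarrow> lower (K k) x \<le> y \<and> y \<le> upper (K k) x" "(x, upper (K k) x) \<in> K k" "(x, lower (K k) x) \<in> K k"
    if "k \<in> I" "x0 < x" "x < right_end (K k)" for k x y
    using section_body[OF body[OF that(1)] inside(1,3)[OF that]] by blast+
  have le: "upper (K i) x \<le> upper (K j) x" "lower (K j) x \<le> lower (K i) x"
    if "x0 < x" "x < right_end (K i)" "x < right_end (K j)" for x
    using sec[OF ij(1) that(1,2)] sec[OF ij(2) that(1,3)] sub by blast+
  have pij: "(px, py) \<in> K i" "(px, py) \<in> frontier (K j)" using p frontier_body[OF body[OF ij(1)]] by auto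
  have rle: "right_end (K i) \<le> right_end (K j)"
  proof -
    have "fst ` K i \<subseteq> fst ` K j" using sub by auto
    then show ?thesis using fst_image_body[OF body[OF ij(1)]] fst_image_body[OF body[OF ij(2)]] x0[OF ij(1)] by auto
  qed
  \<comment> \<open>With equal right ends, the top of the rightmost section of \<open>K i\<close>
    would be a second common point of the frontiers.\<close>
  have "right_end (K i) \<noteq> right_end (K j)"
  proof
    assume e: "right_end (K i) = right_end (K j)"
    have "(right_end (K i), upper (K i) (right_end (K i))) \<in> K i"
      using x0[OF ij(1)] by (intro section_body(3) body ij) auto
    then have "(right_end (K i), upper (K i) (right_end (K i))) \<in> frontier (K i) \<inter> frontier (K j)"
      using extreme_section_frontier[OF body[OF ij(1)]] extreme_section_frontier[OF body[OF ij(2)]] e sub by auto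
    then show False using p px by auto
  qed
  then have rlt: "right_end (K i) < right_end (K j)" and ri: "end_rank i < end_rank j"
    using rle end_rank(3)[OF ij(1,2)] by auto
  have neq: "val (i, b) (sample t) \<noteq> val (j, b) (sample t)"
    if "t \<le> last_time" "sample t < right_end (K i)" "sample t < right_end (K j)" for t b
    using val_eq(3)[of "(i, b)" "(j, b)" "sample t"] sample_notin[OF that(1)] sample_gt[OF that(1)] that ij by auto
  have hcase: "h t (i, True) < h t (j, True) \<and> h t (j, False) < h t (i, False)" if t: "t \<le> last_time" for t
  proof -
    consider "sample t < right_end (K i)" "sample t < right_end (K j)"
      | "\<not> sample t < right_end (K i)" "sample t < right_end (K j)"
      | "\<not> sample t < right_end (K i)" "\<not> sample t < right_end (K j)" using rle by linarith
    then show ?thesis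
    proof cases
      case 1
      then show ?thesis
        using le[OF sample_gt[OF t] 1] neq[OF t 1, of True] neq[OF t 1, of False]
        by (simp add: h_def val_def)
    next
      case 2
      then show ?thesis using h_normal(2)[of "(j, True)" t] h_normal(2)[of "(j, False)" t]
          h_ended(1)[of "(i, True)" t] h_ended(2)[of "(i, False)" t] ij t by auto
    next
      case 3
      then show ?thesis using ri by (simp add: h_def)
    qed
  qed
  consider "py = upper (K j) px" | "py = lower (K j) px"
    using frontier_inside_cases[OF body[OF ij(2)] inside(2)[OF ij(2) px(1,3)] px(3) pij(2)] by blast
  then show ?thesis
  proof cases
    case 1
    then have "upper (K i) px = py" using le(1)[OF px] sec(1)[OF ij(1) px(1,2), of py] pij by auto
    then have "((i, True), (j, True)) \<in> touches V last_time h"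
      using 1 ij px hcase by (intro touches_at_common_point[where px = px and py = py]) (auto simp: V_def val_def)
    then show ?thesis ..
  next
    case 2
    then have "lower (K i) px = py" using le(2)[OF px] sec(1)[OF ij(1) px(1,2), of py] pij by auto
    then have "((j, False), (i, False)) \<in> touches V last_time h"
      using 2 ij px hcase by (intro touches_at_common_point[where px = px and py = py]) (auto simp: V_def val_def)
    then show ?thesis ..
  qed
qed

lemma touch_in_system:
  assumes ij: "i \<in> I" "j \<in> I" "i \<noteq> j" and p: "frontier (K i) \<inter> frontier (K j) = {p}"
    and px: "x0 < fst p" "fst p < right_end (K i)" "fst p < right_end (K j)"
  shows "\<exists>c d. ((i, c), (j, d)) \<in> touches V last_time h \<or> ((j, d), (i, c)) \<in> touches V last_time h"
proof -
  obtain x y where xy: "p = (x, y)" by (cases p)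
  consider "K i \<inter> K j = {p}" | "K i \<subseteq> K j" | "K j \<subseteq> K i"
    using touching_bodies_cases[OF body[OF ij(1)] body[OF ij(2)] p] by blast
  then show ?thesis
  proof cases
    case 1
    have inside: "left_end (K k) \<le> x" "left_end (K k) < x" "x \<le> right_end (K k)" if "k \<in> I" "x < right_end (K k)" for k
      using x0[OF that(1)] that px xy by auto
    have sec: "(x, v) \<in> K k \<longleftrightarrow> lower (K k) x \<le> v \<and> v \<le> upper (K k) x" if "k \<in> I" "x < right_end (K k)" for k v
      using inside[OF that] that by (intro section_body(1) body) auto
    have lu: "lower (K k) x < upper (K k) x" if "k \<in> I" "x < right_end (K k)" for k
      using inside[OF that] that by (intro lower_less_upper body) auto
    have X: "x < right_end (K i)" "x < right_end (K j)" using px xy by auto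
    have un: "v = y" if "lower (K i) x \<le> v \<and> v \<le> upper (K i) x \<and> lower (K j) x \<le> v \<and> v \<le> upper (K j) x" for v
    proof -
      have "(x, v) \<in> K i \<inter> K j" using that sec[OF ij(1) X(1), of v] sec[OF ij(2) X(2), of v] by simp
      then show ?thesis using 1 xy by simp
    qed
    have "(x, y) \<in> K i \<inter> K j" using 1 xy by simp
    then have y: "lower (K i) x \<le> y \<and> y \<le> upper (K i) x \<and> lower (K j) x \<le> y \<and> y \<le> upper (K j) x"
      using sec[OF ij(1) X(1), of y] sec[OF ij(2) X(2), of y] by simp
    \<comment> \<open>The sections over \<open>x\<close> are nondegenerate intervals with only
      \<open>y\<close> in common, so one lies on top of the other.\<close>
    have "(upper (K i) x = y \<and> lower (K j) x = y) \<or> (upper (K j) x = y \<and> lower (K i) x = y)"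
      using un[of "upper (K i) x"] un[of "upper (K j) x"] un[of "lower (K i) x"] un[of "lower (K j) x"]
        lu[OF ij(1) X(1)] lu[OF ij(2) X(2)] y by linarith
    then show ?thesis
    proof
      assume "upper (K i) x = y \<and> lower (K j) x = y"
      then show ?thesis using disjoint_touch[OF ij, of x y] 1 xy px by auto
    next
      assume "upper (K j) x = y \<and> lower (K i) x = y"
      then show ?thesis using disjoint_touch[OF ij(2,1) ij(3)[symmetric], of x y] 1 xy px by (auto simp: Int_commute)
    qed
  next
    case 2
    then show ?thesis using nested_touch[OF ij 2, of x y] p px xy by auto
  next
    case 3
    then show ?thesis using nested_touch[OF ij(2,1) ij(3)[symmetric] 3, of x y] p px xy by (auto simp: Int_commute)
  qed
qed

text \<open>Ends of the vertical sections over \<open>x0\<close> and over the right ends. Touchings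
  there may escape the arcs and are simply counted: at most four points per body, each on at most
  one pair of curves.\<close>

definition bad_points :: "(real \<times> real) set" where
  "bad_points = (\<Union>i\<in>I. \<Union>x\<in>{x0, right_end (K i)}. {(x, upper (K i) x), (x, lower (K i) x)})"

text \<open>Over an abscissa extreme for both bodies both sections consist of frontier points; as
  they share only \<open>y\<close>, it is an end of one of them.\<close>

lemma extreme_touch_endpoint:
  assumes ij: "i \<in> I" "j \<in> I" "i \<noteq> j" and p: "frontier (K i) \<inter> frontier (K j) = {(x, y)}"
    and ends: "x = left_end (K i) \<or> x = right_end (K i)" "x = left_end (K j) \<or> x = right_end (K j)"
  shows "y \<in> {upper (K i) x, lower (K i) x, upper (K j) x, lower (K j) x}"
proof (rule ccontr)
  assume n: "\<not> ?thesis"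
  have inK: "(x, y) \<in> K i" "(x, y) \<in> K j"
    using p frontier_body[OF body[OF ij(1)]] frontier_body[OF body[OF ij(2)]] by auto
  have rng: "left_end (K k) \<le> x" "x \<le> right_end (K k)" if "k = i \<or> k = j" for k
    using that ends x0 ij by force+
  have sec: "(x, v) \<in> K k \<longleftrightarrow> lower (K k) x \<le> v \<and> v \<le> upper (K k) x" if "k = i \<or> k = j" for k v
    using rng[OF that] that ij by (intro section_body(1) body) auto
  define v where "v = min (upper (K i) x) (upper (K j) x)"
  have "y < v" "lower (K i) x \<le> v" "lower (K j) x \<le> v" "v \<le> upper (K i) x" "v \<le> upper (K j) x"
    using inK sec[of i y] sec[of j y] n by (auto simp: v_def)
  then have "(x, v) \<in> K i" "(x, v) \<in> K j" "y < v" using sec by auto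
  then have "(x, v) \<in> frontier (K i) \<inter> frontier (K j)"
    using extreme_section_frontier[OF body[OF ij(1)]] extreme_section_frontier[OF body[OF ij(2)]] ends by auto
  then show False using p \<open>y < v\<close> by auto
qed

text \<open>If \<open>x\<close> is extreme for both bodies, \<open>extreme_touch_endpoint\<close>
  makes the point bad at \<open>x0\<close> or a shared right end; otherwise over \<open>x0\<close>
  it is an end of a section, bad as well. If \<open>x\<close> is the right end of \<open>K i\<close>
  only, the point is inside a vertical edge of \<open>K i\<close> and on an arc of
  \<open>K j\<close>, which contradicts each case of \<open>touching_bodies_cases\<close>.\<close>

lemma good_touch_inside:
  assumes ij: "i \<in> I" "j \<in> I" "i \<noteq> j" and p: "frontier (K i) \<inter> frontier (K j) = {(x, y)}"
    and px: "x0 \<le> x" and good: "(x, y) \<notin> bad_points"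
  shows "x0 < x \<and> x < right_end (K i)"
proof -
  have inK: "(x, y) \<in> K i" "(x, y) \<in> K j" and fr: "(x, y) \<in> frontier (K i)" "(x, y) \<in> frontier (K j)"
    using p frontier_body[OF body[OF ij(1)]] frontier_body[OF body[OF ij(2)]] by auto
  have rng: "left_end (K k) \<le> x" "x \<le> right_end (K k)" if "k = i \<or> k = j" for k
  proof -
    have "x \<in> fst ` K k" using that inK by force
    moreover have "k \<in> I" using that ij by auto
    ultimately show "left_end (K k) \<le> x" "x \<le> right_end (K k)" using fst_image_body[OF body[of k]] by auto
  qed
  have sec: "(x, v) \<in> K k \<longleftrightarrow> lower (K k) x \<le> v \<and> v \<le> upper (K k) x" if "k = i \<or> k = j" for k v
    using rng[OF that] that ij by (intro section_body(1) body) auto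
  have nb: "y \<noteq> upper (K k) x \<and> y \<noteq> lower (K k) x" if "k = i \<or> k = j" "x = x0 \<or> x = right_end (K k)" for k
    using good that ij unfolding bad_points_def by blast
  have x0': "x0 < x"
  proof (rule ccontr)
    assume "\<not> x0 < x"
    then have e: "x = x0" using px by simp
    have "x = left_end (K k) \<or> x = right_end (K k)" if k: "k = i \<or> k = j" for k
    proof (rule ccontr)
      assume "\<not> ?thesis"
      then have "left_end (K k) < x" "x < right_end (K k)" using rng[OF k] by auto
      then have "y = upper (K k) x \<or> y = lower (K k) x"
        using frontier_inside_cases[of "K k" x y] body ij k fr by auto
      then show False using nb[OF k] e by auto
    qed
    then show False using extreme_touch_endpoint[OF ij p] nb[of i] nb[of j] e by auto
  qed
  moreover have "x \<noteq> right_end (K i)"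
  proof
    assume e: "x = right_end (K i)"
    show False
    proof (cases "x = right_end (K j)")
      case True
      then show False using extreme_touch_endpoint[OF ij p] nb[of i] nb[of j] e by auto
    next
      case False
      then have xj: "left_end (K j) < x" "x < right_end (K j)" using rng[of j] x0[OF ij(2)] x0' by auto
      have yi: "lower (K i) x < y" "y < upper (K i) x" using nb[of i] e sec[of i y] inK by auto
      have yj: "y = upper (K j) x \<or> y = lower (K j) x" using frontier_inside_cases[OF body[OF ij(2)] xj fr(2)] .
      have lu: "lower (K j) x < upper (K j) x" by (rule lower_less_upper[OF body[OF ij(2)] xj])
      consider "K i \<inter> K j = {(x, y)}" | "K i \<subseteq> K j" | "K j \<subseteq> K i"
        using touching_bodies_cases[OF body[OF ij(1)] body[OF ij(2)] p] by blast
      then show False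
      proof cases
        case 1
        define v where "v = (if y = upper (K j) x then max (lower (K i) x) (lower (K j) x) else min (upper (K i) x) (upper (K j) x))"
        have "v \<noteq> y" "lower (K i) x \<le> v \<and> v \<le> upper (K i) x" "lower (K j) x \<le> v \<and> v \<le> upper (K j) x"
          using yi yj lu by (auto simp: v_def)
        then have "(x, v) \<in> K i \<inter> K j" "v \<noteq> y" using sec by auto
        then show False using 1 by auto
      next
        case 2
        have "(x, upper (K i) x) \<in> K j" "(x, lower (K i) x) \<in> K j"
          using sec[of i "upper (K i) x"] sec[of i "lower (K i) x"] yi 2 by auto
        then show False using sec[of j "upper (K i) x"] sec[of j "lower (K i) x"] yi yj by auto
      next
        case 3
        then have "fst ` K j \<subseteq> fst ` K i" by auto
        then have "right_end (K j) \<in> fst ` K i" using fst_image_body[OF body[OF ij(2)]] xj by auto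
        then show False using fst_image_body[OF body[OF ij(1)]] xj e by auto
      qed
    qed
  qed
  ultimately show ?thesis using rng[of i] by auto
qed

text \<open>Away from the bad points such a pair gives a touching of arcs. Pairs are ordered, hence
  the factor \<open>2\<close>; bad points account for \<open>4 * 2\<close> ordered pairs per
  curve.\<close>

lemma card_right_touching:
  "card {(i, j) \<in> I \<times> I. i \<noteq> j \<and> (\<exists>p. frontier (K i) \<inter> frontier (K j) = {p} \<and> x0 \<le> fst p)}
    \<le> 2 * card (touches V last_time h) + 8 * card I"
proof -
  define R where "R = {(i, j) \<in> I \<times> I. i \<noteq> j \<and> (\<exists>p. frontier (K i) \<inter> frontier (K j) = {p} \<and> x0 \<le> fst p)}"
  define Bad where "Bad = (\<Union>p\<in>bad_points. {(i, j) \<in> I \<times> I. i \<noteq> j \<and> p \<in> frontier (K i) \<inter> frontier (K j)})"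
  define T where "T = (\<lambda>(a, b). (fst a, fst b)) ` touches V last_time h"
  have finT: "finite (touches V last_time h)" using system by (auto simp: height_system_def intro: finite_touches)
  have fb: "finite bad_points" using finI by (auto simp: bad_points_def)
  have finIJ: "finite {(i, j) \<in> I \<times> I. i \<noteq> j \<and> p \<in> frontier (K i) \<inter> frontier (K j)}" for p
    by (rule finite_subset[of _ "I \<times> I"]) (use finI in auto)
  have sub: "R \<subseteq> T \<union> prod.swap ` T \<union> Bad"
  proof (rule subsetI, rule ccontr)
    fix q assume q: "q \<in> R" "q \<notin> T \<union> prod.swap ` T \<union> Bad"
    obtain i j where ij: "q = (i, j)" "i \<in> I" "j \<in> I" "i \<noteq> j" using q by (auto simp: R_def)
    obtain x y where p: "frontier (K i) \<inter> frontier (K j) = {(x, y)}" "x0 \<le> x" using q ij by (auto simp: R_def)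
    have good: "(x, y) \<notin> bad_points" using q(2) ij p unfolding Bad_def by blast
    have "x0 < x" "x < right_end (K i)" "x < right_end (K j)"
      using good_touch_inside[OF ij(2,3,4) p good] good_touch_inside[OF ij(3,2) ij(4)[symmetric] _ p(2) good] p(1)
      by (auto simp: Int_commute)
    then obtain c d where "((i, c), (j, d)) \<in> touches V last_time h \<or> ((j, d), (i, c)) \<in> touches V last_time h"
      using touch_in_system[OF ij(2,3,4) p(1)] by auto
    then have "(i, j) \<in> T \<or> (j, i) \<in> T" unfolding T_def by force
    then show False using q(2) ij by force
  qed
  have "card bad_points \<le> 4 * card I"
  proof -
    have "card bad_points \<le> (\<Sum>i\<in>I. card (\<Union>x\<in>{x0, right_end (K i)}. {(x, upper (K i) x), (x, lower (K i) x)}))"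
      unfolding bad_points_def using finI by (rule card_UN_le)
    also have "\<dots> \<le> (\<Sum>i\<in>I. 4)"
    proof (rule sum_mono)
      fix i
      have e: "(\<Union>x\<in>{x0, right_end (K i)}. {(x, upper (K i) x), (x, lower (K i) x)}) =
        set [(x0, upper (K i) x0), (x0, lower (K i) x0), (right_end (K i), upper (K i) (right_end (K i))),
          (right_end (K i), lower (K i) (right_end (K i)))]" by auto
      show "card (\<Union>x\<in>{x0, right_end (K i)}. {(x, upper (K i) x), (x, lower (K i) x)}) \<le> 4"
        unfolding e by (rule order_trans[OF card_length]) simp
    qed
    finally show ?thesis by simp
  qed
  moreover have two: "card {(i, j) \<in> I \<times> I. i \<noteq> j \<and> p \<in> frontier (K i) \<inter> frontier (K j)} \<le> 2" for p
    by (rule card_pairs_at_point) (use no_triple in auto)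
  moreover have "card Bad \<le> (\<Sum>p\<in>bad_points. card {(i, j) \<in> I \<times> I. i \<noteq> j \<and> p \<in> frontier (K i) \<inter> frontier (K j)})"
    unfolding Bad_def using fb by (rule card_UN_le)
  moreover have "\<dots> \<le> (\<Sum>p\<in>bad_points. 2)" by (intro sum_mono two)
  ultimately have Bad: "card Bad \<le> 8 * card I" by simp
  have T: "finite T" "card T \<le> card (touches V last_time h)" using finT by (auto simp: T_def intro: card_image_le)
  have "card R \<le> card (T \<union> prod.swap ` T \<union> Bad)"
    using sub T(1) fb finIJ by (intro card_mono) (auto simp: Bad_def)
  also have "\<dots> \<le> card T + card (prod.swap ` T) + card Bad" by (meson card_Un_le add_right_mono order_trans)
  also have "\<dots> \<le> card T + card T + card Bad" using card_image_le[OF T(1), of prod.swap] by simp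
  finally show ?thesis using T(2) Bad unfolding R_def by linarith
qed

end

subsection \<open>Counting intersection points\<close>

text \<open>Closing a convex set leaves its interior, and so its frontier, unchanged.\<close>

lemma closed_convex_curve_body:
  assumes "closed_convex_curve C"
  shows "\<exists>K. convex_body K \<and> frontier K = C"
proof -
  obtain K where K: "convex K" "bounded K" "interior K \<noteq> {}" "C = frontier K"
    using assms by (auto simp: closed_convex_curve_def)
  have i: "interior (closure K) = interior K" using K(1) by (rule convex_interior_closure)
  have "convex_body (closure K)"
    using K i by (simp add: convex_body_def convex_closure)
  moreover have "frontier (closure K) = C" using K i by (simp add: frontier_def)
  ultimately show ?thesis by blast
qed

lemma convex_body_linear_image:
  fixes f :: "'a::euclidean_space \<Rightarrow> 'b::euclidean_space"
  assumes "linear f" "bij f" "convex_body K"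
  shows "convex_body (f ` K)" "frontier (f ` K) = f ` frontier K"
proof -
  have K: "convex K" "compact K" "interior K \<noteq> {}" using assms(3) by (auto simp: convex_body_def)
  have i: "interior (f ` K) = f ` interior K" using assms by (intro interior_bijective_linear_image)
  have c: "compact (f ` K)" using K assms(1) by (intro compact_continuous_image linear_continuous_on) (simp_all add: linear_conv_bounded_linear)
  show "convex_body (f ` K)" using K i c assms(1) by (simp add: convex_body_def convex_linear_image)
  have "frontier (f ` K) = f ` K - f ` interior K" using c i by (simp add: frontier_def compact_imp_closed)
  also have "\<dots> = f ` (K - interior K)" using assms(2) by (simp add: image_set_diff bij_is_inj)
  also have "K - interior K = frontier K" using K by (simp add: frontier_def compact_imp_closed)
  finally show "frontier (f ` K) = f ` frontier K" .
qed

text \<open>The sign \<open>\<sigma>\<close> selects the half-plane to the right (\<open>1\<close>) or left (\<open>- 1\<close>) of the common vertical line.\<close>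

definition plane_pair :: "real \<Rightarrow> real^2 \<Rightarrow> real \<times> real" where
  "plane_pair \<sigma> v = (\<sigma> * v $ 1, v $ 2)"

lemma plane_pair:
  assumes "\<sigma> \<noteq> 0"
  shows "linear (plane_pair \<sigma>)" "bij (plane_pair \<sigma>)"
proof -
  show "linear (plane_pair \<sigma>)"
    by (rule linearI) (auto simp: plane_pair_def algebra_simps)
  show "bij (plane_pair \<sigma>)"
  proof (rule bijI')
    show "plane_pair \<sigma> v = plane_pair \<sigma> w \<longleftrightarrow> v = w" for v w
      using assms by (auto simp: plane_pair_def vec_eq_iff forall_2)
    show "\<exists>v. p = plane_pair \<sigma> v" for p
      using assms by (intro exI[of _ "vector [fst p / \<sigma>, snd p]"]) (simp add: plane_pair_def)
  qed
qed

lemma intersection_points_eq: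
  "intersection_points F = (\<Union>x\<in>{(C, D) \<in> F \<times> F. C \<noteq> D}. fst x \<inter> snd x)"
proof -
  have "intersection_point C D p \<longleftrightarrow> p \<in> C \<inter> D" for C D p
    unfolding intersection_point_def crossing_point_def touching_point_def by blast
  note ip = this
  show ?thesis
  proof (intro set_eqI iffI)
    fix p assume "p \<in> intersection_points F"
    then obtain C D where "C \<in> F" "D \<in> F" "C \<noteq> D" "p \<in> C \<inter> D"
      unfolding intersection_points_def ip by blast
    then show "p \<in> (\<Union>x\<in>{(C, D) \<in> F \<times> F. C \<noteq> D}. fst x \<inter> snd x)"
      by (intro UN_I[of "(C, D)"]) simp_all
  next
    fix p assume "p \<in> (\<Union>x\<in>{(C, D) \<in> F \<times> F. C \<noteq> D}. fst x \<inter> snd x)"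
    then obtain x where "x \<in> {(C, D) \<in> F \<times> F. C \<noteq> D}" "p \<in> fst x \<inter> snd x" by blast
    then show "p \<in> intersection_points F"
      unfolding intersection_points_def ip mem_Collect_eq by (cases x) (simp, blast)
  qed
qed

text \<open>Double counting: a point lies on the two orders of at most one pair of curves.\<close>

lemma sum_common_le:
  assumes fin: "finite F" and gp: "general_position F"
  shows "finite (intersection_points F)"
    and "(\<Sum>x\<in>{(C, D) \<in> F \<times> F. C \<noteq> D}. card (fst x \<inter> snd x)) \<le> 2 * card (intersection_points F)"
proof -
  define P where "P = {(C, D) \<in> F \<times> F. C \<noteq> D}"
  have finP: "finite P" by (rule finite_subset[of _ "F \<times> F"]) (use fin in \<open>auto simp: P_def\<close>)
  show fI: "finite (intersection_points F)"
    unfolding intersection_points_eq P_def[symmetric] using finP gp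
    by (auto simp: P_def general_position_def)
  have "fst x \<inter> snd x = {p \<in> intersection_points F. p \<in> fst x \<inter> snd x}" if "x \<in> P" for x
    using that unfolding intersection_points_eq P_def[symmetric] by blast
  then have "(\<Sum>x\<in>P. card (fst x \<inter> snd x)) = (\<Sum>x\<in>P. card {p \<in> intersection_points F. p \<in> fst x \<inter> snd x})"
    by (intro sum.cong refl arg_cong[of _ _ card]) simp
  also have "\<dots> = (\<Sum>p\<in>intersection_points F. card {x \<in> P. p \<in> fst x \<inter> snd x})"
    by (rule sum_card_swap[OF finP fI])
  also have "\<dots> \<le> (\<Sum>p\<in>intersection_points F. 2)"
  proof (rule sum_mono)
    fix p
    have "{x \<in> P. p \<in> fst x \<inter> snd x} = {(C, D) \<in> F \<times> F. C \<noteq> D \<and> p \<in> C \<inter> D}" by (auto simp: P_def)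
    moreover have "card {(C, D) \<in> F \<times> F. C \<noteq> D \<and> p \<in> C \<inter> D} \<le> 2"
      by (rule card_pairs_at_point[where A = "\<lambda>C. C"]) (use gp in \<open>auto simp: general_position_def\<close>)
    ultimately show "card {x \<in> P. p \<in> fst x \<inter> snd x} \<le> 2" by simp
  qed
  finally show "(\<Sum>x\<in>P. card (fst x \<inter> snd x)) \<le> 2 * card (intersection_points F)" by simp
qed

text \<open>A touching point lies on one side of the vertical line at \<open>x0\<close>, so
  \<open>curve_family\<close> is used for the curves and for their mirror images. Each side has at
  most \<open>2 * touches + 8 n\<close> pairs, and
  \<open>touches \<le> \<delta> * (4 S + 8 n^2) + 2 B n\<close>, where \<open>S\<close> sums the
  common points over ordered pairs and is at most twice the number of intersection points.\<close>

lemma card_touching_pairs: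
  fixes F :: "(real^2) set set"
  assumes fin: "finite F" and ne: "F \<noteq> {}" and cc: "\<forall>C\<in>F. closed_convex_curve C"
    and gp: "general_position F" and pw: "pairwise curves_intersect F"
    and \<delta>: "0 \<le> \<delta>" and bound: "\<And>V m (h :: nat \<Rightarrow> (real^2) set \<times> bool \<Rightarrow> real). height_system V m h \<Longrightarrow>
      real (card (touches V m h)) \<le> \<delta> * real (card (crossings V m h)) + B * real (card V)"
  shows "real (card {(C, D) \<in> F \<times> F. C \<noteq> D \<and> (\<exists>p. C \<inter> D = {p})}) \<le>
     32 * \<delta> * (real (card (intersection_points F)) + (real (card F))^2) + (8 * B + 16) * real (card F)"
proof -
  obtain K where K: "\<And>C. C \<in> F \<Longrightarrow> convex_body (K C) \<and> frontier (K C) = C"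
    using cc closed_convex_curve_body by metis
  define KK where "KK \<sigma> C = plane_pair \<sigma> ` K C" for \<sigma> C
  have KK: "convex_body (KK \<sigma> C)" "frontier (KK \<sigma> C) = plane_pair \<sigma> ` C" if "C \<in> F" "\<sigma> \<noteq> 0" for \<sigma> C
    using convex_body_linear_image[OF plane_pair[OF that(2)], of "K C"] K[OF that(1)] by (auto simp: KK_def)
  have inter: "frontier (KK \<sigma> C) \<inter> frontier (KK \<sigma> D) = plane_pair \<sigma> ` (C \<inter> D)" if "C \<in> F" "D \<in> F" "\<sigma> \<noteq> 0" for \<sigma> C D
    using KK(2) that plane_pair(2)[OF that(3)] by (simp add: image_Int bij_is_inj)
  \<comment> \<open>The largest left end: intervals that pairwise intersect have it in
    common.\<close>
  define x0 where "x0 = Max ((\<lambda>C. left_end (KK 1 C)) ` F)"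
  have "left_end (KK 1 C) \<le> right_end (KK 1 D)" if CD: "C \<in> F" "D \<in> F" for C D
  proof -
    have "\<exists>v. v \<in> K C \<and> v \<in> K D"
    proof (cases "C = D")
      case True
      then show ?thesis using K[OF CD(1)] convex_body_ne by blast
    next
      case False
      then have "C \<inter> D \<noteq> {}" using pw CD by (auto simp: pairwise_def curves_intersect_def)
      moreover have "C \<subseteq> K C" "D \<subseteq> K D" using K CD frontier_subset_compact by (metis convex_body_def)+
      ultimately show ?thesis by blast
    qed
    then obtain v where "v \<in> K C" "v \<in> K D" by blast
    then have "fst (plane_pair 1 v) \<in> fst ` KK 1 C" "fst (plane_pair 1 v) \<in> fst ` KK 1 D" by (auto simp: KK_def)
    then show ?thesis using fst_image_body[OF KK(1)[OF CD(1), of 1]] fst_image_body[OF KK(1)[OF CD(2), of 1]] by auto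
  qed
  then have x0: "left_end (KK 1 C) \<le> x0 \<and> x0 \<le> right_end (KK 1 C)" if "C \<in> F" for C
    using that fin ne by (auto simp: x0_def)
  have reflect: "left_end (KK (- 1) C) = - right_end (KK 1 C) \<and> right_end (KK (- 1) C) = - left_end (KK 1 C)" if C: "C \<in> F" for C
  proof -
    have "fst ` KK (- 1) C = uminus ` fst ` KK 1 C" by (auto simp: KK_def plane_pair_def image_image)
    then have "{left_end (KK (- 1) C)..right_end (KK (- 1) C)} = {- right_end (KK 1 C)..- left_end (KK 1 C)}"
      using fst_image_body[OF KK(1)[OF C, of 1]] fst_image_body[OF KK(1)[OF C, of "- 1"]] by simp
    moreover have "- right_end (KK 1 C) \<le> - left_end (KK 1 C)" using x0[OF C] by linarith
    ultimately show ?thesis by (metis Icc_eq_Icc)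
  qed
  have fam: "curve_family F (KK \<sigma>) (\<sigma> * x0)" if \<sigma>: "\<sigma> = 1 \<or> \<sigma> = - 1" for \<sigma>
  proof
    have s0: "\<sigma> \<noteq> 0" using \<sigma> by auto
    show "finite F" by fact
    show "convex_body (KK \<sigma> C)" if "C \<in> F" for C using KK(1)[OF that s0] .
    show "left_end (KK \<sigma> C) \<le> \<sigma> * x0 \<and> \<sigma> * x0 \<le> right_end (KK \<sigma> C)" if "C \<in> F" for C
      using \<sigma> x0[OF that] reflect[OF that] by auto
    show "finite (frontier (KK \<sigma> C) \<inter> frontier (KK \<sigma> D))" if "C \<in> F" "D \<in> F" "C \<noteq> D" for C D
      using gp that inter[OF that(1,2) s0] by (auto simp: general_position_def)
    show "frontier (KK \<sigma> C) \<inter> frontier (KK \<sigma> D) \<inter> frontier (KK \<sigma> E) = {}"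
      if "C \<in> F" "D \<in> F" "E \<in> F" "C \<noteq> D" "C \<noteq> E" "D \<noteq> E" for C D E
    proof -
      have "C \<inter> D \<inter> E = {}" using gp that unfolding general_position_def by blast
      moreover have "frontier (KK \<sigma> C) \<inter> frontier (KK \<sigma> D) \<inter> frontier (KK \<sigma> E) = plane_pair \<sigma> ` (C \<inter> D \<inter> E)"
        using inter[OF that(1,2) s0] KK(2)[OF that(3) s0] plane_pair(2)[OF s0] by (simp add: image_Int bij_is_inj)
      ultimately show ?thesis by simp
    qed
  qed
  define n where "n = card F"
  define S where "S = (\<Sum>x\<in>{(C, D) \<in> F \<times> F. C \<noteq> D}. card (fst x \<inter> snd x))"
  define R where "R \<sigma> = {(C, D) \<in> F \<times> F. C \<noteq> D \<and> (\<exists>p. frontier (KK \<sigma> C) \<inter> frontier (KK \<sigma> D) = {p} \<and> \<sigma> * x0 \<le> fst p)}" for \<sigma>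
  have side: "real (card (R \<sigma>)) \<le> 8 * \<delta> * real S + 16 * \<delta> * (real n)^2 + (4 * B + 8) * real n" if \<sigma>: "\<sigma> = 1 \<or> \<sigma> = - 1" for \<sigma>
  proof -
    interpret curve_family F "KK \<sigma>" "\<sigma> * x0" by (rule fam[OF \<sigma>])
    have s0: "\<sigma> \<noteq> 0" using \<sigma> by auto
    have "(\<Sum>C\<in>F. \<Sum>D\<in>F. common C D) = (\<Sum>x\<in>F \<times> F. common (fst x) (snd x))"
      by (simp add: sum.cartesian_product split_def)
    also have "\<dots> = (\<Sum>x\<in>{(C, D) \<in> F \<times> F. C \<noteq> D}. common (fst x) (snd x))"
      by (rule sum.mono_neutral_right) (use fin in \<open>auto simp: common_def\<close>)
    also have "\<dots> = S"
      unfolding S_def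
    proof (rule sum.cong[OF refl])
      fix x assume "x \<in> {(C, D) \<in> F \<times> F. C \<noteq> D}"
      then have x: "fst x \<in> F" "snd x \<in> F" "fst x \<noteq> snd x" by auto
      show "common (fst x) (snd x) = card (fst x \<inter> snd x)"
        unfolding common_def inter[OF x(1,2) s0] using x(3)
        by (simp add: card_image[OF inj_on_subset[OF bij_is_inj[OF plane_pair(2)[OF s0]]]])
    qed
    finally have "card (crossings V last_time h) \<le> 4 * S + 8 * n^2"
      using card_crossings by (simp add: n_def)
    then have X: "real (card (crossings V last_time h)) \<le> 4 * real S + 8 * (real n)^2"
      by (metis (mono_tags) of_nat_le_iff of_nat_add of_nat_mult of_nat_numeral of_nat_power)
    have "card V = 2 * n" by (simp add: V_def n_def card_cartesian_product)
    then have "real (card (touches V last_time h)) \<le> \<delta> * real (card (crossings V last_time h)) + B * (2 * real n)"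
      using bound[OF system] by simp
    also have "\<delta> * real (card (crossings V last_time h)) \<le> \<delta> * (4 * real S + 8 * (real n)^2)"
      using X \<delta> by (rule mult_left_mono)
    finally have "real (card (touches V last_time h)) \<le> \<delta> * (4 * real S + 8 * (real n)^2) + B * (2 * real n)" by simp
    moreover have "real (card (R \<sigma>)) \<le> 2 * real (card (touches V last_time h)) + 8 * real n"
      using card_right_touching unfolding R_def n_def by linarith
    ultimately show ?thesis by (simp add: algebra_simps)
  qed
  have finR: "finite (R \<sigma>)" for \<sigma>
    by (rule finite_subset[of _ "F \<times> F"]) (use fin in \<open>auto simp: R_def\<close>)
  have "{(C, D) \<in> F \<times> F. C \<noteq> D \<and> (\<exists>p. C \<inter> D = {p})} \<subseteq> R 1 \<union> R (- 1)"
  proof clarify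
    fix C D p assume a: "C \<in> F" "D \<in> F" "C \<noteq> D" "C \<inter> D = {p}" "(C, D) \<notin> R (- 1)"
    have "frontier (KK \<sigma> C) \<inter> frontier (KK \<sigma> D) = {plane_pair \<sigma> p}" if "\<sigma> \<noteq> 0" for \<sigma>
      using inter[OF a(1,2) that] a(4) by simp
    note this[of 1] this[of "- 1"]
    then show "(C, D) \<in> R 1" using a by (auto simp: R_def plane_pair_def)
  qed
  then have "card {(C, D) \<in> F \<times> F. C \<noteq> D \<and> (\<exists>p. C \<inter> D = {p})} \<le> card (R 1 \<union> R (- 1))"
    using finR by (intro card_mono) auto
  also have "\<dots> \<le> card (R 1) + card (R (- 1))" by (rule card_Un_le)
  finally have "real (card {(C, D) \<in> F \<times> F. C \<noteq> D \<and> (\<exists>p. C \<inter> D = {p})}) \<le> real (card (R 1)) + real (card (R (- 1)))"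
    by linarith
  also have "\<dots> \<le> 2 * (8 * \<delta> * real S + 16 * \<delta> * (real n)^2 + (4 * B + 8) * real n)"
    using side[of 1] side[of "- 1"] by simp
  also have "\<dots> \<le> 32 * \<delta> * (real (card (intersection_points F)) + (real n)^2) + (8 * B + 16) * real n"
  proof -
    have "S \<le> 2 * card (intersection_points F)" unfolding S_def by (rule sum_common_le(2)[OF fin gp])
    then have "real S \<le> 2 * real (card (intersection_points F))" by linarith
    then have "\<delta> * real S \<le> \<delta> * (2 * real (card (intersection_points F)))" using \<delta> by (rule mult_left_mono)
    then show ?thesis by (simp add: algebra_simps)
  qed
  finally show ?thesis by (simp add: n_def)
qed

lemma intersection_points_lower_bound:
  fixes F :: "(real^2) set set"
  assumes fin: "finite F" and gp: "general_position F" and pw: "pairwise curves_intersect F"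
  shows "2 * (real (card F))^2 - 2 * real (card F) - real (card {(C, D) \<in> F \<times> F. C \<noteq> D \<and> (\<exists>p. C \<inter> D = {p})})
     \<le> 2 * real (card (intersection_points F))"
proof -
  define P where "P = {(C, D) \<in> F \<times> F. C \<noteq> D}"
  define T where "T = {(C, D) \<in> F \<times> F. C \<noteq> D \<and> (\<exists>p. C \<inter> D = {p})}"
  have finP: "finite P" by (rule finite_subset[of _ "F \<times> F"]) (use fin in \<open>auto simp: P_def\<close>)
  have TP: "T \<subseteq> P" by (auto simp: P_def T_def)
  have "F \<times> F = P \<union> (\<lambda>C. (C, C)) ` F" by (auto simp: P_def)
  then have "card F * card F = card (P \<union> (\<lambda>C. (C, C)) ` F)" by (metis card_cartesian_product)
  also have "\<dots> \<le> card P + card ((\<lambda>C. (C, C)) ` F)" by (rule card_Un_le)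
  also have "card ((\<lambda>C. (C, C)) ` F) \<le> card F" using fin by (rule card_image_le)
  finally have cP: "card F * card F \<le> card P + card F" by simp
  have "2 * card P = (\<Sum>x\<in>P. 2)" by simp
  also have "\<dots> \<le> (\<Sum>x\<in>P. card (fst x \<inter> snd x) + (if x \<in> T then 1 else 0))"
  proof (rule sum_mono)
    fix x assume x: "x \<in> P"
    then have CD: "fst x \<in> F" "snd x \<in> F" "fst x \<noteq> snd x" by (auto simp: P_def)
    then have ne: "fst x \<inter> snd x \<noteq> {}" and fi: "finite (fst x \<inter> snd x)"
      using pw gp by (auto simp: pairwise_def curves_intersect_def general_position_def)
    then have "card (fst x \<inter> snd x) \<noteq> 0" by simp
    moreover have "x \<in> T" if one: "card (fst x \<inter> snd x) = 1"
    proof -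
      obtain p where "fst x \<inter> snd x = {p}" using one by (rule card_1_singletonE)
      then show ?thesis using CD by (cases x) (simp add: T_def)
    qed
    ultimately show "2 \<le> card (fst x \<inter> snd x) + (if x \<in> T then 1 else 0)"
      by (cases "card (fst x \<inter> snd x) = 1") auto
  qed
  also have "\<dots> = (\<Sum>x\<in>P. card (fst x \<inter> snd x)) + card (P \<inter> T)"
    using finP by (simp add: sum.distrib sum.inter_restrict[symmetric])
  also have "P \<inter> T = T" using TP by auto
  also have "(\<Sum>x\<in>P. card (fst x \<inter> snd x)) \<le> 2 * card (intersection_points F)"
    unfolding P_def by (rule sum_common_le(2)[OF fin gp])
  finally have "2 * card P \<le> 2 * card (intersection_points F) + card T" by simp
  then have "2 * (card F * card F) \<le> 2 * card (intersection_points F) + card T + 2 * card F" using cP by linarith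
  then have "real (2 * (card F * card F)) \<le> real (2 * card (intersection_points F) + card T + 2 * card F)"
    by (simp only: of_nat_le_iff)
  then show ?thesis unfolding T_def[symmetric] by (simp add: power2_eq_square)
qed

theorem corollary2:
  fixes \<delta> :: real
  assumes "\<delta> > 0"
  shows "\<exists>n0::nat. \<forall>n\<ge>n0. \<forall>F :: (real^2) set set.
           finite F \<and> card F = n \<and> (\<forall>C\<in>F. closed_convex_curve C) \<and>
           general_position F \<and> pairwise curves_intersect F \<longrightarrow>
           real (card (intersection_points F)) \<ge> (1 - \<delta>) * (real n)\<^sup>2"
proof -
  \<comment> \<open>With \<open>I \<le> n^2\<close> the main term of
    \<open>card_touching_pairs\<close> is at most
    \<open>32 * \<delta>' * 2 n^2 = \<delta> n^2\<close>.\<close>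
  define \<delta>' where "\<delta>' = \<delta> / 64"
  have \<delta>': "0 < \<delta>'" using assms by (simp add: \<delta>'_def)
  obtain B where B: "0 \<le> B" and bound: "\<And>V m (h :: nat \<Rightarrow> (real^2) set \<times> bool \<Rightarrow> real). height_system V m h \<Longrightarrow>
      real (card (touches V m h)) \<le> \<delta>' * real (card (crossings V m h)) + B * real (card V)"
    using touches_linear_bound[OF \<delta>', where 'a = "(real^2) set \<times> bool"] by blast
  \<comment> \<open>Here \<open>18 = 16 + 2\<close> joins the linear term of the touching pairs and
    the \<open>2 n\<close> lost on the diagonal; from \<open>n0\<close> on this term is at most
    \<open>\<delta> n^2\<close>.\<close>
  obtain n0 :: nat where n0: "(8 * B + 18) / \<delta> < real n0" using reals_Archimedean2 by blast
  show ?thesis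
  proof (intro exI[of _ "max 1 n0"] allI impI)
    fix n and F :: "(real^2) set set"
    assume n: "max 1 n0 \<le> n" and F: "finite F \<and> card F = n \<and> (\<forall>C\<in>F. closed_convex_curve C) \<and>
           general_position F \<and> pairwise curves_intersect F"
    define I where "I = real (card (intersection_points F))"
    show "(1 - \<delta>) * (real n)^2 \<le> real (card (intersection_points F))"
    proof (cases "(real n)^2 \<le> I")
      case True
      have "(1 - \<delta>) * (real n)^2 \<le> 1 * (real n)^2" using assms by (intro mult_right_mono) auto
      then show ?thesis using True unfolding I_def by linarith
    next
      case False
      define T where "T = real (card {(C, D) \<in> F \<times> F. C \<noteq> D \<and> (\<exists>p. C \<inter> D = {p})})"
      have ne: "F \<noteq> {}" using F n by auto
      have "T \<le> 32 * \<delta>' * (I + (real n)^2) + (8 * B + 16) * real n"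
        using card_touching_pairs[OF _ ne _ _ _ less_imp_le[OF \<delta>'] bound] F by (simp add: T_def I_def)
      also have "32 * \<delta>' * (I + (real n)^2) \<le> 32 * \<delta>' * (2 * (real n)^2)"
        using False \<delta>' by (intro mult_left_mono) auto
      finally have T: "T \<le> \<delta> * (real n)^2 + (8 * B + 16) * real n" by (simp add: \<delta>'_def)
      have "2 * (real n)^2 - 2 * real n - T \<le> 2 * I"
        using intersection_points_lower_bound[of F] F by (simp add: T_def I_def)
      then have 1: "2 * I \<ge> 2 * (real n)^2 - \<delta> * (real n)^2 - (8 * B + 18) * real n"
        using T by (simp add: algebra_simps)
      have "8 * B + 18 \<le> \<delta> * real n0" using n0 assms by (simp add: field_simps)
      also have "\<dots> \<le> \<delta> * real n" using n assms by (intro mult_left_mono) auto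
      finally have "(8 * B + 18) * real n \<le> \<delta> * real n * real n" by (intro mult_right_mono) auto
      then show ?thesis using 1 by (simp add: I_def power2_eq_square algebra_simps)
    qed
  qed
qed

end
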